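(* For each $d=1,2,\dots$, each $\nu>1$, each $k=1,2,\dots$, and each $P\in\mathcal{V}_{d,\nu+d}$, the $t_\nu$ location and scatter functional $P'\mapsto(\mu_\nu,\Sigma_\nu)(P')$ is Fréchet $C^k$ at $P$ with respect to the norm $\|\cdot\|_{\mathcal{E}(2k+4,d)}$.
   Context: A law is a Borel probability measure. $\mathcal{P}_d$: symmetric strictly positive definite real $d\times d$ matrices. $\mathcal{V}_{d,a}$: laws $P$ on $\mathbb{R}^d$ with $P(J)<1-(d-q)/a$ for every affine subspace $J$ of $\mathbb{R}^d$ of dimension $q$, $0\le q\le d-1$. With $\rho_{\nu,d}(s)=\frac{\nu+d}{2}\log\frac{\nu+s}{\nu}$, for $\nu>1$ and $P\in\mathcal{V}_{d,\nu+d}$, $(\mu_\nu,\Sigma_\nu)(P)$ is the unique minimizer over $(\mu,\Sigma)\in\mathbb{R}^d\times\mathcal{P}_d$ of $\frac12\log\det\Sigma+\int\big(\rho_{\nu,d}((y-\mu)'\Sigma^{-1}(y-\mu))-\rho_{\nu,d}(y'y)\big)\,dP(y)$. $\mathcal{E}(r,d)$ is the collection of all sets $\{x\in\mathbb{R}^d:p(x)>0\}$ for all polynomials $p$ in $d$ variables of degree at most $r$. For a finite signed Borel measure $\phi$ on $\mathbb{R}^d$, $\|\phi\|_{\mathcal{E}(r,d)}=\sup_{E\in\mathcal{E}(r,d)}|\phi(E)|$. A functional $T$ defined on a set $\mathcal{D}$ of laws is Fréchet $C^k$ at $P\in\mathcal{D}$ with respect to a norm on finite signed measures if there are an open neighborhood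 of $P$ in the normed space of finite signed Borel measures and a (Fréchet) $C^k$ function on it which agrees with $T$ at all laws of $\mathcal{D}$ in that neighborhood. *)

theory Defs
  imports "HOL-Probability.Probability"
begin

section \<open>Finite signed Borel measures\<close>

text \<open>
  A finite signed Borel measure is a real-valued, countably additive function on the Borel sets;
  as a HOL function it is normalised to vanish on all other sets.
\<close>

definition is_signed_borel_measure :: "('a::topological_space set \<Rightarrow> real) \<Rightarrow> bool" where
  "is_signed_borel_measure f \<longleftrightarrow>
     (\<forall>A :: nat \<Rightarrow> 'a set. range A \<subseteq> sets borel \<longrightarrow> disjoint_family A \<longrightarrow>
        (\<lambda>i. f (A i)) sums f (\<Union>i. A i)) \<and>
     (\<forall>B. B \<notin> sets borel \<longrightarrow> f B = 0)"

typedef (overloaded) 'a::topological_space signed_measure =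
  "{f :: 'a set \<Rightarrow> real. is_signed_borel_measure f}"
  morphisms smeas Abs_signed_measure
  by (rule exI[of _ "\<lambda>_. 0"]) (simp add: is_signed_borel_measure_def)

setup_lifting type_definition_signed_measure

instantiation signed_measure :: (topological_space) real_vector
begin

lift_definition zero_signed_measure :: "'a signed_measure" is "\<lambda>_. 0"
  by (simp add: is_signed_borel_measure_def)

lift_definition plus_signed_measure ::
    "'a signed_measure \<Rightarrow> 'a signed_measure \<Rightarrow> 'a signed_measure" is "\<lambda>f g A. f A + g A"
  by (simp add: is_signed_borel_measure_def sums_add)

lift_definition minus_signed_measure ::
    "'a signed_measure \<Rightarrow> 'a signed_measure \<Rightarrow> 'a signed_measure" is "\<lambda>f g A. f A - g A"
  by (simp add: is_signed_borel_measure_def sums_diff)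

lift_definition uminus_signed_measure :: "'a signed_measure \<Rightarrow> 'a signed_measure"
  is "\<lambda>f A. - f A"
  by (simp add: is_signed_borel_measure_def sums_minus)

lift_definition scaleR_signed_measure :: "real \<Rightarrow> 'a signed_measure \<Rightarrow> 'a signed_measure"
  is "\<lambda>c f A. c * f A"
  by (simp add: is_signed_borel_measure_def sums_mult)

instance
  apply standard
         apply (simp_all only: smeas_inject[symmetric] fun_eq_iff plus_signed_measure.rep_eq
      minus_signed_measure.rep_eq uminus_signed_measure.rep_eq zero_signed_measure.rep_eq
      scaleR_signed_measure.rep_eq)
         apply (simp_all add: algebra_simps)
  done

end

text \<open>Signed measures are bounded, so the suprema used below are suprema of bounded sets.\<close>

lemma smeas_sums:
  fixes A :: "nat \<Rightarrow> 'a::topological_space set"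
  assumes "range A \<subseteq> sets borel" "disjoint_family A"
  shows "(\<lambda>i. smeas f (A i)) sums smeas f (\<Union>i. A i)"
  using smeas[of f] assms by (auto simp: is_signed_borel_measure_def)

lemma smeas_empty [simp]: "smeas f {} = 0"
proof -
  have "(\<lambda>i::nat. smeas f {}) sums smeas f (\<Union>i::nat. {})"
    by (rule smeas_sums) (auto simp: disjoint_family_on_def)
  then have "(\<lambda>i::nat. smeas f {}) \<longlonglongrightarrow> 0"
    by (intro summable_LIMSEQ_zero) (auto simp: sums_iff)
  then show ?thesis
    by (simp add: LIMSEQ_const_iff)
qed

lemma smeas_Un:
  assumes "A \<in> sets borel" "B \<in> sets borel" "A \<inter> B = {}"
  shows "smeas f (A \<union> B) = smeas f A + smeas f B"
proof -
  have "(\<lambda>i. smeas f (binaryset A B i)) sums smeas f (\<Union>i. binaryset A B i)"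
    by (rule smeas_sums)
      (use assms in \<open>auto simp: disjoint_family_on_def binaryset_def\<close>)
  moreover have "(\<lambda>i. smeas f (binaryset A B i)) sums (smeas f A + smeas f B)"
    by (rule binaryset_sums) simp
  ultimately show ?thesis
    by (simp add: UN_binaryset_eq sums_unique2)
qed

lemma smeas_bounded:
  fixes f :: "'a::topological_space signed_measure"
  shows "\<exists>C. \<forall>A. \<bar>smeas f A\<bar> \<le> C"
proof -
  define bad where "bad A \<longleftrightarrow> A \<in> sets borel \<and>
    \<not> (\<exists>C. \<forall>B. B \<in> sets borel \<longrightarrow> B \<subseteq> A \<longrightarrow> \<bar>smeas f B\<bar> \<le> C)" for A :: "'a set"
  have step: "\<exists>A'. bad A' \<and> A' \<subseteq> A \<and> \<bar>smeas f (A - A')\<bar> > 1" if "bad A" for A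
  proof -
    have A: "A \<in> sets borel" using that by (simp add: bad_def)
    obtain B where B: "B \<in> sets borel" "B \<subseteq> A" "\<bar>smeas f B\<bar> > 1 + \<bar>smeas f A\<bar>"
      using \<open>bad A\<close> unfolding bad_def by (metis linorder_not_le)
    have AB: "A - B \<in> sets borel" using A B by auto
    have "smeas f A = smeas f B + smeas f (A - B)"
      using smeas_Un[of B "A - B" f] B AB by (simp add: Un_absorb1)
    then have 2: "\<bar>smeas f (A - B)\<bar> > 1" using B(3) by linarith
    have "bad B \<or> bad (A - B)"
    proof (rule ccontr)
      assume "\<not> ?thesis"
      then obtain C1 C2
        where C1: "\<And>E. E \<in> sets borel \<Longrightarrow> E \<subseteq> B \<Longrightarrow> \<bar>smeas f E\<bar> \<le> C1"
          and C2: "\<And>E. E \<in> sets borel \<Longrightarrow> E \<subseteq> A - B \<Longrightarrow> \<bar>smeas f E\<bar> \<le> C2"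
        using B AB unfolding bad_def by blast
      have "\<bar>smeas f E\<bar> \<le> C1 + C2" if E: "E \<in> sets borel" "E \<subseteq> A" for E
      proof -
        have "smeas f E = smeas f (E \<inter> B) + smeas f (E - B)"
          using smeas_Un[of "E \<inter> B" "E - B" f] E B by (simp add: Int_Diff_Un Int_Diff_disjoint)
        moreover have "\<bar>smeas f (E \<inter> B)\<bar> \<le> C1" "\<bar>smeas f (E - B)\<bar> \<le> C2"
          using C1[of "E \<inter> B"] C2[of "E - B"] E B by auto
        ultimately show ?thesis by linarith
      qed
      then show False using \<open>bad A\<close> unfolding bad_def by blast
    qed
    then show ?thesis
    proof
      assume "bad B" then show ?thesis using B 2 by blast
    next
      assume "bad (A - B)"
      moreover have "A - (A - B) = B" using B by auto
      ultimately show ?thesis using B by (intro exI[of _ "A - B"]) auto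
    qed
  qed
  have "\<not> bad UNIV"
  proof
    assume "bad UNIV"
    obtain g where g: "\<And>A. bad A \<Longrightarrow> bad (g A) \<and> g A \<subseteq> A \<and> \<bar>smeas f (A - g A)\<bar> > 1"
      using step by metis
    define S where "S n = (g ^^ n) UNIV" for n
    have S1: "bad (S n)" for n
      by (induction n) (use \<open>bad UNIV\<close> g in \<open>simp_all add: S_def\<close>)
    have S2: "S (Suc n) \<subseteq> S n" "\<bar>smeas f (S n - S (Suc n))\<bar> > 1" for n
      using g[OF S1[of n]] by (simp_all add: S_def)
    have anti: "S n \<subseteq> S m" if "m \<le> n" for m n
      using lift_Suc_antimono_le[of S m n] S2(1) that by simp
    define D where "D n = S n - S (Suc n)" for n
    have disj: "D m \<inter> D n = {}" if "m < n" for m n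
      using anti[of "Suc m" n] that by (auto simp: D_def)
    have "disjoint_family D"
      unfolding disjoint_family_on_def by (metis disj inf_commute linorder_neq_iff)
    moreover have "range D \<subseteq> sets borel"
      using S1 by (auto simp: D_def bad_def)
    ultimately have "(\<lambda>n. smeas f (D n)) \<longlonglongrightarrow> 0"
      using smeas_sums[of D f] by (intro summable_LIMSEQ_zero) (auto simp: sums_iff)
    then have "\<forall>\<^sub>F n in sequentially. norm (smeas f (D n)) < 1"
      by (auto simp: tendsto_iff)
    then obtain n where "norm (smeas f (D n)) < 1"
      by (auto simp: eventually_sequentially)
    then show False using S2(2)[of n] by (simp add: D_def)
  qed
  then obtain C where C: "\<And>B. B \<in> sets borel \<Longrightarrow> \<bar>smeas f B\<bar> \<le> C"
    unfolding bad_def by auto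
  have "\<bar>smeas f B\<bar> \<le> \<bar>C\<bar>" for B
  proof (cases "B \<in> sets borel")
    case True
    then show ?thesis using C[of B] by linarith
  next
    case False
    then show ?thesis using smeas[of f] by (simp add: is_signed_borel_measure_def)
  qed
  then show ?thesis by blast
qed


section \<open>Laws\<close>

definition law :: "'a::topological_space measure \<Rightarrow> bool" where
  "law P \<longleftrightarrow> prob_space P \<and> sets P = sets borel"

definition signed_of :: "'a::topological_space measure \<Rightarrow> 'a signed_measure" where
  "signed_of P = Abs_signed_measure (measure P)"

lemma smeas_signed_of:
  assumes "law P"
  shows "smeas (signed_of P) = measure P"
proof -
  interpret prob_space P using assms by (simp add: law_def)
  have "is_signed_borel_measure (measure P)"
    using assms finite_measure_UNION
    by (auto simp: is_signed_borel_measure_def law_def measure_notin_sets)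
  then show ?thesis
    by (simp add: signed_of_def Abs_signed_measure_inverse)
qed

definition V_laws :: "real \<Rightarrow> (real ^ 'd) measure set" where
  "V_laws a = {P. law P \<and>
     (\<forall>q < CARD('d). \<forall>J. affine J \<and> aff_dim J = int q \<longrightarrow>
        measure P J < 1 - (real CARD('d) - real q) / a)}"


section \<open>The norms given by positivity sets of polynomials\<close>

text \<open>Multi-indices are functions \<open>'d \<Rightarrow> nat\<close>; there are finitely many of each degree.\<close>

lemma finite_multiindices: "finite {\<alpha> :: 'd::finite \<Rightarrow> nat. sum \<alpha> UNIV \<le> r}"
proof (rule finite_subset)
  have "\<alpha> i \<le> r" if "sum \<alpha> UNIV \<le> r" for \<alpha> :: "'d \<Rightarrow> nat" and i
    using that member_le_sum[of i UNIV \<alpha>] by simp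
  then show "{\<alpha> :: 'd \<Rightarrow> nat. sum \<alpha> UNIV \<le> r} \<subseteq> PiE UNIV (\<lambda>_. {..r})"
    by (simp add: PiE_UNIV_domain subset_eq)
  show "finite (PiE (UNIV :: 'd set) (\<lambda>_. {..r}))"
    by (rule finite_PiE) simp_all
qed

definition poly_fun_le :: "nat \<Rightarrow> (real ^ 'd \<Rightarrow> real) \<Rightarrow> bool" where
  "poly_fun_le r p \<longleftrightarrow> (\<exists>c :: ('d \<Rightarrow> nat) \<Rightarrow> real.
     \<forall>x. p x = (\<Sum>\<alpha> | sum \<alpha> UNIV \<le> r. c \<alpha> * (\<Prod>i\<in>UNIV. (x $ i) ^ \<alpha> i)))"

definition poly_pos_sets :: "nat \<Rightarrow> (real ^ 'd) set set" where
  "poly_pos_sets r = {{x. p x > 0} | p. poly_fun_le r p}"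

definition poly_norm :: "nat \<Rightarrow> (real ^ 'd) signed_measure \<Rightarrow> real" where
  "poly_norm r \<phi> = (SUP E \<in> poly_pos_sets r. \<bar>smeas \<phi> E\<bar>)"


section \<open>\<open>C\<^sup>k\<close> functions with respect to an explicitly given norm\<close>

text \<open>
  The norm on the domain is an argument \<open>N\<close>, since the same vector space carries a
  family of norms. The \<open>j\<close>-th derivative at a point is a bounded \<open>j\<close>-linear map, represented as a
  function on lists of length \<open>j\<close>.
\<close>

definition open_wrt :: "('x::real_vector \<Rightarrow> real) \<Rightarrow> 'x set \<Rightarrow> bool" where
  "open_wrt N U \<longleftrightarrow> (\<forall>x\<in>U. \<exists>\<delta>>0. \<forall>y. N (y - x) < \<delta> \<longrightarrow> y \<in> U)"

definition multi_bound ::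
    "('x \<Rightarrow> real) \<Rightarrow> nat \<Rightarrow> ('x list \<Rightarrow> 'y::real_normed_vector) \<Rightarrow> real \<Rightarrow> bool" where
  "multi_bound N j L C \<longleftrightarrow> (\<forall>vs. length vs = j \<longrightarrow> norm (L vs) \<le> C * prod_list (map N vs))"

definition bounded_multilinear ::
    "('x::real_vector \<Rightarrow> real) \<Rightarrow> nat \<Rightarrow> ('x list \<Rightarrow> 'y::real_normed_vector) \<Rightarrow> bool" where
  "bounded_multilinear N j L \<longleftrightarrow>
     (\<forall>vs i. length vs = j \<longrightarrow> i < j \<longrightarrow> linear (\<lambda>v. L (vs[i := v]))) \<and>
     (\<exists>C. multi_bound N j L C)"

text \<open>
  Under the isometry between bounded \<open>(j+1)\<close>-linear maps and bounded linear maps into the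
  \<open>j\<close>-linear ones, the derivative of \<open>D j\<close> at \<open>x\<close> in the direction \<open>h\<close> is
  \<open>\<lambda>vs. D (Suc j) x (h # vs)\<close>. Both the remainder and the continuity of \<open>D k\<close> are measured in
  the operator norm of multilinear maps.
\<close>

definition Ck_on_wrt ::
    "nat \<Rightarrow> ('x::real_vector \<Rightarrow> real) \<Rightarrow> 'x set \<Rightarrow> ('x \<Rightarrow> 'y::real_normed_vector) \<Rightarrow> bool" where
  "Ck_on_wrt k N U F \<longleftrightarrow> (\<exists>D :: nat \<Rightarrow> 'x \<Rightarrow> 'x list \<Rightarrow> 'y.
     (\<forall>x\<in>U. D 0 x [] = F x) \<and>
     (\<forall>j\<le>k. \<forall>x\<in>U. bounded_multilinear N j (D j x)) \<and>
     (\<forall>j<k. \<forall>x\<in>U. \<forall>\<epsilon>>0. \<exists>\<delta>>0. \<forall>u\<in>U. N (u - x) < \<delta> \<longrightarrow>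
        multi_bound N j (\<lambda>vs. D j u vs - D j x vs - D (Suc j) x ((u - x) # vs)) (\<epsilon> * N (u - x))) \<and>
     (\<forall>x\<in>U. \<forall>\<epsilon>>0. \<exists>\<delta>>0. \<forall>u\<in>U. N (u - x) < \<delta> \<longrightarrow>
        multi_bound N k (\<lambda>vs. D k u vs - D k x vs) \<epsilon>))"

definition frechet_Ck_at ::
    "nat \<Rightarrow> ('a::topological_space signed_measure \<Rightarrow> real) \<Rightarrow> 'a measure set \<Rightarrow>
     ('a measure \<Rightarrow> 'y::real_normed_vector) \<Rightarrow> 'a measure \<Rightarrow> bool" where
  "frechet_Ck_at k N \<D> T P \<longleftrightarrow> (\<exists>U F.
     open_wrt N U \<and> signed_of P \<in> U \<and> Ck_on_wrt k N U F \<and>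
     (\<forall>Q\<in>\<D>. signed_of Q \<in> U \<longrightarrow> F (signed_of Q) = T Q))"


section \<open>The \<open>t\<^sub>\<nu>\<close> location and scatter functional\<close>

definition pos_def_mats :: "(real ^ 'd ^ 'd) set" where
  "pos_def_mats = {\<Sigma>. transpose \<Sigma> = \<Sigma> \<and> (\<forall>x. x \<noteq> 0 \<longrightarrow> x \<bullet> (\<Sigma> *v x) > 0)}"

definition rho :: "real \<Rightarrow> nat \<Rightarrow> real \<Rightarrow> real" where
  "rho \<nu> d s = (\<nu> + real d) / 2 * ln ((\<nu> + s) / \<nu>)"

definition t_objective ::
    "real \<Rightarrow> (real ^ 'd) measure \<Rightarrow> (real ^ 'd) \<times> (real ^ 'd ^ 'd) \<Rightarrow> real" where
  "t_objective \<nu> P = (\<lambda>(\<mu>, \<Sigma>).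
     1 / 2 * ln (det \<Sigma>) +
     (LINT y|P. rho \<nu> CARD('d) ((y - \<mu>) \<bullet> (matrix_inv \<Sigma> *v (y - \<mu>))) - rho \<nu> CARD('d) (y \<bullet> y)))"

text \<open>
  For \<open>\<nu> > 1\<close> and \<open>P \<in> V_laws (\<nu> + d)\<close> exactly one minimiser exists; other arguments are irrelevant.
\<close>

definition t_functional ::
    "real \<Rightarrow> (real ^ 'd) measure \<Rightarrow> (real ^ 'd) \<times> (real ^ 'd ^ 'd)" where
  "t_functional \<nu> P = (THE \<theta>. is_arg_min (t_objective \<nu> P) (\<lambda>\<theta>. \<theta> \<in> UNIV \<times> pos_def_mats) \<theta>)"

end

theory Submission
  imports Defs
begin

text \<open>
  Adjoin a coordinate 1 to every observation \<open>y\<close> and call the result \<open>z\<close>. Location and scatter are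
  then encoded by a single positive definite matrix \<open>B\<close> of size \<open>d + 1\<close>, the inverse of the moment
  matrix with blocks \<open>\<Sigma> + \<mu>\<mu>'\<close>, \<open>\<mu>\<close>, \<open>\<mu>'\<close> and 1. With \<open>c = \<nu> - 1\<close> and \<open>a = \<nu> + d\<close> the objective of the
  functional becomes minus half the log determinant of \<open>B\<close> plus \<open>a / 2\<close> times the integral of
  \<open>log ((c + z'Bz) / (c + |z|\<^sup>2))\<close>, restricted to such \<open>B\<close> (\<open>t_objective_eq\<close>). On all positive definite
  \<open>B\<close> this function is easier to handle than in terms of \<open>\<mu>\<close> and \<open>\<Sigma>\<close>. Its critical points are the
  solutions of \<open>B S = 1\<close>, where \<open>S\<close> is \<open>a\<close> times the integral of \<open>zz' / (c + z'Bz)\<close>. For a law the trace of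
  this equation forces the corner entry of \<open>S\<close> to be 1 (\<open>critical_corner\<close>), so that a critical point
  always comes from a location and a scatter, and these are read off the entries of \<open>S\<close>.

  A critical point is the unique minimiser: after diagonalising two positive definite matrices
  simultaneously this is concavity of the logarithm (\<open>critical_point_strict_minimum\<close>). A critical point
  exists because the mass condition on affine subspaces makes the function coercive
  (\<open>scatter_coercive\<close>, \<open>critical_point_exists\<close>).

  The equation \<open>B S = 1\<close> makes sense for signed measures and is affine in the measure. Differentiating the
  integrand \<open>m - 1\<close> times in \<open>B\<close> gives products of \<open>m\<close> quadratic forms divided by the \<open>m\<close>-th power of
  \<open>c + z'Bz\<close>. These functions are bounded and their superlevel sets are positivity sets of polynomials of
  degree \<open>2 m\<close>, so by the layer cake formula their integrals are bounded by the seminorm of that degree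
  (\<open>sint_poly_norm_bound\<close>, \<open>J_bound\<close>). The linearised equation is nonsingular at a critical point by the
  Cauchy--Schwarz inequality (\<open>critical_point_nondegenerate\<close>), and a contraction argument produces a branch
  of solutions over a ball of signed measures (\<open>implicit_branch_exists\<close>). The branch and the resulting
  matrix \<open>S\<close> have \<open>k + 1\<close> bounded directional derivatives, for which products of up to \<open>k + 2\<close> forms, that
  is degree \<open>2 k + 4\<close>, are needed (\<open>smooth_branch\<close>). By the mean value theorem this is enough for being
  \<open>C\<^sup>k\<close> (\<open>smooth_imp_Ck_on_wrt\<close>). At every law of the class in the ball, the location and scatter read off
  the branch are the functional, by the uniqueness of the minimiser (\<open>t_functional_eq\<close>).
\<close>

section \<open>Integration against a signed measure\<close>

text \<open>
  The positive part of the Jordan decomposition. As a supremum over subsets it is additive and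
  finite for elementary reasons.
\<close>

definition upper_var :: "'a::topological_space signed_measure \<Rightarrow> 'a set \<Rightarrow> ennreal" where
  "upper_var f A = (SUP B\<in>{B \<in> sets borel. B \<subseteq> A}. ennreal (smeas f B))"

definition pos_var :: "'a::topological_space signed_measure \<Rightarrow> 'a measure" where
  "pos_var f = measure_of UNIV (sets borel) (upper_var f)"

lemma upper_var_upper: "B \<in> sets borel \<Longrightarrow> B \<subseteq> A \<Longrightarrow> ennreal (smeas f B) \<le> upper_var f A"
  unfolding upper_var_def by (intro SUP_upper) auto

lemma upper_var_mono: "A \<subseteq> B \<Longrightarrow> upper_var f A \<le> upper_var f B"
  unfolding upper_var_def by (intro SUP_subset_mono) auto

text \<open>
  Two disjoint subsets can be combined after discarding any of negative mass.
\<close>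

lemma upper_var_superadd:
  assumes "X \<in> sets borel" "Y \<in> sets borel" "X \<inter> Y = {}"
  shows "upper_var f X + upper_var f Y \<le> upper_var f (X \<union> Y)"
proof -
  have key: "ennreal (smeas f B) + ennreal (smeas f C) \<le> upper_var f (X \<union> Y)"
    if B: "B \<in> sets borel" "B \<subseteq> X" and C: "C \<in> sets borel" "C \<subseteq> Y" for B C
  proof -
    consider "smeas f B \<le> 0" | "smeas f C \<le> 0" | "smeas f B > 0" "smeas f C > 0" by linarith
    then show ?thesis
    proof cases
      case 1 then show ?thesis using upper_var_upper[of C "X \<union> Y" f] C by (auto simp: ennreal_neg)
    next
      case 2 then show ?thesis using upper_var_upper[of B "X \<union> Y" f] B by (auto simp: ennreal_neg)
    next
      case 3
      have "smeas f (B \<union> C) = smeas f B + smeas f C"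
        using B C assms by (intro smeas_Un) auto
      then have "ennreal (smeas f B) + ennreal (smeas f C) = ennreal (smeas f (B \<union> C))"
        using 3 by (simp add: ennreal_plus)
      also have "\<dots> \<le> upper_var f (X \<union> Y)" using B C by (intro upper_var_upper) auto
      finally show ?thesis .
    qed
  qed
  have "upper_var f X + ennreal (smeas f C) \<le> upper_var f (X \<union> Y)"
    if C: "C \<in> sets borel" "C \<subseteq> Y" for C
    unfolding upper_var_def[of f X]
    by (subst ennreal_SUP_add_left[symmetric]) (auto intro!: SUP_least key C)
  then show ?thesis
    unfolding upper_var_def[of f Y]
    by (subst ennreal_SUP_add_right) (auto intro!: SUP_least)
qed

lemma upper_var_countably_additive: "countably_additive (sets borel) (upper_var f)"
  unfolding countably_additive_def
proof (intro allI impI)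
  fix A :: "nat \<Rightarrow> 'a set"
  assume A: "range A \<subseteq> sets borel" "disjoint_family A" "\<Union> (range A) \<in> sets borel"
  show "(\<Sum>i. upper_var f (A i)) = upper_var f (\<Union> (range A))"
  proof (rule antisym)
    have fin: "(\<Sum>i<n. upper_var f (A i)) \<le> upper_var f (\<Union>i<n. A i)" for n
    proof (induction n)
      case (Suc n)
      have "(\<Sum>i<Suc n. upper_var f (A i)) \<le> upper_var f (\<Union>i<n. A i) + upper_var f (A n)"
        by (subst sum.lessThan_Suc) (rule add_right_mono[OF Suc.IH])
      also have "\<dots> \<le> upper_var f ((\<Union>i<n. A i) \<union> A n)"
      proof (intro upper_var_superadd)
        have "A i \<inter> A n = {}" if "i < n" for i
          using A(2) that by (simp add: disjoint_family_on_def)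
        then show "(\<Union>i<n. A i) \<inter> A n = {}" by blast
        show "A n \<in> sets borel" "(\<Union>i<n. A i) \<in> sets borel" using A(1) by auto
      qed
      also have "(\<Union>i<n. A i) \<union> A n = (\<Union>i<Suc n. A i)" by (auto simp: less_Suc_eq)
      finally show ?case .
    qed simp
    show "(\<Sum>i. upper_var f (A i)) \<le> upper_var f (\<Union> (range A))"
      by (intro suminf_le_const order_trans[OF fin] upper_var_mono) auto
    show "upper_var f (\<Union> (range A)) \<le> (\<Sum>i. upper_var f (A i))"
      unfolding upper_var_def[of f "\<Union> (range A)"]
    proof (rule SUP_least, clarify)
      fix B assume B: "B \<in> sets borel" "B \<subseteq> \<Union> (range A)"
      have "(\<lambda>i. smeas f (B \<inter> A i)) sums smeas f (\<Union>i. B \<inter> A i)"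
        using A B by (intro smeas_sums) (auto simp: disjoint_family_on_def)
      moreover have "(\<Union>i. B \<inter> A i) = B" using B by auto
      ultimately have "(\<lambda>n. ennreal (\<Sum>i<n. smeas f (B \<inter> A i))) \<longlonglongrightarrow> ennreal (smeas f B)"
        by (intro tendsto_ennrealI) (simp add: sums_def)
      moreover have "ennreal (\<Sum>i<n. smeas f (B \<inter> A i)) \<le> (\<Sum>i. upper_var f (A i))" for n
      proof -
        have "(\<Sum>i<n. smeas f (B \<inter> A i)) \<le> (\<Sum>i<n. max 0 (smeas f (B \<inter> A i)))"
          by (intro sum_mono) auto
        then have "ennreal (\<Sum>i<n. smeas f (B \<inter> A i)) \<le> (\<Sum>i<n. ennreal (max 0 (smeas f (B \<inter> A i))))"
          by (subst sum_ennreal) (auto intro: ennreal_leI)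
        also have "\<dots> \<le> (\<Sum>i<n. upper_var f (A i))"
        proof (intro sum_mono)
          fix i
          have "ennreal (smeas f (B \<inter> A i)) \<le> upper_var f (A i)"
            using A B by (intro upper_var_upper) auto
          then show "ennreal (max 0 (smeas f (B \<inter> A i))) \<le> upper_var f (A i)"
            by (auto simp: max_def)
        qed
        also have "\<dots> \<le> (\<Sum>i. upper_var f (A i))" by (rule sum_le_suminf) auto
        finally show ?thesis .
      qed
      ultimately show "ennreal (smeas f B) \<le> (\<Sum>i. upper_var f (A i))"
        by (intro LIMSEQ_le_const2) auto
    qed
  qed
qed

lemma sets_pos_var [simp]: "sets (pos_var f) = sets borel"
  and space_pos_var [simp]: "space (pos_var f) = UNIV"
  using sets.sigma_sets_eq[of borel] by (auto simp: pos_var_def)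

lemma measurable_pos_var [simp]: "measurable (pos_var f) M = measurable borel M"
  by (rule measurable_cong_sets) simp_all

lemma emeasure_pos_var:
  assumes "A \<in> sets borel" shows "emeasure (pos_var f) A = upper_var f A"
proof (rule emeasure_measure_of[OF pos_var_def])
  show "positive (sets (pos_var f)) (upper_var f)"
    by (auto simp: positive_def upper_var_def SUP_eq_iff)
  show "countably_additive (sets (pos_var f)) (upper_var f)"
    using upper_var_countably_additive by simp
qed (use assms in auto)

lemma finite_measure_pos_var: "finite_measure (pos_var f)"
proof
  obtain C where C: "\<And>A. \<bar>smeas f A\<bar> \<le> C" using smeas_bounded by blast
  have "upper_var f UNIV \<le> ennreal C"
    unfolding upper_var_def by (intro SUP_least ennreal_leI) (use C abs_le_D1 in blast)
  then show "emeasure (pos_var f) (space (pos_var f)) \<noteq> \<infinity>"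
    using emeasure_pos_var[of UNIV f] by (auto simp: top_unique)
qed

text \<open>
  Together with the next lemma this characterises the positive part inside the reals.
\<close>

lemma pos_var_upper:
  assumes "A \<in> sets borel" "B \<in> sets borel" "B \<subseteq> A"
  shows "smeas f B \<le> measure (pos_var f) A"
proof -
  interpret finite_measure "pos_var f" by (rule finite_measure_pos_var)
  have "ennreal (smeas f B) \<le> ennreal (measure (pos_var f) A)"
    using upper_var_upper[OF assms(2,3), of f] emeasure_pos_var[OF assms(1), of f]
    by (simp add: emeasure_eq_measure)
  then show ?thesis by (simp add: ennreal_le_iff)
qed

lemma pos_var_least:
  assumes "A \<in> sets borel" "\<And>B. B \<in> sets borel \<Longrightarrow> B \<subseteq> A \<Longrightarrow> smeas f B \<le> c"
  shows "measure (pos_var f) A \<le> c"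
proof -
  interpret finite_measure "pos_var f" by (rule finite_measure_pos_var)
  have c: "0 \<le> c" using assms(2)[of "{}"] by simp
  have "upper_var f A \<le> ennreal c"
    unfolding upper_var_def by (intro SUP_least ennreal_leI) (use assms in auto)
  then have "ennreal (measure (pos_var f) A) \<le> ennreal c"
    using emeasure_pos_var[OF assms(1), of f] by (simp add: emeasure_eq_measure)
  then show ?thesis using c by simp
qed

text \<open>
  Passing from a subset to its complement in \<^term>\<open>A\<close> exchanges the positive parts of
  \<^term>\<open>f\<close> and of its negative at the cost of \<^term>\<open>smeas f A\<close>.
\<close>

lemma jordan_decomposition:
  assumes A: "A \<in> sets borel"
  shows "smeas f A = measure (pos_var f) A - measure (pos_var (- f)) A"
proof -
  have le: "measure (pos_var f) A \<le> smeas f A + measure (pos_var (- f)) A" for f :: "'a signed_measure"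
  proof (rule pos_var_least[OF A])
    fix B assume B: "B \<in> sets borel" "B \<subseteq> A"
    have "smeas f (B \<union> (A - B)) = smeas f B + smeas f (A - B)"
      using A B by (intro smeas_Un) auto
    moreover have "smeas (- f) (A - B) \<le> measure (pos_var (- f)) A"
      using A B by (intro pos_var_upper) auto
    moreover have "B \<union> (A - B) = A" using B by auto
    ultimately show "smeas f B \<le> smeas f A + measure (pos_var (- f)) A"
      by (simp add: uminus_signed_measure.rep_eq)
  qed
  show ?thesis using le[of f] le[of "- f"] by (simp add: uminus_signed_measure.rep_eq)
qed

text \<open>
  The integral is used for bounded Borel functions only.
\<close>

definition sint :: "'a::topological_space signed_measure \<Rightarrow> ('a \<Rightarrow> real) \<Rightarrow> real" where
  "sint f g = (LINT x|pos_var f. g x) - (LINT x|pos_var (- f). g x)"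

lemma bounded_integrable:
  fixes g :: "'a \<Rightarrow> real"
  assumes "finite_measure M" "g \<in> borel_measurable M" "\<And>x. \<bar>g x\<bar> \<le> K"
  shows "integrable M g"
  using assms by (intro finite_measure.integrable_const_bound[of M _ K]) auto

text \<open>
  Fubini for the region below the graph.
\<close>

lemma layer_cake:
  fixes g :: "'a \<Rightarrow> real" and K :: real
  assumes M: "finite_measure M" and g [measurable]: "g \<in> borel_measurable M"
    and b: "\<And>x. x \<in> space M \<Longrightarrow> 0 \<le> g x" "\<And>x. x \<in> space M \<Longrightarrow> g x \<le> K"
  shows "set_integrable lborel {0..K} (\<lambda>t. measure M {x \<in> space M. t < g x})"
    and "(LINT x|M. g x) = (LINT t:{0..K}|lborel. measure M {x \<in> space M. t < g x})"
proof -
  interpret M: finite_measure M by fact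
  interpret pair_sigma_finite M lborel ..
  define h :: "'a \<Rightarrow> real \<Rightarrow> real" where "h x t = indicator {0..K} t * indicator {..<g x} t" for x t
  define S where "S = {p \<in> space (M \<Otimes>\<^sub>M lborel). snd p \<in> {0..K} \<and> snd p < g (fst p)}"
  have S [measurable]: "S \<in> sets (M \<Otimes>\<^sub>M lborel)" unfolding S_def by measurable
  have "emeasure (M \<Otimes>\<^sub>M lborel) S \<le> emeasure (M \<Otimes>\<^sub>M lborel) (space M \<times> {0..K})"
    by (intro emeasure_mono) (auto simp: S_def space_pair_measure)
  also have "\<dots> = emeasure M (space M) * emeasure lborel {0..K}"
    by (intro lborel.emeasure_pair_measure_Times) auto
  also have "\<dots> < \<infinity>"
    by (auto simp: ennreal_mult_less_top M.emeasure_eq_measure emeasure_lborel_Icc_eq)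
  finally have "integrable (M \<Otimes>\<^sub>M lborel) (indicator S :: _ \<Rightarrow> real)"
    by (intro integrable_real_indicator S)
  also have "?this \<longleftrightarrow> integrable (M \<Otimes>\<^sub>M lborel) (case_prod h)"
    by (intro Bochner_Integration.integrable_cong) (auto simp: S_def h_def space_pair_measure indicator_def)
  finally have int: "integrable (M \<Otimes>\<^sub>M lborel) (case_prod h)" .
  have in1: "(LINT x|M. h x t) = indicator {0..K} t *\<^sub>R measure M {x \<in> space M. t < g x}" for t
  proof -
    have "(LINT x|M. h x t) = (LINT x|M. indicator {0..K} t * indicator {x \<in> space M. t < g x} x)"
      by (intro Bochner_Integration.integral_cong) (auto simp: h_def indicator_def)
    then show ?thesis by simp
  qed
  have in2: "(LINT t|lborel. h x t) = g x" if "x \<in> space M" for x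
  proof -
    have "(LINT t|lborel. h x t) = (LINT t|lborel. indicator {0..<g x} t)"
      using b[OF that] by (intro Bochner_Integration.integral_cong) (auto simp: h_def indicator_def)
    then show ?thesis using b[OF that] by simp
  qed
  show "set_integrable lborel {0..K} (\<lambda>t. measure M {x \<in> space M. t < g x})"
    using integrable_snd[OF int] unfolding set_integrable_def in1 .
  have "(LINT x|M. g x) = (LINT x|M. LINT t|lborel. h x t)"
    by (intro Bochner_Integration.integral_cong) (auto simp: in2)
  also have "\<dots> = (LINT t|lborel. LINT x|M. h x t)"
    by (rule Fubini_integral[OF int, symmetric])
  also have "\<dots> = (LINT t:{0..K}|lborel. measure M {x \<in> space M. t < g x})"
    unfolding in1 set_lebesgue_integral_def ..
  finally show "(LINT x|M. g x) = (LINT t:{0..K}|lborel. measure M {x \<in> space M. t < g x})" .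
qed

lemma layer_cake_shifted:
  fixes g :: "'a::topological_space \<Rightarrow> real"
  assumes M: "finite_measure M" and sM: "sets M = sets borel"
    and g: "g \<in> borel_measurable borel" and b: "\<And>x. \<bar>g x\<bar> \<le> K"
  shows "set_integrable lborel {0..2*K} (\<lambda>t. measure M {x. t - K < g x})"
    and "(LINT x|M. g x) = (LINT t:{0..2*K}|lborel. measure M {x. t - K < g x}) - K * measure M UNIV"
proof -
  have sp: "space M = UNIV" using sets_eq_imp_space_eq[OF sM] by simp
  have gM: "g \<in> borel_measurable M" using g sM measurable_cong_sets by blast
  have eq: "{x \<in> space M. t < g x + K} = {x. t - K < g x}" for t by (auto simp: sp algebra_simps)
  have 1: "0 \<le> g x + K" "g x + K \<le> 2 * K" for x using b[of x] by (auto simp: abs_le_iff)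
  note lc = layer_cake[OF M borel_measurable_add[OF gM borel_measurable_const] 1, unfolded eq]
  show "set_integrable lborel {0..2*K} (\<lambda>t. measure M {x. t - K < g x})" using lc(1) .
  have "(LINT x|M. g x + K) = (LINT x|M. g x) + K * measure M UNIV"
    using bounded_integrable[OF M gM b] M
    by (subst Bochner_Integration.integral_add) (auto simp: sp finite_measure.integrable_const)
  then show "(LINT x|M. g x) = (LINT t:{0..2*K}|lborel. measure M {x. t - K < g x}) - K * measure M UNIV"
    using lc(2) by simp
qed

text \<open>
  The integral depends on the measure only through its values on the superlevel sets of the
  integrand. Linearity in the measure and the bound by the polynomial seminorm both follow from
  this formula; the shift by \<^term>\<open>K\<close> makes the integrand nonnegative.
\<close>

lemma sint_layer_cake:
  assumes g [measurable]: "g \<in> borel_measurable borel" and b: "\<And>x. \<bar>g x\<bar> \<le> K"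
  shows "set_integrable lborel {0..2*K} (\<lambda>t. smeas f {x. t - K < g x})"
    and "sint f g = (LINT t:{0..2*K}|lborel. smeas f {x. t - K < g x}) - K * smeas f UNIV"
proof -
  have j: "smeas f {x. t - K < g x} = measure (pos_var f) {x. t - K < g x}
      - measure (pos_var (- f)) {x. t - K < g x}" for t
    by (rule jordan_decomposition) measurable
  note l1 = layer_cake_shifted[OF finite_measure_pos_var[of f] sets_pos_var g b]
  note l2 = layer_cake_shifted[OF finite_measure_pos_var[of "- f"] sets_pos_var g b]
  show "set_integrable lborel {0..2*K} (\<lambda>t. smeas f {x. t - K < g x})"
    unfolding j using set_integral_diff(1)[OF l1(1) l2(1)] .
  show "sint f g = (LINT t:{0..2*K}|lborel. smeas f {x. t - K < g x}) - K * smeas f UNIV"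
    unfolding j sint_def l1(2) l2(2) set_integral_diff(2)[OF l1(1) l2(1)]
    by (simp add: jordan_decomposition[of UNIV f] algebra_simps)
qed

lemma sint_signed_of:
  assumes "law Q" and g: "g \<in> borel_measurable borel" and b: "\<And>x. \<bar>g x\<bar> \<le> K"
  shows "sint (signed_of Q) g = (LINT x|Q. g x)"
proof -
  have "finite_measure Q" "sets Q = sets borel"
    using assms(1) by (auto simp: law_def prob_space.finite_measure)
  then show ?thesis
    unfolding sint_layer_cake(2)[OF g b] smeas_signed_of[OF assms(1)]
    using layer_cake_shifted(2)[OF _ _ g b] by simp
qed

lemma sint_level_bound:
  assumes g: "g \<in> borel_measurable borel" and b: "\<And>x. \<bar>g x\<bar> \<le> K"
    and c: "\<And>t. \<bar>smeas f {x. t < g x}\<bar> \<le> c"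
  shows "\<bar>sint f g\<bar> \<le> 3 * K * c"
proof -
  have K: "0 \<le> K" using b order_trans[OF abs_ge_zero] by blast
  have "\<bar>LINT t:{0..2*K}|lborel. smeas f {x. t - K < g x}\<bar> \<le> (LINT t:{0..2*K}|lborel. c)"
    unfolding set_lebesgue_integral_def
  proof (rule order_trans[OF integral_abs_bound integral_mono])
    show "integrable lborel (\<lambda>t. \<bar>indicator {0..2*K} t *\<^sub>R smeas f {x. t - K < g x}\<bar>)"
      using integrable_abs[OF sint_layer_cake(1)[OF g b, unfolded set_integrable_def]] .
    show "integrable lborel (\<lambda>t. indicator {0..2*K} t *\<^sub>R c)"
      by (intro integrable_scaleR_left integrable_real_indicator) (auto simp: emeasure_lborel_Icc_eq)
  qed (auto simp: c abs_mult indicator_def)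
  also have "\<dots> = 2 * K * c" using K by (simp add: set_lebesgue_integral_def)
  finally have 1: "\<bar>LINT t:{0..2*K}|lborel. smeas f {x. t - K < g x}\<bar> \<le> 2 * K * c" .
  \<comment> \<open>the whole space is itself a superlevel set, so its mass is controlled too\<close>
  have "{x. - K - 1 < g x} = UNIV" using b by (auto simp: abs_le_iff) (smt (verit) b)
  then have "\<bar>smeas f UNIV\<bar> \<le> c" using c[of "- K - 1"] by simp
  then have "\<bar>K * smeas f UNIV\<bar> \<le> K * c" using K by (simp add: abs_mult mult_left_mono)
  with 1 show ?thesis unfolding sint_layer_cake(2)[OF g b] by linarith
qed

lemma sint_add_measure:
  assumes g: "g \<in> borel_measurable borel" and b: "\<And>x. \<bar>g x\<bar> \<le> K"
  shows "sint (f + f') g = sint f g + sint f' g"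
  using set_integral_add(2)[OF sint_layer_cake(1)[OF g b, of f] sint_layer_cake(1)[OF g b, of f']]
  by (simp add: sint_layer_cake(2)[OF g b] plus_signed_measure.rep_eq algebra_simps)

lemma sint_scale_measure:
  assumes g: "g \<in> borel_measurable borel" and b: "\<And>x. \<bar>g x\<bar> \<le> K"
  shows "sint (c *\<^sub>R f) g = c * sint f g"
  by (simp add: sint_layer_cake(2)[OF g b] scaleR_signed_measure.rep_eq algebra_simps)

lemma sint_add:
  assumes "g \<in> borel_measurable borel" "\<And>x. \<bar>g x\<bar> \<le> K" "h \<in> borel_measurable borel" "\<And>x. \<bar>h x\<bar> \<le> L"
  shows "sint f (\<lambda>x. g x + h x) = sint f g + sint f h"
  unfolding sint_def
  using bounded_integrable[OF finite_measure_pos_var, of g _ K] bounded_integrable[OF finite_measure_pos_var, of h _ L] assms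
  by simp

lemma sint_mult: "sint f (\<lambda>x. c * g x) = c * sint f g"
  unfolding sint_def by (simp add: algebra_simps)

text \<open>
  For one fixed measure a supremum bound is enough. This is what differentiation under the integral
  uses: error terms are uniformly small but their superlevel sets are not controlled.
\<close>

lemma sint_total_variation_bound:
  "\<exists>T\<ge>0. \<forall>g K. g \<in> borel_measurable borel \<longrightarrow> (\<forall>x. \<bar>g x\<bar> \<le> K) \<longrightarrow> \<bar>sint f g\<bar> \<le> T * K"
proof (intro exI[of _ "3 * (SOME C. \<forall>A. \<bar>smeas f A\<bar> \<le> C)"] conjI allI impI)
  let ?C = "SOME C. \<forall>A. \<bar>smeas f A\<bar> \<le> C"
  have C: "\<bar>smeas f A\<bar> \<le> ?C" for A using someI_ex[OF smeas_bounded[of f]] by blast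
  show "0 \<le> 3 * ?C" using C[of "{}"] by simp
  fix g :: "'a \<Rightarrow> real" and K
  assume "g \<in> borel_measurable borel" "\<forall>x. \<bar>g x\<bar> \<le> K"
  then show "\<bar>sint f g\<bar> \<le> 3 * ?C * K" using sint_level_bound[of g K f ?C] C by (simp add: mult_ac)
qed

section \<open>Polynomials and the seminorm of polynomial positivity sets\<close>

lemma poly_fun_le_add: "poly_fun_le r p \<Longrightarrow> poly_fun_le r q \<Longrightarrow> poly_fun_le r (\<lambda>x. p x + q x)"
  unfolding poly_fun_le_def
proof (elim exE)
  fix c d
  assume "\<forall>x. p x = (\<Sum>\<alpha> | sum \<alpha> UNIV \<le> r. c \<alpha> * (\<Prod>i\<in>UNIV. (x $ i) ^ \<alpha> i))"
    "\<forall>x. q x = (\<Sum>\<alpha> | sum \<alpha> UNIV \<le> r. d \<alpha> * (\<Prod>i\<in>UNIV. (x $ i) ^ \<alpha> i))"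
  then show "\<exists>c. \<forall>x. p x + q x = (\<Sum>\<alpha> | sum \<alpha> UNIV \<le> r. c \<alpha> * (\<Prod>i\<in>UNIV. (x $ i) ^ \<alpha> i))"
    by (intro exI[of _ "\<lambda>\<alpha>. c \<alpha> + d \<alpha>"]) (simp add: sum.distrib distrib_right)
qed

lemma poly_fun_le_scale: "poly_fun_le r p \<Longrightarrow> poly_fun_le r (\<lambda>x. c * p x)"
  unfolding poly_fun_le_def
proof (elim exE)
  fix d
  assume "\<forall>x. p x = (\<Sum>\<alpha> | sum \<alpha> UNIV \<le> r. d \<alpha> * (\<Prod>i\<in>UNIV. (x $ i) ^ \<alpha> i))"
  then show "\<exists>d. \<forall>x. c * p x = (\<Sum>\<alpha> | sum \<alpha> UNIV \<le> r. d \<alpha> * (\<Prod>i\<in>UNIV. (x $ i) ^ \<alpha> i))"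
    by (intro exI[of _ "\<lambda>\<alpha>. c * d \<alpha>"]) (simp add: sum_distrib_left mult.assoc)
qed

lemma poly_fun_le_monomial:
  assumes "sum \<alpha> UNIV \<le> r" shows "poly_fun_le r (\<lambda>x. \<Prod>i\<in>UNIV. (x $ i) ^ \<alpha> i)"
  unfolding poly_fun_le_def
proof (intro exI[of _ "\<lambda>\<beta>. if \<beta> = \<alpha> then 1 else 0"] allI)
  fix x :: "real ^ 'a"
  have "(\<Sum>\<beta> | sum \<beta> UNIV \<le> r. (if \<beta> = \<alpha> then 1 else 0) * (\<Prod>i\<in>UNIV. (x $ i) ^ \<beta> i))
    = (\<Sum>\<beta> | sum \<beta> UNIV \<le> r. if \<beta> = \<alpha> then (\<Prod>i\<in>UNIV. (x $ i) ^ \<beta> i) else 0)"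
    by (intro sum.cong) auto
  then show "(\<Prod>i\<in>UNIV. (x $ i) ^ \<alpha> i)
    = (\<Sum>\<beta> | sum \<beta> UNIV \<le> r. (if \<beta> = \<alpha> then 1 else 0) * (\<Prod>i\<in>UNIV. (x $ i) ^ \<beta> i))"
    using assms by (simp add: sum.delta[OF finite_multiindices])
qed

lemma poly_fun_le_const: "poly_fun_le r (\<lambda>_. c)"
  using poly_fun_le_scale[OF poly_fun_le_monomial[of "\<lambda>_. 0" r], of c] by simp

lemma poly_fun_le_sum:
  "finite S \<Longrightarrow> (\<And>i. i \<in> S \<Longrightarrow> poly_fun_le r (p i)) \<Longrightarrow> poly_fun_le r (\<lambda>x. \<Sum>i\<in>S. p i x)"
  by (induction S rule: finite_induct) (auto intro: poly_fun_le_add poly_fun_le_const)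

text \<open>
  Expanding both factors gives scaled monomials whose exponents add up, so that the coefficients of
  the product never have to be collected.
\<close>

lemma poly_fun_le_mult:
  assumes "poly_fun_le r p" "poly_fun_le s q"
  shows "poly_fun_le (r + s) (\<lambda>x. p x * q x)"
proof -
  obtain c d where c: "\<And>x. p x = (\<Sum>\<alpha> | sum \<alpha> UNIV \<le> r. c \<alpha> * (\<Prod>i\<in>UNIV. (x $ i) ^ \<alpha> i))"
    and d: "\<And>x. q x = (\<Sum>\<alpha> | sum \<alpha> UNIV \<le> s. d \<alpha> * (\<Prod>i\<in>UNIV. (x $ i) ^ \<alpha> i))"
    using assms unfolding poly_fun_le_def by blast
  have "(\<lambda>x. p x * q x) = (\<lambda>x. \<Sum>\<alpha> | sum \<alpha> UNIV \<le> r. \<Sum>\<beta> | sum \<beta> UNIV \<le> s.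
      (c \<alpha> * d \<beta>) * (\<Prod>i\<in>UNIV. (x $ i) ^ (\<alpha> i + \<beta> i)))"
    by (rule ext) (simp add: c d sum_product power_add prod.distrib mult_ac)
  moreover have "poly_fun_le (r + s) \<dots>"
  proof (intro poly_fun_le_sum finite_multiindices poly_fun_le_scale poly_fun_le_monomial)
    fix \<alpha> \<beta> :: "'a \<Rightarrow> nat"
    assume "\<alpha> \<in> {\<alpha>. sum \<alpha> UNIV \<le> r}" "\<beta> \<in> {\<beta>. sum \<beta> UNIV \<le> s}"
    then show "(\<Sum>i\<in>UNIV. \<alpha> i + \<beta> i) \<le> r + s" by (simp add: sum.distrib add_mono)
  qed
  ultimately show ?thesis by simp
qed

lemma poly_fun_le_mono:
  assumes "poly_fun_le r p" "r \<le> s" shows "poly_fun_le s p"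
  using poly_fun_le_mult[OF assms(1) poly_fun_le_const[of "s - r" 1]] assms(2) by simp

lemma poly_fun_le_coord:
  fixes i :: "'d::finite" shows "poly_fun_le 1 (\<lambda>x. x $ i)"
proof -
  have "(\<Prod>j\<in>UNIV. (x $ j) ^ (if j = i then 1 else 0)) = x $ i" for x :: "real ^ 'd"
  proof -
    have "(\<Prod>j\<in>UNIV. (x $ j) ^ (if j = i then 1 else 0)) = (\<Prod>j\<in>UNIV. if j = i then x $ j else 1)"
      by (intro prod.cong) auto
    then show ?thesis by simp
  qed
  then show ?thesis
    using poly_fun_le_monomial[of "\<lambda>j. if j = i then 1 else 0" 1] by simp
qed

definition is_seminorm :: "('x::real_vector \<Rightarrow> real) \<Rightarrow> bool" where
  "is_seminorm N \<longleftrightarrow> (\<forall>x. 0 \<le> N x) \<and> (\<forall>x y. N (x + y) \<le> N x + N y) \<and> (\<forall>c x. N (c *\<^sub>R x) = \<bar>c\<bar> * N x)"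

lemma poly_norm_upper:
  assumes "E \<in> poly_pos_sets r" shows "\<bar>smeas \<phi> E\<bar> \<le> poly_norm r \<phi>"
proof -
  obtain C where "\<And>A. \<bar>smeas \<phi> A\<bar> \<le> C" using smeas_bounded by blast
  then show ?thesis unfolding poly_norm_def
    by (intro cSUP_upper assms bdd_aboveI2)
qed

lemma empty_in_poly_pos_sets: "{} \<in> poly_pos_sets r"
  unfolding poly_pos_sets_def using poly_fun_le_const[of r 0] by force

lemma poly_norm_least:
  "(\<And>E. E \<in> poly_pos_sets r \<Longrightarrow> \<bar>smeas \<phi> E\<bar> \<le> c) \<Longrightarrow> poly_norm r \<phi> \<le> c"
  unfolding poly_norm_def using empty_in_poly_pos_sets by (intro cSUP_least) auto

lemma is_seminorm_poly_norm: "is_seminorm (poly_norm r)"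
  unfolding is_seminorm_def
proof (intro conjI allI)
  show nn: "0 \<le> poly_norm r \<phi>" for \<phi> :: "(real^'a) signed_measure"
    using poly_norm_upper[OF empty_in_poly_pos_sets[of r], of \<phi>] by simp
  show "poly_norm r (\<phi> + \<psi>) \<le> poly_norm r \<phi> + poly_norm r \<psi>" for \<phi> \<psi> :: "(real^'a) signed_measure"
  proof (rule poly_norm_least)
    fix E :: "(real^'a) set" assume "E \<in> poly_pos_sets r"
    then show "\<bar>smeas (\<phi> + \<psi>) E\<bar> \<le> poly_norm r \<phi> + poly_norm r \<psi>"
      using poly_norm_upper[of E r \<phi>] poly_norm_upper[of E r \<psi>] by (simp add: plus_signed_measure.rep_eq)
  qed
  have le: "poly_norm r (c *\<^sub>R \<phi>) \<le> \<bar>c\<bar> * poly_norm r \<phi>" for c and \<phi> :: "(real^'a) signed_measure"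
    by (rule poly_norm_least)
      (auto simp: scaleR_signed_measure.rep_eq abs_mult intro!: mult_left_mono poly_norm_upper)
  show "poly_norm r (c *\<^sub>R \<phi>) = \<bar>c\<bar> * poly_norm r \<phi>" for c and \<phi> :: "(real^'a) signed_measure"
  proof (cases "c = 0")
    case True then show ?thesis using le[of 0 \<phi>] nn[of "0 *\<^sub>R \<phi>"] by simp
  next
    case False
    then have "\<bar>c\<bar> * poly_norm r \<phi> \<le> poly_norm r (c *\<^sub>R \<phi>)"
      using le[of "inverse c" "c *\<^sub>R \<phi>"] by (simp add: field_simps abs_mult)
    then show ?thesis using le[of c \<phi>] by simp
  qed
qed

text \<open>
  The only way in which the polynomial seminorm enters.
\<close>

lemma sint_poly_norm_bound:
  fixes g :: "real ^ 'd \<Rightarrow> real"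
  assumes g: "g \<in> borel_measurable borel" and b: "\<And>x. \<bar>g x\<bar> \<le> K"
    and lev: "\<And>t. {x. t < g x} \<in> poly_pos_sets r"
  shows "\<bar>sint \<phi> g\<bar> \<le> 3 * K * poly_norm r \<phi>"
  by (rule sint_level_bound[OF g b poly_norm_upper[OF lev]])

section \<open>Smooth functions on a seminormed space via directional derivatives\<close>

text \<open>
  The seminorm is a parameter and not a type class instance, since one space of measures carries a
  whole family of them.
\<close>

locale seminormed_ball =
  fixes N :: "'x::real_vector \<Rightarrow> real" and x0 :: 'x and \<delta> :: real
  assumes seminorm: "is_seminorm N" and \<delta>: "0 < \<delta>"
begin

lemma N_nonneg [simp]: "0 \<le> N x" and N_add: "N (x + y) \<le> N x + N y"
  and N_scale [simp]: "N (c *\<^sub>R x) = \<bar>c\<bar> * N x"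
  using seminorm by (auto simp: is_seminorm_def)

lemma N_zero [simp]: "N 0 = 0" using N_scale[of 0 0] by simp

definition U :: "'x set" where "U = {x. N (x - x0) < \<delta>}"

lemma U_open: "open_wrt N U"
  unfolding open_wrt_def U_def
proof (intro ballI)
  fix x assume x: "x \<in> {x. N (x - x0) < \<delta>}"
  have "N (y - x0) < \<delta>" if "N (y - x) < \<delta> - N (x - x0)" for y
    using N_add[of "y - x" "x - x0"] that by simp
  then show "\<exists>d>0. \<forall>y. N (y - x) < d \<longrightarrow> y \<in> {x. N (x - x0) < \<delta>}"
    using x by (intro exI[of _ "\<delta> - N (x - x0)"]) auto
qed

lemma center_in_U: "x0 \<in> U" using \<delta> by (simp add: U_def)

lemma U_segment:
  assumes "x \<in> U" "u \<in> U" "0 \<le> t" "t \<le> 1" shows "x + t *\<^sub>R (u - x) \<in> U"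
proof -
  have "x + t *\<^sub>R (u - x) - x0 = (1 - t) *\<^sub>R (x - x0) + t *\<^sub>R (u - x0)"
    by (simp add: algebra_simps)
  then have "N (x + t *\<^sub>R (u - x) - x0) \<le> (1 - t) * N (x - x0) + t * N (u - x0)"
    using N_add[of "(1 - t) *\<^sub>R (x - x0)" "t *\<^sub>R (u - x0)"] assms by simp
  also have "\<dots> < \<delta>"
    using assms convex_bound_lt[of "N (x - x0)" \<delta> "N (u - x0)" "1 - t" t] by (simp add: U_def)
  finally show ?thesis by (simp add: U_def)
qed

lemma eventually_line_in_U:
  assumes "x \<in> U" shows "\<forall>\<^sub>F t in at 0. x + t *\<^sub>R h \<in> U"
proof -
  obtain d where d: "d > 0" "\<And>y. N (y - x) < d \<Longrightarrow> y \<in> U"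
    using U_open assms unfolding open_wrt_def by blast
  have "\<forall>\<^sub>F t in at 0. \<bar>t\<bar> * N h < d"
    by (rule order_tendstoD(2)[OF _ d(1)]) (auto intro!: tendsto_eq_intros)
  then show ?thesis by (rule eventually_mono) (auto intro!: d(2))
qed

text \<open>
  The arguments of a multilinear function are named by natural numbers: \<^term>\<open>f x v\<close> depends
  on \<^term>\<open>v i\<close> for \<^term>\<open>i \<in> S\<close> only. With named arguments the product of two functions of
  disjoint sets of arguments is again of this kind.
\<close>

definition mlin :: "nat set \<Rightarrow> ('x \<Rightarrow> (nat \<Rightarrow> 'x) \<Rightarrow> real) \<Rightarrow> bool" where
  "mlin S f \<longleftrightarrow> finite S \<and>
     (\<forall>x\<in>U. \<forall>v. \<forall>i\<in>S. linear (\<lambda>w. f x (v(i := w)))) \<and>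
     (\<forall>x\<in>U. \<forall>v v'. (\<forall>i\<in>S. v i = v' i) \<longrightarrow> f x v = f x v') \<and>
     (\<exists>C\<ge>0. \<forall>x\<in>U. \<forall>v. \<bar>f x v\<bar> \<le> C * (\<Prod>i\<in>S. N (v i)))"

text \<open>
  The direction of differentiation is the argument with the new name \<^term>\<open>i\<close>.
\<close>

definition line_deriv :: "nat \<Rightarrow> ('x \<Rightarrow> (nat \<Rightarrow> 'x) \<Rightarrow> real) \<Rightarrow> ('x \<Rightarrow> (nat \<Rightarrow> 'x) \<Rightarrow> real) \<Rightarrow> bool" where
  "line_deriv i f f' \<longleftrightarrow>
     (\<forall>x\<in>U. \<forall>v. ((\<lambda>t. f (x + t *\<^sub>R v i) v) has_real_derivative f' x v) (at 0))"

text \<open>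
  Derivatives are taken along lines, and all uniformity sits in the bounds on them. This makes it easy
  to propagate smoothness through sums, products and implicit equations.
\<close>

primrec smooth :: "nat \<Rightarrow> nat set \<Rightarrow> ('x \<Rightarrow> (nat \<Rightarrow> 'x) \<Rightarrow> real) \<Rightarrow> bool" where
  "smooth 0 S f \<longleftrightarrow> mlin S f"
| "smooth (Suc m) S f \<longleftrightarrow> mlin S f \<and>
     (\<forall>i. i \<notin> S \<longrightarrow> (\<exists>f'. smooth m (insert i S) f' \<and> line_deriv i f f'))"

lemma smooth_imp_mlin: "smooth m S f \<Longrightarrow> mlin S f"
  by (cases m) auto

lemma smooth_SucE:
  assumes "smooth (Suc m) S f" "i \<notin> S"
  obtains f' where "smooth m (insert i S) f'" "line_deriv i f f'"
  using assms by auto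

lemma smooth_SucD: "smooth (Suc m) S f \<Longrightarrow> smooth m S f"
proof (induction m arbitrary: S f)
  case (Suc m)
  show ?case
    unfolding smooth.simps(2)
  proof (intro conjI allI impI)
    show "mlin S f" using Suc.prems by (rule smooth_imp_mlin)
    fix i assume "i \<notin> S"
    then obtain f' where "smooth (Suc m) (insert i S) f'" "line_deriv i f f'"
      using Suc.prems unfolding smooth.simps(2)[of "Suc m"] by blast
    then show "\<exists>f'. smooth m (insert i S) f' \<and> line_deriv i f f'"
      using Suc.IH by blast
  qed
qed simp

lemma mlin_zero: "finite S \<Longrightarrow> mlin S (\<lambda>_ _. 0)"
  unfolding mlin_def by (simp add: linear_iff) (rule exI[of _ 0], simp)

lemma smooth_zero: "finite S \<Longrightarrow> smooth m S (\<lambda>_ _. 0)"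
proof (induction m arbitrary: S)
  case 0
  then show ?case by (simp add: mlin_zero)
next
  case (Suc m)
  have "line_deriv i (\<lambda>_ _. 0) (\<lambda>_ _. 0)" for i by (simp add: line_deriv_def)
  then show ?case using Suc.IH[of "insert _ S"] mlin_zero[OF Suc.prems] Suc.prems
    unfolding smooth.simps by blast
qed

lemma smooth_const: "smooth m {} (\<lambda>_ _. c)"
proof -
  have "mlin {} (\<lambda>_ _. c)" unfolding mlin_def by (simp, rule exI[of _ "\<bar>c\<bar>"], simp)
  moreover have "line_deriv i (\<lambda>_ _. c) (\<lambda>_ _. 0)" for i by (simp add: line_deriv_def)
  ultimately show ?thesis
    using smooth_zero[of "{_}"] by (cases m) (simp, simp only: smooth.simps, blast)
qed

lemma mlin_add: assumes "mlin S f" "mlin S g" shows "mlin S (\<lambda>x v. f x v + g x v)"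
proof -
  obtain C D where "C \<ge> 0" "D \<ge> 0" and C: "\<And>x v. x \<in> U \<Longrightarrow> \<bar>f x v\<bar> \<le> C * (\<Prod>i\<in>S. N (v i))"
    and D: "\<And>x v. x \<in> U \<Longrightarrow> \<bar>g x v\<bar> \<le> D * (\<Prod>i\<in>S. N (v i))"
    using assms unfolding mlin_def by metis
  have "\<bar>f x v + g x v\<bar> \<le> (C + D) * (\<Prod>i\<in>S. N (v i))" if "x \<in> U" for x v
    using C[OF that, of v] D[OF that, of v] by (simp add: distrib_right)
  then have "\<exists>C\<ge>0. \<forall>x\<in>U. \<forall>v. \<bar>f x v + g x v\<bar> \<le> C * (\<Prod>i\<in>S. N (v i))"
    using \<open>C \<ge> 0\<close> \<open>D \<ge> 0\<close> by (intro exI[of _ "C + D"]) auto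
  moreover have "linear (\<lambda>w. f x (v(i := w)) + g x (v(i := w)))" if "x \<in> U" "i \<in> S" for x v i
    using assms that unfolding mlin_def by (intro linear_compose_add) auto
  moreover have "f x v + g x v = f x v' + g x v'" if "x \<in> U" "\<forall>i\<in>S. v i = v' i" for x v v'
    using assms that unfolding mlin_def by metis
  ultimately show ?thesis using assms unfolding mlin_def by simp
qed

lemma mlin_mult:
  assumes "mlin S f" "mlin T g" "S \<inter> T = {}"
  shows "mlin (S \<union> T) (\<lambda>x v. f x v * g x v)"
proof -
  have fin: "finite S" "finite T" using assms by (auto simp: mlin_def)
  obtain C D where CD: "C \<ge> 0" "D \<ge> 0" and C: "\<And>x v. x \<in> U \<Longrightarrow> \<bar>f x v\<bar> \<le> C * (\<Prod>i\<in>S. N (v i))"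
    and D: "\<And>x v. x \<in> U \<Longrightarrow> \<bar>g x v\<bar> \<le> D * (\<Prod>i\<in>T. N (v i))"
    using assms unfolding mlin_def by metis
  have "\<bar>f x v * g x v\<bar> \<le> (C * D) * (\<Prod>i\<in>S \<union> T. N (v i))" if "x \<in> U" for x v
  proof -
    have "\<bar>f x v * g x v\<bar> \<le> (C * (\<Prod>i\<in>S. N (v i))) * (D * (\<Prod>i\<in>T. N (v i)))"
      unfolding abs_mult using C[OF that] D[OF that] CD
      by (intro mult_mono) (auto intro!: mult_nonneg_nonneg prod_nonneg)
    then show ?thesis using fin assms(3) by (simp add: prod.union_disjoint mult_ac)
  qed
  then have 1: "\<exists>C\<ge>0. \<forall>x\<in>U. \<forall>v. \<bar>f x v * g x v\<bar> \<le> C * (\<Prod>i\<in>S \<union> T. N (v i))"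
    using CD by (intro exI[of _ "C * D"]) auto
  have f1: "f x (v(i := w)) = f x v" if "x \<in> U" "i \<notin> S" for x v i w
    using assms(1) that unfolding mlin_def by (metis fun_upd_other)
  have g1: "g x (v(i := w)) = g x v" if "x \<in> U" "i \<notin> T" for x v i w
    using assms(2) that unfolding mlin_def by (metis fun_upd_other)
  have 2: "linear (\<lambda>w. f x (v(i := w)) * g x (v(i := w)))" if x: "x \<in> U" and i: "i \<in> S \<union> T" for x v i
  proof (cases "i \<in> S")
    case True
    then have "i \<notin> T" using assms by auto
    have "linear (\<lambda>w. f x (v(i := w)))" using assms(1) x True unfolding mlin_def by blast
    then have "linear (\<lambda>w. g x v *\<^sub>R f x (v(i := w)))" by (rule linear_compose_scale_right)
    then show ?thesis using g1[OF x \<open>i \<notin> T\<close>] by (simp add: mult.commute)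
  next
    case False
    then have "linear (\<lambda>w. g x (v(i := w)))" using assms(2) x i unfolding mlin_def by blast
    then have "linear (\<lambda>w. f x v *\<^sub>R g x (v(i := w)))" by (rule linear_compose_scale_right)
    then show ?thesis using f1[OF x False] by simp
  qed
  have 3: "f x v * g x v = f x v' * g x v'" if "x \<in> U" "\<forall>i\<in>S \<union> T. v i = v' i" for x v v'
  proof -
    have "f x v = f x v'" "g x v = g x v'" using assms that unfolding mlin_def by blast+
    then show ?thesis by simp
  qed
  show ?thesis using fin 1 2 3 unfolding mlin_def by simp
qed

lemma smooth_add: "smooth m S f \<Longrightarrow> smooth m S g \<Longrightarrow> smooth m S (\<lambda>x v. f x v + g x v)"
proof (induction m arbitrary: S f g)
  case 0 then show ?case by (simp add: mlin_add)
next
  case (Suc m)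
  have "\<exists>h. smooth m (insert i S) h \<and> line_deriv i (\<lambda>x v. f x v + g x v) h" if i: "i \<notin> S" for i
  proof -
    obtain f' where "smooth m (insert i S) f'" "line_deriv i f f'"
      by (rule smooth_SucE[OF Suc.prems(1) i])
    moreover obtain g' where "smooth m (insert i S) g'" "line_deriv i g g'"
      by (rule smooth_SucE[OF Suc.prems(2) i])
    ultimately show ?thesis
      using Suc.IH by (intro exI[of _ "\<lambda>x v. f' x v + g' x v"]) (auto simp: line_deriv_def intro: DERIV_add)
  qed
  then show ?case using Suc.prems by (simp add: mlin_add)
qed

lemma line_deriv_mult:
  "line_deriv i f f' \<Longrightarrow> line_deriv i g g' \<Longrightarrow>
    line_deriv i (\<lambda>x v. f x v * g x v) (\<lambda>x v. f' x v * g x v + f x v * g' x v)"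
  unfolding line_deriv_def
  by (auto intro!: derivative_eq_intros simp: algebra_simps)

text \<open>
  The Leibniz rule; the two terms are multilinear in the same enlarged set of arguments.
\<close>

lemma smooth_mult:
  "smooth m S f \<Longrightarrow> smooth m T g \<Longrightarrow> S \<inter> T = {} \<Longrightarrow> smooth m (S \<union> T) (\<lambda>x v. f x v * g x v)"
proof (induction m arbitrary: S T f g)
  case 0 then show ?case by (simp add: mlin_mult)
next
  case (Suc m)
  have "\<exists>h. smooth m (insert i (S \<union> T)) h \<and> line_deriv i (\<lambda>x v. f x v * g x v) h"
    if i: "i \<notin> S \<union> T" for i
  proof -
    have "i \<notin> S" "i \<notin> T" using i by auto
    obtain f' where f': "smooth m (insert i S) f'" "line_deriv i f f'"
      by (rule smooth_SucE[OF Suc.prems(1) \<open>i \<notin> S\<close>])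
    obtain g' where g': "smooth m (insert i T) g'" "line_deriv i g g'"
      by (rule smooth_SucE[OF Suc.prems(2) \<open>i \<notin> T\<close>])
    have "smooth m (insert i S \<union> T) (\<lambda>x v. f' x v * g x v)"
      using f'(1) smooth_SucD[OF Suc.prems(2)] by (rule Suc.IH) (use Suc.prems(3) i in auto)
    moreover have "smooth m (S \<union> insert i T) (\<lambda>x v. f x v * g' x v)"
      using smooth_SucD[OF Suc.prems(1)] g'(1) by (rule Suc.IH) (use Suc.prems(3) i in auto)
    ultimately have "smooth m (insert i (S \<union> T)) (\<lambda>x v. f' x v * g x v + f x v * g' x v)"
      by (intro smooth_add) simp_all
    then show ?thesis using line_deriv_mult[OF f'(2) g'(2)] by blast
  qed
  then show ?case using Suc.prems by (simp add: mlin_mult)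
qed

lemma smooth_cmult: "smooth m S f \<Longrightarrow> smooth m S (\<lambda>x v. c * f x v)"
  using smooth_mult[OF smooth_const[of m c]] by simp

lemma smooth_mult_scalar: "smooth m {} f \<Longrightarrow> smooth m S g \<Longrightarrow> smooth m S (\<lambda>x v. f x v * g x v)"
  using smooth_mult[of m "{}" f S g] by simp

lemma smooth_uminus: "smooth m S f \<Longrightarrow> smooth m S (\<lambda>x v. - f x v)"
  using smooth_cmult[of m S f "-1"] by simp

lemma smooth_sum:
  "finite I \<Longrightarrow> finite S \<Longrightarrow> (\<And>i. i \<in> I \<Longrightarrow> smooth m S (f i)) \<Longrightarrow> smooth m S (\<lambda>x v. \<Sum>i\<in>I. f i x v)"
  by (induction I rule: finite_induct) (auto intro: smooth_zero smooth_add)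

lemma smooth_SucI:
  assumes "mlin S f" "\<And>i. i \<notin> S \<Longrightarrow> smooth m (insert i S) (f' i)" "\<And>i. i \<notin> S \<Longrightarrow> line_deriv i f (f' i)"
  shows "smooth (Suc m) S f"
  using assms unfolding smooth.simps by blast

text \<open>
  Starting from the arguments below \<^term>\<open>j\<close>, each derivative takes the next free number as its
  direction.
\<close>

lemma smooth_tower:
  "smooth m {..<j} f \<Longrightarrow> \<exists>D :: nat \<Rightarrow> 'x \<Rightarrow> (nat \<Rightarrow> 'x) \<Rightarrow> real. D j = f \<and> (\<forall>i. j \<le> i \<and> i \<le> j + m \<longrightarrow> mlin {..<i} (D i)) \<and>
     (\<forall>i. j \<le> i \<and> i < j + m \<longrightarrow> line_deriv i (D i) (D (Suc i)))"
proof (induction m arbitrary: j f)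
  case 0 then show ?case by (intro exI[of _ "\<lambda>_. f"]) auto
next
  case (Suc m)
  have "j \<notin> {..<j}" by simp
  then obtain f' where "smooth m (insert j {..<j}) f'" "line_deriv j f f'"
    by (rule smooth_SucE[OF Suc.prems])
  then obtain D where D: "D (Suc j) = f'" "\<And>i. Suc j \<le> i \<Longrightarrow> i \<le> Suc j + m \<Longrightarrow> mlin {..<i} (D i)"
    "\<And>i. Suc j \<le> i \<Longrightarrow> i < Suc j + m \<Longrightarrow> line_deriv i (D i) (D (Suc i))"
    using Suc.IH[of _ f'] by (metis lessThan_Suc)
  show ?case
  proof (intro exI[of _ "D(j := f)"] conjI allI impI)
    show "(D(j := f)) j = f" by simp
    fix i assume "j \<le> i \<and> i \<le> j + Suc m"
    then show "mlin {..<i} ((D(j := f)) i)"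
      using D(2)[of i] smooth_imp_mlin[OF Suc.prems] by (cases "i = j") auto
  next
    fix i assume "j \<le> i \<and> i < j + Suc m"
    then show "line_deriv i ((D(j := f)) i) ((D(j := f)) (Suc i))"
      using D(1) D(3)[of i] \<open>line_deriv j f f'\<close> by (cases "i = j") auto
  qed
qed

lemma line_deriv_at:
  assumes "line_deriv i f f'" "mlin S f" "i \<notin> S" "x + t *\<^sub>R h \<in> U"
  shows "((\<lambda>s. f (x + s *\<^sub>R h) v) has_real_derivative f' (x + t *\<^sub>R h) (v(i := h))) (at t)"
proof -
  let ?y = "x + t *\<^sub>R h"
  have "((\<lambda>s. f (?y + s *\<^sub>R h) (v(i := h))) has_real_derivative f' ?y (v(i := h))) (at 0)"
    using assms(1,4) unfolding line_deriv_def by (metis fun_upd_same)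
  moreover have "\<forall>\<^sub>F s in nhds 0. f (?y + s *\<^sub>R h) (v(i := h)) = f (?y + s *\<^sub>R h) v"
  proof -
    have "f y (v(i := h)) = f y v" if "y \<in> U" for y
      using assms(2,3) that unfolding mlin_def by (metis fun_upd_other)
    then show ?thesis
      using eventually_line_in_U[OF assms(4), of h] assms(4)
      by (auto simp: eventually_at_filter elim!: eventually_mono)
  qed
  ultimately have "((\<lambda>s. f (?y + s *\<^sub>R h) v) has_real_derivative f' ?y (v(i := h))) (at 0)"
    by (subst (asm) DERIV_cong_ev) auto
  then have "((\<lambda>s. f (?y + (s - t) *\<^sub>R h) v) has_real_derivative f' ?y (v(i := h))) (at t)"
    using DERIV_shift[of "\<lambda>s. f (?y + (s - t) *\<^sub>R h) v" _ 0 t] by simp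
  then show ?thesis by (simp add: algebra_simps)
qed

lemma line_deriv_lipschitz:
  assumes d: "line_deriv i f f'" and f: "mlin {..<i} f" and f': "mlin {..<Suc i} f'"
  shows "\<exists>C\<ge>0. \<forall>x\<in>U. \<forall>u\<in>U. \<forall>v. \<bar>f u v - f x v\<bar> \<le> C * N (u - x) * (\<Prod>l<i. N (v l))"
proof -
  obtain C where C: "C \<ge> 0" "\<And>x v. x \<in> U \<Longrightarrow> \<bar>f' x v\<bar> \<le> C * (\<Prod>l<Suc i. N (v l))"
    using f' unfolding mlin_def by metis
  have "\<bar>f u v - f x v\<bar> \<le> C * N (u - x) * (\<Prod>l<i. N (v l))" if x: "x \<in> U" and u: "u \<in> U" for x u v
  proof -
    let ?h = "u - x"
    have der: "((\<lambda>s. f (x + s *\<^sub>R ?h) v) has_real_derivative f' (x + t *\<^sub>R ?h) (v(i := ?h))) (at t)"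
      if "0 \<le> t" "t \<le> 1" for t
      by (rule line_deriv_at[OF d f]) (use U_segment[OF x u that] in auto)
    obtain t where t: "0 < t" "t < 1" "f (x + 1 *\<^sub>R ?h) v - f (x + 0 *\<^sub>R ?h) v
        = (1 - 0) * f' (x + t *\<^sub>R ?h) (v(i := ?h))"
      using MVT2[of 0 1 "\<lambda>s. f (x + s *\<^sub>R ?h) v" "\<lambda>t. f' (x + t *\<^sub>R ?h) (v(i := ?h))", OF _ der]
      by auto
    have "\<bar>f u v - f x v\<bar> = \<bar>f' (x + t *\<^sub>R ?h) (v(i := ?h))\<bar>" using t(3) by simp
    also have "\<dots> \<le> C * (\<Prod>l<Suc i. N ((v(i := ?h)) l))"
      using t by (intro C(2) U_segment x u) auto
    also have "(\<Prod>l<Suc i. N ((v(i := ?h)) l)) = N ?h * (\<Prod>l<i. N (v l))" by simp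
    finally show ?thesis by (simp add: mult.assoc)
  qed
  then show ?thesis using C(1) by blast
qed

text \<open>
  The mean value theorem for the function and a Lipschitz bound for its derivative give a quadratic
  remainder, uniformly in the other arguments.
\<close>

lemma line_deriv_remainder:
  assumes d: "line_deriv i f f'" "line_deriv (Suc i) f' f''"
    and f: "mlin {..<i} f" "mlin {..<Suc i} f'" "mlin {..<Suc (Suc i)} f''"
  shows "\<exists>C\<ge>0. \<forall>x\<in>U. \<forall>u\<in>U. \<forall>v. \<bar>f u v - f x v - f' x (v(i := u - x))\<bar>
           \<le> C * N (u - x) * N (u - x) * (\<Prod>l<i. N (v l))"
proof -
  obtain C where C: "C \<ge> 0" "\<And>x u v. x \<in> U \<Longrightarrow> u \<in> U \<Longrightarrow>
      \<bar>f' u v - f' x v\<bar> \<le> C * N (u - x) * (\<Prod>l<Suc i. N (v l))"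
    using line_deriv_lipschitz[OF d(2) f(2,3)] by metis
  have "\<bar>f u v - f x v - f' x (v(i := u - x))\<bar> \<le> C * N (u - x) * N (u - x) * (\<Prod>l<i. N (v l))"
    if x: "x \<in> U" and u: "u \<in> U" for x u v
  proof -
    let ?h = "u - x"
    have der: "((\<lambda>s. f (x + s *\<^sub>R ?h) v) has_real_derivative f' (x + t *\<^sub>R ?h) (v(i := ?h))) (at t)"
      if "0 \<le> t" "t \<le> 1" for t
      by (rule line_deriv_at[OF d(1) f(1)]) (use U_segment[OF x u that] in auto)
    obtain t where t: "0 < t" "t < 1" "f (x + 1 *\<^sub>R ?h) v - f (x + 0 *\<^sub>R ?h) v
        = (1 - 0) * f' (x + t *\<^sub>R ?h) (v(i := ?h))"
      using MVT2[of 0 1 "\<lambda>s. f (x + s *\<^sub>R ?h) v" "\<lambda>t. f' (x + t *\<^sub>R ?h) (v(i := ?h))", OF _ der]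
      by auto
    have "\<bar>f u v - f x v - f' x (v(i := ?h))\<bar> = \<bar>f' (x + t *\<^sub>R ?h) (v(i := ?h)) - f' x (v(i := ?h))\<bar>"
      using t(3) by simp
    also have "\<dots> \<le> C * N (x + t *\<^sub>R ?h - x) * (\<Prod>l<Suc i. N ((v(i := ?h)) l))"
      using t by (intro C(2) U_segment x u) auto
    also have "\<dots> = C * (t * N ?h) * (N ?h * (\<Prod>l<i. N (v l)))" using t by simp
    also have "\<dots> \<le> C * (1 * N ?h) * (N ?h * (\<Prod>l<i. N (v l)))"
      using t C(1) by (intro mult_right_mono mult_left_mono mult_nonneg_nonneg prod_nonneg) auto
    finally show ?thesis by (simp add: mult_ac)
  qed
  then show ?thesis using C(1) by blast
qed

text \<open>
  A direction of differentiation is prepended to the list of arguments, so positions are counted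
  from the end: the existing arguments keep their numbers.
\<close>

definition args :: "'x list \<Rightarrow> nat \<Rightarrow> 'x" where
  "args vs l = (if l < length vs then rev vs ! l else 0)"

lemma args_Cons: "args (h # vs) = (args vs)(length vs := h)"
  by (auto simp: args_def fun_eq_iff nth_append)

lemma prod_args: "(\<Prod>l<length vs. N (args vs l)) = prod_list (map N vs)"
  by (induction vs) (simp_all add: args_Cons mult.commute)

lemma args_update: "i < length vs \<Longrightarrow> args (vs[i := w]) = (args vs)(length vs - 1 - i := w)"
  by (auto simp: args_def fun_eq_iff rev_update nth_list_update)

text \<open>
  One more directional derivative than asked for, merely bounded in operator norm, yields by the mean
  value theorem the uniform remainder estimates and the continuity of the top derivative.
\<close>

lemma smooth_imp_Ck_on_wrt:
  fixes F :: "'x \<Rightarrow> 'y::euclidean_space"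
  assumes F: "\<And>b. b \<in> Basis \<Longrightarrow> smooth (Suc k) {} (\<lambda>x _. F x \<bullet> b)"
  shows "Ck_on_wrt k N U F"
proof -
  have "\<forall>b\<in>Basis. \<exists>D. D 0 = (\<lambda>x _. F x \<bullet> b) \<and> (\<forall>i. i \<le> Suc k \<longrightarrow> mlin {..<i} (D i)) \<and>
     (\<forall>i. i < Suc k \<longrightarrow> line_deriv i (D i) (D (Suc i)))"
    using smooth_tower[of "Suc k" 0] F by simp
  then obtain D where D0: "\<And>b. b \<in> Basis \<Longrightarrow> D b 0 = (\<lambda>x _. F x \<bullet> b)"
    and mD: "\<And>b i. b \<in> Basis \<Longrightarrow> i \<le> Suc k \<Longrightarrow> mlin {..<i} (D b i)"
    and dD: "\<And>b i. b \<in> Basis \<Longrightarrow> i < Suc k \<Longrightarrow> line_deriv i (D b i) (D b (Suc i))"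
    by metis
  define E :: "nat \<Rightarrow> 'x \<Rightarrow> 'x list \<Rightarrow> 'y" where "E i x vs = (\<Sum>b\<in>Basis. D b i x (args vs) *\<^sub>R b)" for i x vs
  have norm_sum: "norm (\<Sum>b\<in>Basis. c b *\<^sub>R b :: 'y) \<le> (\<Sum>b\<in>Basis. \<bar>c b\<bar>)" for c
    by (rule sum_norm_le) simp
  have pos: "0 \<le> prod_list (map N vs)" for vs by (induction vs) auto
  have bound: "\<exists>C\<ge>0. \<forall>x\<in>U. \<forall>vs. length vs = i \<longrightarrow> norm (E i x vs) \<le> C * prod_list (map N vs)"
    if i: "i \<le> Suc k" for i
  proof -
    have "\<forall>b\<in>Basis. \<exists>C\<ge>0. \<forall>x\<in>U. \<forall>v. \<bar>D b i x v\<bar> \<le> C * (\<Prod>l<i. N (v l))"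
      using mD[OF _ i] unfolding mlin_def by blast
    then obtain C where C: "\<And>b. b \<in> Basis \<Longrightarrow> C b \<ge> 0"
      "\<And>b x v. b \<in> Basis \<Longrightarrow> x \<in> U \<Longrightarrow> \<bar>D b i x v\<bar> \<le> C b * (\<Prod>l<i. N (v l))" by metis
    have "norm (E i x vs) \<le> (\<Sum>b\<in>Basis. C b) * prod_list (map N vs)" if "x \<in> U" "length vs = i" for x vs
    proof -
      have "norm (E i x vs) \<le> (\<Sum>b\<in>Basis. C b * prod_list (map N vs))"
        unfolding E_def using C(2)[OF _ that(1), of _ "args vs"] that(2)
        by (intro order_trans[OF norm_sum] sum_mono) (auto simp: prod_args[symmetric])
      then show ?thesis by (simp add: sum_distrib_right)
    qed
    then show ?thesis using C(1) by (intro exI[of _ "\<Sum>b\<in>Basis. C b"]) (auto intro: sum_nonneg)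
  qed
  have lin: "linear (\<lambda>w. E i x (vs[l := w]))" if "i \<le> Suc k" "x \<in> U" "length vs = i" "l < i" for i x vs l
  proof -
    have l1: "linear (\<lambda>w. D b i x ((args vs)(i - 1 - l := w)))" if "b \<in> Basis" for b
      using mD[OF that \<open>i \<le> Suc k\<close>] \<open>x \<in> U\<close> \<open>l < i\<close> unfolding mlin_def by auto
    then have "linear (\<lambda>w. D b i x ((args vs)(i - 1 - l := w)) *\<^sub>R b)" if "b \<in> Basis" for b
      using l1[OF that] by (simp add: linear_iff scaleR_add_left)
    then show ?thesis
      using that unfolding E_def by (simp add: args_update linear_compose_sum)
  qed
  have lip: "\<exists>C\<ge>0. \<forall>x\<in>U. \<forall>u\<in>U. \<forall>vs. length vs = k \<longrightarrow>
      norm (E k u vs - E k x vs) \<le> C * N (u - x) * prod_list (map N vs)"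
  proof -
    have "\<forall>b\<in>Basis. \<exists>C\<ge>0. \<forall>x\<in>U. \<forall>u\<in>U. \<forall>v. \<bar>D b k u v - D b k x v\<bar> \<le> C * N (u - x) * (\<Prod>l<k. N (v l))"
      using mD dD by (intro ballI line_deriv_lipschitz) auto
    then obtain C where C: "\<And>b. b \<in> Basis \<Longrightarrow> C b \<ge> 0" "\<And>b x u v. b \<in> Basis \<Longrightarrow> x \<in> U \<Longrightarrow> u \<in> U \<Longrightarrow>
        \<bar>D b k u v - D b k x v\<bar> \<le> C b * N (u - x) * (\<Prod>l<k. N (v l))" by metis
    have "norm (E k u vs - E k x vs) \<le> (\<Sum>b\<in>Basis. C b) * N (u - x) * prod_list (map N vs)"
      if "x \<in> U" "u \<in> U" "length vs = k" for x u vs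
    proof -
      have "E k u vs - E k x vs = (\<Sum>b\<in>Basis. (D b k u (args vs) - D b k x (args vs)) *\<^sub>R b)"
        by (simp add: E_def sum_subtractf algebra_simps)
      then have "norm (E k u vs - E k x vs) \<le> (\<Sum>b\<in>Basis. C b * N (u - x) * prod_list (map N vs))"
        using C(2)[OF _ that(1,2), of _ "args vs"] that(3)
        by (auto intro!: order_trans[OF norm_sum] sum_mono simp: prod_args[symmetric])
      then show ?thesis by (simp add: sum_distrib_right)
    qed
    then show ?thesis using C(1) by (intro exI[of _ "\<Sum>b\<in>Basis. C b"]) (auto intro: sum_nonneg)
  qed
  have rem: "\<exists>C\<ge>0. \<forall>x\<in>U. \<forall>u\<in>U. \<forall>vs. length vs = i \<longrightarrow>
      norm (E i u vs - E i x vs - E (Suc i) x ((u - x) # vs)) \<le> C * N (u - x) * N (u - x) * prod_list (map N vs)"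
    if i: "i < k" for i
  proof -
    have "\<forall>b\<in>Basis. \<exists>C\<ge>0. \<forall>x\<in>U. \<forall>u\<in>U. \<forall>v. \<bar>D b i u v - D b i x v - D b (Suc i) x (v(i := u - x))\<bar>
        \<le> C * N (u - x) * N (u - x) * (\<Prod>l<i. N (v l))"
    proof
      fix b :: 'y assume b: "b \<in> Basis"
      show "\<exists>C\<ge>0. \<forall>x\<in>U. \<forall>u\<in>U. \<forall>v. \<bar>D b i u v - D b i x v - D b (Suc i) x (v(i := u - x))\<bar>
          \<le> C * N (u - x) * N (u - x) * (\<Prod>l<i. N (v l))"
        using i by (intro line_deriv_remainder[OF dD[OF b] dD[OF b] mD[OF b] mD[OF b] mD[OF b]]) auto
    qed
    then obtain C where C: "\<And>b. b \<in> Basis \<Longrightarrow> C b \<ge> 0" "\<And>b x u v. b \<in> Basis \<Longrightarrow> x \<in> U \<Longrightarrow> u \<in> U \<Longrightarrow>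
        \<bar>D b i u v - D b i x v - D b (Suc i) x (v(i := u - x))\<bar>
        \<le> C b * N (u - x) * N (u - x) * (\<Prod>l<i. N (v l))" by metis
    have "norm (E i u vs - E i x vs - E (Suc i) x ((u - x) # vs))
        \<le> (\<Sum>b\<in>Basis. C b) * N (u - x) * N (u - x) * prod_list (map N vs)"
      if "x \<in> U" "u \<in> U" "length vs = i" for x u vs
    proof -
      have "E i u vs - E i x vs - E (Suc i) x ((u - x) # vs) =
          (\<Sum>b\<in>Basis. (D b i u (args vs) - D b i x (args vs) - D b (Suc i) x ((args vs)(i := u - x))) *\<^sub>R b)"
        using that(3) by (simp add: E_def sum_subtractf sum.distrib algebra_simps args_Cons)
      then have "norm (E i u vs - E i x vs - E (Suc i) x ((u - x) # vs))
          \<le> (\<Sum>b\<in>Basis. C b * N (u - x) * N (u - x) * prod_list (map N vs))"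
        using C(2)[OF _ that(1,2), of _ "args vs"] that(3)
        by (auto intro!: order_trans[OF norm_sum] sum_mono simp: prod_args[symmetric])
      then show ?thesis by (simp add: sum_distrib_right)
    qed
    then show ?thesis using C(1) by (intro exI[of _ "\<Sum>b\<in>Basis. C b"]) (auto intro: sum_nonneg)
  qed
  have small: "\<exists>d>0. \<forall>u. N (u - x) < d \<longrightarrow> C * N (u - x) \<le> \<epsilon>" if "0 < \<epsilon>" "0 \<le> C" for \<epsilon> C and x :: 'x
  proof (intro exI[of _ "\<epsilon> / (C + 1)"] conjI allI impI)
    show "0 < \<epsilon> / (C + 1)" using that by simp
    fix u assume "N (u - x) < \<epsilon> / (C + 1)"
    then have "(C + 1) * N (u - x) < \<epsilon>" using that by (simp add: field_simps)
    then show "C * N (u - x) \<le> \<epsilon>" unfolding distrib_right using N_nonneg[of "u - x"] by linarith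
  qed
  show ?thesis
    unfolding Ck_on_wrt_def
  proof (intro exI[of _ E] conjI ballI allI impI)
    fix x assume "x \<in> U"
    show "E 0 x [] = F x" using D0 by (simp add: E_def euclidean_representation)
  next
    fix j x assume j: "j \<le> k" and x: "x \<in> U"
    show "bounded_multilinear N j (E j x)"
      unfolding bounded_multilinear_def multi_bound_def
    proof (intro conjI allI impI)
      show "linear (\<lambda>w. E j x (vs[i := w]))" if "length vs = j" "i < j" for vs i
        using lin[OF _ x that] j by simp
      have "j \<le> Suc k" using j by simp
      from bound[OF this] show "\<exists>C. \<forall>vs. length vs = j \<longrightarrow> norm (E j x vs) \<le> C * prod_list (map N vs)"
        using x by blast
    qed
  next
    fix j x and \<epsilon> :: real assume j: "j < k" and x: "x \<in> U" and \<epsilon>: "0 < \<epsilon>"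
    obtain C where C: "C \<ge> 0" "\<And>u vs. u \<in> U \<Longrightarrow> length vs = j \<Longrightarrow>
        norm (E j u vs - E j x vs - E (Suc j) x ((u - x) # vs)) \<le> C * N (u - x) * N (u - x) * prod_list (map N vs)"
      using rem[OF j] x by blast
    obtain d where d: "d > 0" "\<And>u. N (u - x) < d \<Longrightarrow> C * N (u - x) \<le> \<epsilon>" using small[OF \<epsilon> C(1)] by blast
    show "\<exists>d>0. \<forall>u\<in>U. N (u - x) < d \<longrightarrow> multi_bound N j
        (\<lambda>vs. E j u vs - E j x vs - E (Suc j) x ((u - x) # vs)) (\<epsilon> * N (u - x))"
      unfolding multi_bound_def
      by (intro exI[of _ d] conjI d(1) ballI impI allI order_trans[OF C(2)] mult_right_mono d(2) pos) auto
  next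
    fix x and \<epsilon> :: real assume x: "x \<in> U" and \<epsilon>: "0 < \<epsilon>"
    obtain C where C: "C \<ge> 0" "\<And>u vs. u \<in> U \<Longrightarrow> length vs = k \<Longrightarrow>
        norm (E k u vs - E k x vs) \<le> C * N (u - x) * prod_list (map N vs)"
      using lip x by blast
    obtain d where d: "d > 0" "\<And>u. N (u - x) < d \<Longrightarrow> C * N (u - x) \<le> \<epsilon>" using small[OF \<epsilon> C(1)] by blast
    show "\<exists>d>0. \<forall>u\<in>U. N (u - x) < d \<longrightarrow> multi_bound N k (\<lambda>vs. E k u vs - E k x vs) \<epsilon>"
      unfolding multi_bound_def
      by (intro exI[of _ d] conjI d(1) ballI impI allI order_trans[OF C(2)] mult_right_mono d(2) pos) auto
  qed
qed

end

section \<open>Diagonalisation of symmetric matrices\<close>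

text \<open>
  A maximiser of the Rayleigh quotient on the unit sphere of the subspace: moving it in the direction
  of the residual would increase the quotient to first order.
\<close>

lemma self_adjoint_eigenvector:
  fixes f :: "'a::euclidean_space \<Rightarrow> 'a"
  assumes f: "linear f" and sa: "\<And>x y. f x \<bullet> y = x \<bullet> f y"
    and S: "subspace S" "f ` S \<subseteq> S" "S \<noteq> {0}"
  shows "\<exists>x\<in>S. norm x = 1 \<and> (\<exists>l. f x = l *\<^sub>R x)"
proof -
  obtain w where w: "w \<in> S" "w \<noteq> 0" using S(1,3) subspace_0 by blast
  have "compact (sphere 0 1 \<inter> S)"
    using S(1) by (intro compact_Int_closed compact_sphere closed_subspace)
  moreover have "(1 / norm w) *\<^sub>R w \<in> sphere 0 1 \<inter> S"
    using w S(1) by (auto intro: subspace_scale)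
  moreover have "continuous_on (sphere 0 1 \<inter> S) (\<lambda>x. x \<bullet> f x)"
    using f by (intro continuous_intros linear_continuous_on linear_conv_bounded_linear[THEN iffD1])
  ultimately obtain x where x: "x \<in> sphere 0 1 \<inter> S"
    and max: "\<And>y. y \<in> sphere 0 1 \<inter> S \<Longrightarrow> y \<bullet> f y \<le> x \<bullet> f x"
    using continuous_attains_sup[of "sphere 0 1 \<inter> S" "\<lambda>x. x \<bullet> f x"] by blast
  define l where "l = x \<bullet> f x"
  have nx: "norm x = 1" "x \<in> S" using x by auto
  have rayleigh: "y \<bullet> f y \<le> l * (norm y)\<^sup>2" if "y \<in> S" for y
  proof (cases "y = 0")
    case False
    have "((1 / norm y) *\<^sub>R y) \<bullet> f ((1 / norm y) *\<^sub>R y) \<le> l"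
      unfolding l_def using that False S(1) by (intro max) (auto intro: subspace_scale)
    then show ?thesis
      using False by (simp add: linear_scale[OF f] power2_eq_square field_simps)
  qed (simp add: linear_0[OF f])
  have "f x - l *\<^sub>R x = 0"
  proof -
    define r where "r = f x - l *\<^sub>R x"
    have rS: "r \<in> S" unfolding r_def using nx(2) S by (auto intro!: subspace_diff subspace_scale)
    have key: "2 * t * (r \<bullet> r) \<le> t\<^sup>2 * (l * (norm r)\<^sup>2 - r \<bullet> f r)" for t
    proof -
      have "(x + t *\<^sub>R r) \<bullet> f (x + t *\<^sub>R r) \<le> l * (norm (x + t *\<^sub>R r))\<^sup>2"
        using nx(2) rS S(1) by (intro rayleigh) (auto intro: subspace_add subspace_scale)
      moreover have "(x + t *\<^sub>R r) \<bullet> f (x + t *\<^sub>R r) = l + 2 * t * (r \<bullet> f x) + t\<^sup>2 * (r \<bullet> f r)"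
        using sa[of x r] by (simp add: linear_add[OF f] linear_scale[OF f] inner_simps l_def
            power2_eq_square inner_commute algebra_simps)
      moreover have "l * (norm (x + t *\<^sub>R r))\<^sup>2 = l + 2 * t * (l * (r \<bullet> x)) + t\<^sup>2 * (l * (norm r)\<^sup>2)"
      proof -
        have "(norm (x + t *\<^sub>R r))\<^sup>2 = 1 + 2 * t * (r \<bullet> x) + t\<^sup>2 * (norm r)\<^sup>2"
          using nx(1) unfolding power2_norm_eq_inner norm_eq_1
          by (simp add: inner_simps inner_commute power2_eq_square)
        then show ?thesis by (simp add: algebra_simps)
      qed
      moreover have "r \<bullet> r = r \<bullet> f x - l * (r \<bullet> x)"
        by (simp add: r_def inner_simps)
      then have "2 * t * (r \<bullet> r) = 2 * t * (r \<bullet> f x) - 2 * t * (l * (r \<bullet> x))"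
        by (simp only: right_diff_distrib)
      ultimately show ?thesis unfolding right_diff_distrib by linarith
    qed
    define K where "K = l * (norm r)\<^sup>2 - r \<bullet> f r"
    have "r \<bullet> r \<le> 0"
    proof (rule ccontr)
      assume a: "\<not> ?thesis"
      \<comment> \<open>a step so small that the linear term dominates the quadratic one\<close>
      define t where "t = (r \<bullet> r) / (\<bar>K\<bar> + 1)"
      have t: "t > 0" unfolding t_def using a by (intro divide_pos_pos) auto
      have "2 * (r \<bullet> r) \<le> t * K"
        using key[of t] t by (simp add: K_def power2_eq_square mult.assoc mult.left_commute)
      also have "\<dots> \<le> t * (\<bar>K\<bar> + 1)" using t by (intro mult_left_mono) auto
      also have "\<dots> = r \<bullet> r" by (simp add: t_def)
      finally show False using a by simp
    qed
    then have "r = 0" using inner_gt_zero_iff[of r] by (metis not_le)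
    then show ?thesis by (simp add: r_def)
  qed
  then show ?thesis using nx by (intro bexI[of _ x]) auto
qed

text \<open>
  Split off an eigenvector; its orthogonal complement in the subspace is invariant again.
\<close>

lemma self_adjoint_orthonormal_eigenbasis:
  fixes f :: "'a::euclidean_space \<Rightarrow> 'a"
  assumes f: "linear f" and sa: "\<And>x y. f x \<bullet> y = x \<bullet> f y"
  shows "subspace S \<Longrightarrow> f ` S \<subseteq> S \<Longrightarrow>
    \<exists>B. B \<subseteq> S \<and> pairwise orthogonal B \<and> (\<forall>b\<in>B. norm b = 1 \<and> (\<exists>l. f b = l *\<^sub>R b)) \<and> S \<subseteq> span B"
proof (induction "dim S" arbitrary: S rule: less_induct)
  case less
  show ?case
  proof (cases "S = {0}")
    case True then show ?thesis by (intro exI[of _ "{}"]) auto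
  next
    case False
    obtain x l where x: "x \<in> S" "norm x = 1" "f x = l *\<^sub>R x"
      using self_adjoint_eigenvector[OF f sa less.prems False] by blast
    define T where "T = {y \<in> S. orthogonal x y}"
    have T: "subspace T" unfolding T_def using less.prems(1)
      by (auto simp: subspace_def orthogonal_clauses)
    have "f ` T \<subseteq> T"
    proof clarify
      fix y assume "y \<in> T"
      then show "f y \<in> T"
        using less.prems(2) sa[of x y] x(3) by (auto simp: T_def orthogonal_def)
    qed
    moreover have "dim T < dim S"
    proof (rule dim_psubset)
      have "x \<notin> T" using x by (simp add: T_def orthogonal_def norm_eq_1)
      then have "T \<subset> S" using x(1) by (auto simp: T_def)
      then show "span T \<subset> span S" using T less.prems(1) by (simp add: span_eq_iff[THEN iffD2])
    qed
    ultimately obtain B where B: "B \<subseteq> T" "pairwise orthogonal B"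
        "\<forall>b\<in>B. norm b = 1 \<and> (\<exists>l. f b = l *\<^sub>R b)" "T \<subseteq> span B"
      using less.hyps[OF _ T] by blast
    have "S \<subseteq> span (insert x B)"
    proof
      fix y assume y: "y \<in> S"
      have "y - (x \<bullet> y) *\<^sub>R x \<in> T"
        using y x less.prems(1) by (auto simp: T_def orthogonal_def inner_simps norm_eq_1 intro!: subspace_diff subspace_scale)
      then show "y \<in> span (insert x B)" unfolding span_insert using B(4) by blast
    qed
    moreover have "pairwise orthogonal (insert x B)"
      using B(1,2) by (auto simp: pairwise_insert T_def orthogonal_commute)
    ultimately show ?thesis
      using B x T_def by (intro exI[of _ "insert x B"]) auto
  qed
qed

definition diag :: "('n \<Rightarrow> real) \<Rightarrow> real ^ 'n ^ 'n" where
  "diag l = (\<chi> i j. if i = j then l i else 0)"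

lemma diag_vector: "(diag l *v x) $ i = l i * x $ i"
proof -
  have "(\<Sum>j\<in>UNIV. (if i = j then l i else 0) * x $ j) = (\<Sum>j\<in>UNIV. if j = i then l i * x $ j else 0)"
    by (intro sum.cong) auto
  then show ?thesis by (simp add: diag_def matrix_vector_mult_def)
qed

lemma det_diag: "det (diag l) = prod l UNIV"
  unfolding diag_def by (subst det_diagonal) auto

lemma inner_transpose: "x \<bullet> (transpose A *v y) = (A *v x) \<bullet> y" for A :: "real ^ 'm ^ 'n"
  by (metis dot_lmul_matrix inner_commute transpose_matrix_vector transpose_transpose)

lemma matrix_eqI_vector: "(\<And>x. A *v x = B *v x) \<Longrightarrow> A = B" for A :: "real ^ 'm ^ 'n"
  by (simp add: matrix_eq)

lemma spectral_theorem:
  fixes A :: "real ^ 'n ^ 'n"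
  assumes A: "transpose A = A"
  shows "\<exists>(P :: real ^ 'n ^ 'n) l. transpose P ** P = mat 1 \<and> P ** transpose P = mat 1 \<and> A = transpose P ** diag l ** P"
proof -
  have "linear (\<lambda>x. A *v x)" by (rule matrix_vector_mul_linear)
  moreover have "(A *v x) \<bullet> y = x \<bullet> (A *v y)" for x y using inner_transpose[of x A y] A by simp
  ultimately obtain B where B: "pairwise orthogonal B" "\<forall>b\<in>B. norm b = 1 \<and> (\<exists>l. A *v b = l *\<^sub>R b)"
      "UNIV \<subseteq> span B"
    using self_adjoint_orthonormal_eigenbasis[of "\<lambda>x. A *v x" UNIV] by auto
  have ind: "independent B" using B(1,2) by (intro pairwise_orthogonal_independent) auto
  have "card B = CARD('n)"
    using basis_card_eq_dim[of B UNIV] B(3) ind by (simp add: dim_UNIV)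
  moreover have "finite B" using ind by (rule independent_imp_finite)
  ultimately obtain e where e: "bij_betw e (UNIV :: 'n set) B"
    by (metis finite finite_same_card_bij)
  have eB: "e i \<in> B" for i using e by (auto simp: bij_betw_def)
  have inj: "e i = e j \<longleftrightarrow> i = j" for i j using e by (auto simp: bij_betw_def inj_on_def)
  have "\<forall>i. \<exists>l. A *v e i = l *\<^sub>R e i" using B(2) eB by blast
  then obtain l where l: "\<And>i. A *v e i = l i *\<^sub>R e i" by metis
  have on: "e i \<bullet> e j = (if i = j then 1 else 0)" for i j
    using B(1,2) eB[of i] eB[of j] inj[of i j] by (auto simp: pairwise_def orthogonal_def norm_eq_1)
  define P :: "real ^ 'n ^ 'n" where "P = (\<chi> i. e i)"
  have PP: "P ** transpose P = mat 1"
    by (simp add: P_def matrix_matrix_mult_def transpose_def mat_def vec_eq_iff on[unfolded inner_vec_def inner_real_def])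
  then have PP': "transpose P ** P = mat 1" by (simp add: matrix_left_right_inverse)
  have Pv: "(P *v x) $ i = e i \<bullet> x" for x i by (simp add: P_def matrix_vector_mult_def inner_vec_def)
  have "A = transpose P ** diag l ** P"
  proof (rule matrix_eqI_vector)
    fix x
    have "P *v (A *v x) = diag l *v (P *v x)"
    proof (rule vec_eq_iff[THEN iffD2], rule allI)
      fix i
      have "e i \<bullet> (A *v x) = (A *v e i) \<bullet> x" using inner_transpose[of "e i" A x] A by simp
      then show "(P *v (A *v x)) $ i = (diag l *v (P *v x)) $ i"
        by (simp add: Pv diag_vector l)
    qed
    then have "transpose P *v (P *v (A *v x)) = transpose P *v (diag l *v (P *v x))" by simp
    then show "A *v x = (transpose P ** diag l ** P) *v x"
      by (simp add: matrix_vector_mul_assoc matrix_mul_assoc PP')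
  qed
  then show ?thesis using PP PP' by blast
qed

lemma quadratic_form_congruence: "x \<bullet> ((transpose G ** A ** G) *v x) = (G *v x) \<bullet> (A *v (G *v x))"
  for G A :: "real ^ 'n ^ 'n"
  by (simp add: matrix_vector_mul_assoc[symmetric] inner_transpose del: transpose_matrix_vector)

lemma quadratic_form_diag: "y \<bullet> (diag l *v y) = (\<Sum>i\<in>UNIV. l i * (y $ i)\<^sup>2)"
  by (simp add: inner_vec_def diag_vector power2_eq_square mult_ac)

lemma pos_def_sym: "A \<in> pos_def_mats \<Longrightarrow> transpose A = A"
  and pos_def_pos: "A \<in> pos_def_mats \<Longrightarrow> x \<noteq> 0 \<Longrightarrow> x \<bullet> (A *v x) > 0"
  by (auto simp: pos_def_mats_def)

lemma pos_def_spectral: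
  fixes A :: "real ^ 'n ^ 'n"
  assumes A: "A \<in> pos_def_mats"
  shows "\<exists>(P :: real ^ 'n ^ 'n) l. transpose P ** P = mat 1 \<and> P ** transpose P = mat 1 \<and> A = transpose P ** diag l ** P \<and> (\<forall>i. l i > 0)"
proof -
  obtain P :: "real ^ 'n ^ 'n" and l where P: "transpose P ** P = mat 1" "P ** transpose P = mat 1" "A = transpose P ** diag l ** P"
    using spectral_theorem[OF pos_def_sym[OF A]] by blast
  have "l i > 0" for i
  proof -
    define x where "x = transpose P *v axis i 1"
    have Px: "P *v x = axis i 1" by (simp add: x_def matrix_vector_mul_assoc P(2) del: transpose_matrix_vector)
    then have "x \<noteq> 0" by (metis axis_eq_0_iff matrix_vector_mult_0_right zero_neq_one)
    then have "x \<bullet> (A *v x) > 0" by (rule pos_def_pos[OF A])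
    moreover have "x \<bullet> (A *v x) = (\<Sum>j\<in>UNIV. if j = i then l j else 0)"
      unfolding P(3) quadratic_form_congruence Px quadratic_form_diag
      by (intro sum.cong) (auto simp: axis_def)
    ultimately show ?thesis by simp
  qed
  then show ?thesis using P by blast
qed

lemma det_orthonormal: "transpose P ** P = mat 1 \<Longrightarrow> det P * det P = 1" for P :: "real ^ 'n ^ 'n"
  by (metis det_I det_mul det_transpose)

lemma pos_def_factor:
  fixes A :: "real ^ 'n ^ 'n"
  assumes A: "A \<in> pos_def_mats"
  shows "\<exists>G :: real ^ 'n ^ 'n. invertible G \<and> A = transpose G ** G"
proof -
  obtain P :: "real ^ 'n ^ 'n" and l where P: "transpose P ** P = mat 1" "P ** transpose P = mat 1" "A = transpose P ** diag l ** P" "\<And>i. l i > 0"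
    using pos_def_spectral[OF A] by blast
  define G where "G = diag (\<lambda>i. sqrt (l i)) ** P"
  have "diag (\<lambda>i. sqrt (l i)) ** diag (\<lambda>i. sqrt (l i)) = diag l"
    using P(4) by (intro matrix_eqI_vector) (simp add: vec_eq_iff matrix_vector_mul_assoc[symmetric] diag_vector less_imp_le)
  moreover have "transpose (diag (\<lambda>i. sqrt (l i))) = diag (\<lambda>i. sqrt (l i))"
    by (auto simp: diag_def transpose_def vec_eq_iff)
  ultimately have "A = transpose G ** G"
    unfolding P(3) G_def matrix_transpose_mul by (metis matrix_mul_assoc)
  moreover have "det G \<noteq> 0"
    using P(4) det_orthonormal[OF P(1)] by (auto simp: G_def det_mul det_diag less_imp_neq[symmetric])
  ultimately show ?thesis by (auto simp: invertible_det_nz)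
qed

lemma congruence_pos_def:
  fixes A G :: "real ^ 'n ^ 'n"
  assumes A: "A \<in> pos_def_mats" and G: "invertible G"
  shows "transpose G ** A ** G \<in> pos_def_mats"
proof -
  have "transpose (transpose G ** A ** G) = transpose G ** A ** G"
    using pos_def_sym[OF A] by (simp add: matrix_transpose_mul matrix_mul_assoc)
  moreover have "x \<bullet> ((transpose G ** A ** G) *v x) > 0" if "x \<noteq> 0" for x
  proof -
    have "G *v x \<noteq> 0" using G that
      by (metis invertible_def matrix_vector_mul_assoc matrix_vector_mul_lid matrix_vector_mult_0_right)
    then show ?thesis unfolding quadratic_form_congruence by (rule pos_def_pos[OF A])
  qed
  ultimately show ?thesis by (simp add: pos_def_mats_def)
qed

lemma mat_1_pos_def: "mat 1 \<in> pos_def_mats"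
  by (simp add: pos_def_mats_def)

lemma pos_def_det_pos:
  fixes A :: "real ^ 'n ^ 'n"
  assumes "A \<in> pos_def_mats" shows "det A > 0"
proof -
  obtain G :: "real ^ 'n ^ 'n" where "invertible G" "A = transpose G ** G" using pos_def_factor[OF assms] by blast
  then show ?thesis
    by (metis det_mul det_transpose invertible_det_nz not_real_square_gt_zero)
qed

text \<open>
  In coordinates that turn \<^term>\<open>A\<close> into the identity, diagonalise \<^term>\<open>B\<close>. This replaces the
  geodesics of the cone of positive definite matrices.
\<close>

lemma simultaneous_diagonalisation:
  fixes A B :: "real ^ 'n ^ 'n"
  assumes A: "A \<in> pos_def_mats" and B: "B \<in> pos_def_mats"
  shows "\<exists>(G :: real ^ 'n ^ 'n) l. invertible G \<and> (\<forall>i. l i > 0) \<and> A = transpose G ** G \<and> B = transpose G ** diag l ** G"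
proof -
  obtain G :: "real ^ 'n ^ 'n" where G: "invertible G" "A = transpose G ** G" using pos_def_factor[OF A] by blast
  obtain H where H: "G ** H = mat 1" "H ** G = mat 1" using G(1) by (auto simp: invertible_def)
  have tH: "transpose H ** transpose G = mat 1" "transpose G ** transpose H = mat 1"
    using H by (metis matrix_transpose_mul transpose_mat)+
  have "transpose H ** B ** H \<in> pos_def_mats"
    using H by (intro congruence_pos_def B) (auto simp: invertible_def)
  then obtain P :: "real ^ 'n ^ 'n" and l where P: "transpose P ** P = mat 1" "P ** transpose P = mat 1"
      "transpose H ** B ** H = transpose P ** diag l ** P" "\<And>i. l i > 0"
    using pos_def_spectral by blast
  have "B = transpose G ** (transpose H ** B ** H) ** G"
    by (metis (no_types, opaque_lifting) H(2) tH(2) matrix_mul_assoc matrix_mul_lid matrix_mul_rid)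
  also have "\<dots> = transpose (P ** G) ** diag l ** (P ** G)"
    by (simp add: P(3) matrix_transpose_mul matrix_mul_assoc)
  finally have "B = transpose (P ** G) ** diag l ** (P ** G)" .
  moreover have "A = transpose (P ** G) ** (P ** G)"
    unfolding G(2) matrix_transpose_mul by (metis P(1) matrix_mul_assoc matrix_mul_lid)
  moreover have "invertible (P ** G)"
    using G(1) P(1,2) by (intro invertible_mult) (auto simp: invertible_def)
  ultimately show ?thesis using P(4) by blast
qed

section \<open>Rational kernels and their integrals\<close>

text \<open>
  The embedding of the observation space as an affine hyperplane off the origin. Affine subspaces
  become linear ones, and location and scatter become scatter alone.
\<close>

definition augment :: "real ^ 'd \<Rightarrow> real ^ 'd option" where
  "augment y = (\<chi> i. case i of None \<Rightarrow> 1 | Some j \<Rightarrow> y $ j)"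

lemma augment_None [simp]: "augment y $ None = 1" and augment_Some [simp]: "augment y $ Some j = y $ j"
  by (simp_all add: augment_def)

lemma norm_augment_sq: "(norm (augment y))\<^sup>2 = 1 + (norm y)\<^sup>2"
  by (simp add: power2_norm_eq_inner inner_vec_def UNIV_option_conv sum.reindex)

lemma norm_augment_ge_1: "1 \<le> (norm (augment y))\<^sup>2"
  by (simp add: norm_augment_sq)

lemma continuous_augment: "continuous_on UNIV augment"
  unfolding augment_def
proof (rule continuous_on_vec_lambda)
  show "continuous_on UNIV (\<lambda>y :: real ^ 'a. case i of None \<Rightarrow> 1 | Some j \<Rightarrow> y $ j)" for i
    by (cases i) (auto intro!: continuous_intros)
qed

definition qf :: "real ^ ('d::finite) option ^ 'd option \<Rightarrow> real ^ 'd \<Rightarrow> real" where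
  "qf M y = augment y \<bullet> (M *v augment y)"

lemma qf_entries: "qf M y = (\<Sum>i\<in>UNIV. \<Sum>j\<in>UNIV. M $ i $ j * (augment y $ i * augment y $ j))"
  by (simp add: qf_def inner_vec_def matrix_vector_mult_def sum_distrib_left mult_ac)

lemma qf_add: "qf (A + B) y = qf A y + qf B y"
  by (simp add: qf_def matrix_vector_mult_add_rdistrib inner_right_distrib)

lemma qf_scale: "qf (c *\<^sub>R A) y = c * qf A y"
  by (simp add: qf_def scaleR_matrix_vector_assoc[symmetric])

lemma qf_diff: "qf (A - B) y = qf A y - qf B y"
  by (simp add: qf_def matrix_vector_mult_diff_rdistrib inner_diff_right)

lemma continuous_qf: "continuous_on UNIV (qf M)"
  unfolding qf_def
  by (intro continuous_intros continuous_augment linear_continuous_on_compose[OF continuous_augment] matrix_vector_mul_linear)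

lemma measurable_qf [measurable]: "qf M \<in> borel_measurable borel"
  by (rule borel_measurable_continuous_onI[OF continuous_qf])

lemma norm_matrix_vector_le: "norm (M *v x) \<le> norm M * norm x" for M :: "real ^ 'n ^ 'm"
proof -
  have "norm (M *v x) \<le> norm (\<chi> i. norm (M $ i) * norm x)"
    unfolding norm_vec_def[of "M *v x"] norm_vec_def[of "\<chi> i. norm (M $ i) * norm x"]
    by (intro L2_set_mono) (auto simp: matrix_vector_mul_component intro!: order_trans[OF norm_cauchy_schwarz] order_trans[OF Cauchy_Schwarz_ineq2])
  also have "\<dots> = norm x * norm M"
    unfolding norm_vec_def[of "\<chi> i. norm (M $ i) * norm x"] norm_vec_def[of M]
    by (simp add: L2_set_right_distrib mult.commute)
  finally show ?thesis by (simp add: mult.commute)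
qed

lemma abs_quadratic_form_le: "\<bar>x \<bullet> (M *v x)\<bar> \<le> norm M * (norm x)\<^sup>2" for M :: "real ^ 'n ^ 'n"
proof -
  have "\<bar>x \<bullet> (M *v x)\<bar> \<le> norm x * norm (M *v x)" by (rule Cauchy_Schwarz_ineq2)
  also have "\<dots> \<le> norm x * (norm M * norm x)" by (intro mult_left_mono norm_matrix_vector_le) auto
  finally show ?thesis by (simp add: power2_eq_square mult_ac)
qed

lemma abs_qf_le: "\<bar>qf M y\<bar> \<le> norm M * (norm (augment y))\<^sup>2"
  unfolding qf_def by (rule abs_quadratic_form_le)

lemma poly_augment: "poly_fun_le 1 (\<lambda>y. augment y $ i)"
  using poly_fun_le_coord by (cases i) (auto intro: poly_fun_le_const)

lemma poly_qf: "poly_fun_le 2 (qf M)"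
proof -
  have "poly_fun_le 2 (\<lambda>y. augment y $ i * augment y $ j)" for i j
    using poly_fun_le_mult[OF poly_augment poly_augment, of i j] by (simp add: numeral_2_eq_2)
  then show ?thesis unfolding qf_entries
    by (intro poly_fun_le_sum poly_fun_le_scale) auto
qed

lemma poly_prod_qf: "poly_fun_le (2 * length Ms) (\<lambda>y. \<Prod>M\<leftarrow>Ms. qf M y)"
proof (induction Ms)
  case (Cons M Ms)
  then show ?case using poly_fun_le_mult[OF poly_qf[of M] Cons.IH] by simp
qed (simp add: poly_fun_le_const)

lemma poly_power: "poly_fun_le r f \<Longrightarrow> poly_fun_le (r * p) (\<lambda>y. f y ^ p)"
  by (induction p) (auto intro: poly_fun_le_const poly_fun_le_mult)

text \<open>
  Meant for arbitrary square matrices: the implicit function is constructed among all matrices near a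
  given one, and the symmetry of its values comes out of the equation.
\<close>

definition coercive :: "real \<Rightarrow> real ^ 'n ^ 'n \<Rightarrow> bool" where
  "coercive \<kappa> B \<longleftrightarrow> (\<forall>x. \<kappa> * (norm x)\<^sup>2 \<le> x \<bullet> (B *v x))"

lemma coercive_qf: "coercive \<kappa> B \<Longrightarrow> \<kappa> * (norm (augment y))\<^sup>2 \<le> qf B y"
  by (simp add: coercive_def qf_def)

lemma coercive_near:
  assumes "coercive \<kappa> A" "norm (B - A) \<le> e" shows "coercive (\<kappa> - e) B"
  unfolding coercive_def
proof
  fix x
  have "x \<bullet> (B *v x) = x \<bullet> (A *v x) + x \<bullet> ((B - A) *v x)"
    by (simp add: matrix_vector_mult_diff_rdistrib inner_diff_right)
  moreover have "\<bar>x \<bullet> ((B - A) *v x)\<bar> \<le> e * (norm x)\<^sup>2"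
    using assms(2) by (intro order_trans[OF abs_quadratic_form_le] mult_right_mono) auto
  ultimately show "(\<kappa> - e) * (norm x)\<^sup>2 \<le> x \<bullet> (B *v x)"
    using assms(1)[unfolded coercive_def, rule_format, of x] by (simp add: left_diff_distrib)
qed

text \<open>
  This family is closed under differentiation with respect to \<^term>\<open>B\<close>: a derivative in direction
  \<^term>\<open>H\<close> brings, up to a constant, one more factor in the numerator and one more power of the
  denominator.
\<close>

definition kernel :: "real \<Rightarrow> real ^ ('d::finite) option ^ 'd option \<Rightarrow> (real ^ ('d::finite) option ^ 'd option) list \<Rightarrow> real ^ 'd \<Rightarrow> real" where
  "kernel c B Ms y = (\<Prod>M\<leftarrow>Ms. qf M y) / (c + qf B y) ^ length Ms"

lemma measurable_kernel: "kernel c B Ms \<in> borel_measurable borel"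
proof -
  have "(\<lambda>y. \<Prod>M\<leftarrow>Ms. qf M y) \<in> borel_measurable borel"
    by (induction Ms) auto
  then show ?thesis unfolding kernel_def by measurable
qed

lemma denominator_pos:
  assumes "0 < c" "0 < \<kappa>" "coercive \<kappa> B"
  shows "\<kappa> * (norm (augment y))\<^sup>2 \<le> c + qf B y" "0 < c + qf B y"
proof -
  show "\<kappa> * (norm (augment y))\<^sup>2 \<le> c + qf B y"
    using assms(1) coercive_qf[OF assms(3), of y] by linarith
  then show "0 < c + qf B y" using assms(2) norm_augment_ge_1[of y]
    by (meson less_le_trans mult_pos_pos zero_less_one)
qed

lemma abs_ratio_le:
  assumes "0 < c" "0 < \<kappa>" "coercive \<kappa> B"
  shows "\<bar>qf M y / (c + qf B y)\<bar> \<le> norm M / \<kappa>"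
proof -
  note d = denominator_pos[OF assms, of y]
  have "\<kappa> * \<bar>qf M y\<bar> \<le> norm M * (\<kappa> * (norm (augment y))\<^sup>2)"
    using mult_left_mono[OF abs_qf_le[of M y], of \<kappa>] assms(2) by (simp add: mult_ac)
  also have "\<dots> \<le> norm M * (c + qf B y)" using d(1) by (intro mult_left_mono) auto
  finally show ?thesis using d(2) assms(2) by (simp add: abs_divide divide_simps mult.commute)
qed

lemma kernel_Cons: "kernel c B (M # Ms) y = qf M y / (c + qf B y) * kernel c B Ms y"
  by (simp add: kernel_def)

lemma abs_kernel_le:
  assumes "0 < c" "0 < \<kappa>" "coercive \<kappa> B"
  shows "\<bar>kernel c B Ms y\<bar> \<le> (\<Prod>M\<leftarrow>Ms. norm M / \<kappa>)"
proof (induction Ms)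
  case (Cons M Ms)
  have "0 \<le> (\<Prod>M\<leftarrow>Ms. norm M / \<kappa>)" using Cons.IH abs_ge_zero order_trans by blast
  then show ?case
    unfolding kernel_Cons abs_mult list.map prod_list.Cons using assms(2)
    by (intro mult_mono abs_ratio_le[OF assms] Cons.IH) auto
qed (simp add: kernel_def)

text \<open>
  Multiplying by the positive denominator turns the level condition into a polynomial inequality of
  degree twice the number of factors.
\<close>

lemma kernel_levels:
  assumes "0 < c" "0 < \<kappa>" "coercive \<kappa> B" "2 * length Ms \<le> r"
  shows "{y. t < kernel c B Ms y} \<in> poly_pos_sets r"
proof -
  let ?p = "\<lambda>y. (\<Prod>M\<leftarrow>Ms. qf M y) + - t * (c + qf B y) ^ length Ms"
  have "poly_fun_le (2 * length Ms) (\<lambda>y. (c + qf B y) ^ length Ms)"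
    by (intro poly_power poly_fun_le_add poly_fun_le_const poly_qf)
  then have "poly_fun_le (2 * length Ms) ?p"
    by (intro poly_fun_le_add poly_prod_qf poly_fun_le_scale)
  then have 1: "poly_fun_le r ?p" using assms(4) by (rule poly_fun_le_mono)
  have "t < kernel c B Ms y \<longleftrightarrow> 0 < ?p y" for y
    using denominator_pos(2)[OF assms(1-3), of y] by (simp add: kernel_def pos_less_divide_eq)
  then have "{y. t < kernel c B Ms y} = {y. 0 < ?p y}" by blast
  with 1 show ?thesis unfolding poly_pos_sets_def by (intro CollectI exI[of _ ?p] conjI)
qed

definition J :: "real \<Rightarrow> real ^ ('d::finite) option ^ 'd option \<Rightarrow> (real ^ ('d::finite) option ^ 'd option) list \<Rightarrow>
    (real ^ 'd) signed_measure \<Rightarrow> real" where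
  "J c B Ms \<phi> = sint \<phi> (kernel c B Ms)"

text \<open>
  Kernels with at most \<^term>\<open>k + 2\<close> factors are controlled by the seminorm of degree
  \<^term>\<open>2 * k + 4\<close>; this is where the degree in the final theorem comes from.
\<close>

lemma J_bound:
  assumes "0 < c" "0 < \<kappa>" "coercive \<kappa> B" "2 * length Ms \<le> r"
  shows "\<bar>J c B Ms \<phi>\<bar> \<le> 3 * (\<Prod>M\<leftarrow>Ms. norm M / \<kappa>) * poly_norm r \<phi>"
  unfolding J_def
  by (rule sint_poly_norm_bound[OF measurable_kernel abs_kernel_le[OF assms(1-3)] kernel_levels[OF assms]])

lemma linear_J:
  assumes "0 < c" "0 < \<kappa>" "coercive \<kappa> B"
  shows "linear (J c B Ms)"
  by (rule linearI; unfold J_def)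
    (simp_all add: sint_add_measure[OF measurable_kernel abs_kernel_le[OF assms]]
      sint_scale_measure[OF measurable_kernel abs_kernel_le[OF assms]])

lemma linear_J_head:
  assumes "0 < c" "0 < \<kappa>" "coercive \<kappa> B"
  shows "linear (\<lambda>H. J c B (H # Ms) \<phi>)"
proof (rule linearI; unfold J_def)
  fix H K
  have "kernel c B ((H + K) # Ms) = (\<lambda>y. kernel c B (H # Ms) y + kernel c B (K # Ms) y)"
    by (rule ext) (simp add: kernel_def qf_add distrib_right add_divide_distrib)
  then show "sint \<phi> (kernel c B ((H + K) # Ms)) = sint \<phi> (kernel c B (H # Ms)) + sint \<phi> (kernel c B (K # Ms))"
    by (simp add: sint_add[OF measurable_kernel abs_kernel_le[OF assms] measurable_kernel abs_kernel_le[OF assms]])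
next
  fix t H
  have "kernel c B ((t *\<^sub>R H) # Ms) = (\<lambda>y. t * kernel c B (H # Ms) y)"
    by (rule ext) (simp add: kernel_def qf_scale)
  then show "sint \<phi> (kernel c B ((t *\<^sub>R H) # Ms)) = t *\<^sub>R sint \<phi> (kernel c B (H # Ms))"
    by (simp add: sint_mult)
qed

definition matrix_unit :: "'n \<Rightarrow> 'n \<Rightarrow> real ^ 'n ^ 'n" where
  "matrix_unit i j = axis i (axis j 1)"

lemma matrix_unit_nth: "matrix_unit i j $ k $ l = (if k = i \<and> l = j then 1 else 0)"
  by (simp add: matrix_unit_def axis_def)

lemma sum_matrix_unit: "(\<Sum>k\<in>UNIV. \<Sum>l\<in>UNIV. matrix_unit i j $ k $ l * g k l) = g i j"
proof -
  have "(\<Sum>l\<in>UNIV. matrix_unit i j $ k $ l * g k l) = (if k = i then g i j else 0)" for k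
  proof -
    have "(\<Sum>l\<in>UNIV. matrix_unit i j $ k $ l * g k l) = (\<Sum>l\<in>UNIV. if l = j then (if k = i then g k l else 0) else 0)"
      by (intro sum.cong) (auto simp: matrix_unit_nth)
    then show ?thesis by simp
  qed
  then show ?thesis by simp
qed

lemma qf_matrix_unit: "qf (matrix_unit i j) y = augment y $ i * augment y $ j"
  unfolding qf_entries by (rule sum_matrix_unit)

lemma norm_matrix_unit [simp]: "norm (matrix_unit i j) = 1"
  by (simp add: matrix_unit_def)

lemma matrix_expansion: "M = (\<Sum>i\<in>UNIV. \<Sum>j\<in>UNIV. M $ i $ j *\<^sub>R matrix_unit i j)" for M :: "real ^ 'n ^ 'n"
proof (simp only: vec_eq_iff, intro allI)
  fix k l
  have "matrix_unit i j $ k $ l = matrix_unit k l $ i $ j" for i j :: 'n by (auto simp: matrix_unit_nth)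
  then show "M $ k $ l = (\<Sum>i\<in>UNIV. \<Sum>j\<in>UNIV. M $ i $ j *\<^sub>R matrix_unit i j) $ k $ l"
    using sum_matrix_unit[of k l "\<lambda>i j. M $ i $ j"] by (simp add: mult.commute)
qed

lemma linear_matrix_expansion:
  fixes f :: "real ^ 'n ^ 'n \<Rightarrow> 'b::real_vector"
  assumes "linear f" shows "f M = (\<Sum>i\<in>UNIV. \<Sum>j\<in>UNIV. M $ i $ j *\<^sub>R f (matrix_unit i j))"
  using arg_cong[OF matrix_expansion, of f M] by (simp add: linear_sum[OF assms] linear_scale[OF assms])

lemma inverse_power_expansion:
  assumes "0 < e"
  shows "\<exists>d>0. \<forall>s::real. \<bar>s\<bar> < d \<longrightarrow> \<bar>1 / (1 + s) ^ p - 1 + real p * s\<bar> \<le> e * \<bar>s\<bar>"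
proof -
  have "((\<lambda>s::real. 1 / (1 + s) ^ p) has_real_derivative - real p) (at 0)"
    by (auto intro!: derivative_eq_intros)
  then have "((\<lambda>s::real. 1 / (1 + s) ^ p) has_derivative (\<lambda>s. - real p * s)) (at 0)"
    unfolding has_field_derivative_def .
  then obtain d where "d > 0" "\<And>s. norm (s - 0) < d \<Longrightarrow>
      norm (1 / (1 + s) ^ p - 1 / (1 + 0) ^ p - - real p * (s - 0)) \<le> e * norm (s - (0::real))"
    using assms unfolding has_derivative_at_alt by blast
  then show ?thesis by auto
qed

text \<open>
  Up to a bounded factor the difference of two kernels is \<^term>\<open>1 / (1 + s) ^ p - 1\<close> where
  \<^term>\<open>s\<close> is the ratio of the two quadratic forms, which is at most
  \<^term>\<open>norm H / \<kappa>\<close> for every observation. The expansion at \<^term>\<open>s = 0\<close> is therefore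
  uniform, and the total variation bound applies to the error.
\<close>

lemma has_derivative_J:
  assumes c: "0 < c" and l: "0 < \<kappa>" and B: "coercive \<kappa> B"
  shows "((\<lambda>B. J c B Ms \<phi>) has_derivative (\<lambda>H. - real (length Ms) * J c B (H # Ms) \<phi>)) (at B)"
  unfolding has_derivative_at_alt
proof (intro conjI allI impI)
  let ?p = "length Ms"
  show "bounded_linear (\<lambda>H. - real ?p * J c B (H # Ms) \<phi>)"
    using linear_compose_scale_right[OF linear_J_head[OF assms, of Ms \<phi>], of "- real ?p"]
    by (simp add: linear_conv_bounded_linear)
  fix e :: real assume e: "0 < e"
  define K where "K = (\<Prod>M\<leftarrow>Ms. norm M / \<kappa>)"
  have K: "0 \<le> K" unfolding K_def using abs_kernel_le[OF assms, of Ms] abs_ge_zero order_trans by blast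
  obtain T where T: "0 \<le> T" "\<And>g k. g \<in> borel_measurable borel \<Longrightarrow> (\<And>x. \<bar>g x\<bar> \<le> k) \<Longrightarrow> \<bar>sint \<phi> g\<bar> \<le> T * k"
    using sint_total_variation_bound[of \<phi>] by blast
  \<comment> \<open>the error bound \<open>K * (e' * (norm H / \<kappa>))\<close>, multiplied by the total variation, becomes at most \<open>e * norm H\<close>\<close>
  define e' where "e' = e * \<kappa> / (T * K + 1)"
  have TK: "0 \<le> T * K" using T(1) K by simp
  have e': "0 < e'" unfolding e'_def using e l TK by (intro divide_pos_pos) auto
  obtain d where d: "0 < d" "\<And>s::real. \<bar>s\<bar> < d \<Longrightarrow> \<bar>1 / (1 + s) ^ ?p - 1 + real ?p * s\<bar> \<le> e' * \<bar>s\<bar>"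
    using inverse_power_expansion[OF e', of ?p] by blast
  show "\<exists>d>0. \<forall>A. norm (A - B) < d \<longrightarrow>
      norm (J c A Ms \<phi> - J c B Ms \<phi> - - real ?p * J c B ((A - B) # Ms) \<phi>) \<le> e * norm (A - B)"
  proof (intro exI[of _ "min (\<kappa> / 2) (d * \<kappa>)"] conjI allI impI)
    show "0 < min (\<kappa> / 2) (d * \<kappa>)" using l d(1) by simp
    fix A assume A: "norm (A - B) < min (\<kappa> / 2) (d * \<kappa>)"
    define H where "H = A - B"
    have cA: "coercive (\<kappa> / 2) A" using coercive_near[OF B, of A "\<kappa> / 2"] A by simp
    have l2: "0 < \<kappa> / 2" using l by simp
    define err where "err y = (kernel c A Ms y + (-1) * kernel c B Ms y) + real ?p * kernel c B (H # Ms) y" for y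
    have err: "\<bar>err y\<bar> \<le> K * (e' * (norm H / \<kappa>))" for y
    proof -
      define u where "u = c + qf B y"
      define s where "s = qf H y / u"
      have u: "0 < u" unfolding u_def by (rule denominator_pos(2)[OF assms])
      have s: "\<bar>s\<bar> \<le> norm H / \<kappa>" unfolding s_def u_def by (rule abs_ratio_le[OF assms])
      also have "norm H / \<kappa> < d" using A l by (simp add: H_def field_simps)
      finally have sd: "\<bar>s\<bar> < d" .
      have "c + qf A y = u * (1 + s)"
        using u by (simp add: s_def u_def H_def qf_diff field_simps)
      then have "(c + qf A y) ^ ?p = u ^ ?p * (1 + s) ^ ?p" by (simp add: power_mult_distrib)
      then have "err y = kernel c B Ms y * (1 / (1 + s) ^ ?p - 1 + real ?p * s)"
        unfolding err_def kernel_Cons u_def[symmetric] s_def[symmetric]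
        by (simp add: kernel_def u_def[symmetric] algebra_simps)
      then have "\<bar>err y\<bar> = \<bar>kernel c B Ms y\<bar> * \<bar>1 / (1 + s) ^ ?p - 1 + real ?p * s\<bar>" by (simp add: abs_mult)
      also have "\<dots> \<le> K * (e' * (norm H / \<kappa>))"
        unfolding K_def
        by (intro mult_mono abs_kernel_le[OF assms] order_trans[OF d(2)[OF sd]] mult_left_mono s)
          (use e' K K_def in auto)
      finally show ?thesis .
    qed
    have m: "err \<in> borel_measurable borel"
      unfolding err_def using measurable_kernel by measurable
    have "sint \<phi> err = J c A Ms \<phi> - J c B Ms \<phi> + real ?p * J c B (H # Ms) \<phi>"
    proof -
      have 1: "\<bar>(-1) * kernel c B Ms y\<bar> \<le> (\<Prod>M\<leftarrow>Ms. norm M / \<kappa>)" for y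
        using abs_kernel_le[OF assms, of Ms y] by simp
      have 2: "\<bar>real ?p * kernel c B (H # Ms) y\<bar> \<le> real ?p * (\<Prod>M\<leftarrow>H # Ms. norm M / \<kappa>)" for y
        using mult_left_mono[OF abs_kernel_le[OF assms, of "H # Ms" y], of "real ?p"] by (simp add: abs_mult)
      have 3: "\<bar>kernel c A Ms y + (-1) * kernel c B Ms y\<bar> \<le> (\<Prod>M\<leftarrow>Ms. norm M / (\<kappa> / 2)) + (\<Prod>M\<leftarrow>Ms. norm M / \<kappa>)" for y
        by (rule order_trans[OF abs_triangle_ineq add_mono[OF abs_kernel_le[OF c l2 cA] 1]])
      have m1: "(\<lambda>y. (-1) * kernel c B Ms y) \<in> borel_measurable borel"
        "(\<lambda>y. real ?p * kernel c B (H # Ms) y) \<in> borel_measurable borel"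
        "(\<lambda>y. kernel c A Ms y + (-1) * kernel c B Ms y) \<in> borel_measurable borel"
        using measurable_kernel[of c B Ms] measurable_kernel[of c B "H # Ms"] measurable_kernel[of c A Ms] by measurable
      show ?thesis
        unfolding err_def J_def sint_add[OF m1(3) 3 m1(2) 2]
          sint_add[OF measurable_kernel abs_kernel_le[OF c l2 cA] m1(1) 1] sint_mult by simp
    qed
    moreover have "\<bar>sint \<phi> err\<bar> \<le> T * (K * (e' * (norm H / \<kappa>)))" by (rule T(2)[OF m err])
    moreover have "T * (K * (e' * (norm H / \<kappa>))) \<le> e * norm H"
    proof -
      have "T * (K * (e' * (norm H / \<kappa>))) = (T * K / (T * K + 1)) * (e * norm H)"
        using l by (simp add: e'_def)
      also have "\<dots> \<le> 1 * (e * norm H)"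
        using TK e by (intro mult_right_mono) (auto simp: divide_simps)
      finally show ?thesis by simp
    qed
    ultimately show "norm (J c A Ms \<phi> - J c B Ms \<phi> - - real ?p * J c B ((A - B) # Ms) \<phi>) \<le> e * norm (A - B)"
      by (simp add: H_def)
  qed
qed

section \<open>The estimating equation\<close>

text \<open>
  For a law this is \<^term>\<open>a\<close> times the second moment of the augmented observations, weighted
  by \<open>1 / (c + z'Bz)\<close>. Critical points of the likelihood are the \<^term>\<open>B\<close> whose inverse it is.
\<close>

definition weighted_moment :: "real \<Rightarrow> real \<Rightarrow> real ^ ('d::finite) option ^ 'd option \<Rightarrow> (real ^ 'd) signed_measure \<Rightarrow> real ^ ('d::finite) option ^ 'd option" where
  "weighted_moment c a B \<phi> = (\<chi> i j. a * J c B [matrix_unit i j] \<phi>)"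

definition weighted_moment_deriv :: "real \<Rightarrow> real \<Rightarrow> real ^ ('d::finite) option ^ 'd option \<Rightarrow> (real ^ 'd) signed_measure \<Rightarrow>
    real ^ ('d::finite) option ^ 'd option \<Rightarrow> real ^ ('d::finite) option ^ 'd option" where
  "weighted_moment_deriv c a B \<phi> H = (\<chi> i j. - (a * J c B [H, matrix_unit i j] \<phi>))"

text \<open>
  Written as a product rather than with an inverse matrix, so that only kernels and entries of
  \<^term>\<open>B\<close> occur. A zero is automatically symmetric, being the inverse of a symmetric matrix.
\<close>

definition score :: "real \<Rightarrow> real \<Rightarrow> real ^ ('d::finite) option ^ 'd option \<Rightarrow> (real ^ 'd) signed_measure \<Rightarrow> real ^ ('d::finite) option ^ 'd option" where
  "score c a B \<phi> = B ** weighted_moment c a B \<phi> - mat 1"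

definition score_deriv :: "real \<Rightarrow> real \<Rightarrow> real ^ ('d::finite) option ^ 'd option \<Rightarrow> (real ^ 'd) signed_measure \<Rightarrow>
    real ^ ('d::finite) option ^ 'd option \<Rightarrow> real ^ ('d::finite) option ^ 'd option" where
  "score_deriv c a B \<phi> H = H ** weighted_moment c a B \<phi> + B ** weighted_moment_deriv c a B \<phi> H"

lemma has_derivative_matrix:
  fixes f :: "'a::euclidean_space \<Rightarrow> real ^ 'n ^ 'm"
  assumes "\<And>i j. ((\<lambda>x. f x $ i $ j) has_derivative (\<lambda>h. f' h $ i $ j)) (at x)"
  shows "(f has_derivative f') (at x)"
  unfolding has_derivative_componentwise_within[of f f' x UNIV]
proof
  fix b :: "real ^ 'n ^ 'm" assume "b \<in> Basis"
  then obtain i j where "b = axis i (axis j 1)" by (auto simp: Basis_vec_def)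
  then show "((\<lambda>x. f x \<bullet> b) has_derivative (\<lambda>h. f' h \<bullet> b)) (at x)"
    using assms by (simp add: inner_axis)
qed

lemma bounded_bilinear_matrix_mult:
  "bounded_bilinear ((**) :: real ^ 'n ^ 'm \<Rightarrow> real ^ 'p ^ 'n \<Rightarrow> real ^ 'p ^ 'm)"
proof -
  have "bilinear ((**) :: real ^ 'n ^ 'm \<Rightarrow> real ^ 'p ^ 'n \<Rightarrow> real ^ 'p ^ 'm)"
    by (auto simp: bilinear_def linear_iff vec_eq_iff matrix_matrix_mult_def sum_distrib_left sum.distrib algebra_simps)
  then show ?thesis by (simp add: bilinear_conv_bounded_bilinear)
qed

lemma has_derivative_weighted_moment:
  assumes "0 < c" "0 < \<kappa>" "coercive \<kappa> B"
  shows "((\<lambda>B. weighted_moment c a B \<phi>) has_derivative weighted_moment_deriv c a B \<phi>) (at B)"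
proof (rule has_derivative_matrix)
  fix i j
  have "((\<lambda>B. a * J c B [matrix_unit i j] \<phi>) has_derivative (\<lambda>H. a * (- real (length [matrix_unit i j]) * J c B [H, matrix_unit i j] \<phi>))) (at B)"
    by (rule has_derivative_mult_right[OF has_derivative_J[OF assms]])
  then show "((\<lambda>B. weighted_moment c a B \<phi> $ i $ j) has_derivative (\<lambda>H. weighted_moment_deriv c a B \<phi> H $ i $ j)) (at B)"
    by (simp add: weighted_moment_def weighted_moment_deriv_def)
qed

lemma has_derivative_score:
  assumes "0 < c" "0 < \<kappa>" "coercive \<kappa> B"
  shows "((\<lambda>B. score c a B \<phi>) has_derivative score_deriv c a B \<phi>) (at B)"
proof -
  have "((\<lambda>B. B ** weighted_moment c a B \<phi>) has_derivative (\<lambda>H. B ** weighted_moment_deriv c a B \<phi> H + H ** weighted_moment c a B \<phi>)) (at B)"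
    by (rule bounded_bilinear.FDERIV[OF bounded_bilinear_matrix_mult has_derivative_ident has_derivative_weighted_moment[OF assms]])
  then have "((\<lambda>B. score c a B \<phi>) has_derivative (\<lambda>H. B ** weighted_moment_deriv c a B \<phi> H + H ** weighted_moment c a B \<phi> - 0)) (at B)"
    unfolding score_def by (intro has_derivative_diff has_derivative_const)
  then show ?thesis by (simp add: score_deriv_def[abs_def] add.commute)
qed

lemma linear_score_deriv:
  assumes "0 < c" "0 < \<kappa>" "coercive \<kappa> B"
  shows "linear (score_deriv c a B \<phi>)"
  using has_derivative_score[OF assms] has_derivative_linear by blast

lemma weighted_moment_scale: "0 < c \<Longrightarrow> 0 < \<kappa> \<Longrightarrow> coercive \<kappa> B \<Longrightarrow> weighted_moment c a B (t *\<^sub>R \<phi>) = t *\<^sub>R weighted_moment c a B \<phi>"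
  and weighted_moment_diff: "0 < c \<Longrightarrow> 0 < \<kappa> \<Longrightarrow> coercive \<kappa> B \<Longrightarrow> weighted_moment c a B (\<phi> - \<psi>) = weighted_moment c a B \<phi> - weighted_moment c a B \<psi>"
  by (simp_all add: weighted_moment_def vec_eq_iff linear_scale[OF linear_J] linear_diff[OF linear_J] algebra_simps)

lemma weighted_moment_deriv_diff: "0 < c \<Longrightarrow> 0 < \<kappa> \<Longrightarrow> coercive \<kappa> B \<Longrightarrow>
    weighted_moment_deriv c a B (\<phi> - \<psi>) H = weighted_moment_deriv c a B \<phi> H - weighted_moment_deriv c a B \<psi> H"
  by (simp add: weighted_moment_deriv_def vec_eq_iff linear_diff[OF linear_J] algebra_simps)

lemma norm_matrix_le_entries:
  fixes M :: "real ^ 'n ^ 'm"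
  assumes "\<And>i j. \<bar>M $ i $ j\<bar> \<le> e" shows "norm M \<le> real CARD('m) * real CARD('n) * e"
proof -
  have "norm (M $ i) \<le> real CARD('n) * e" for i
    by (rule order_trans[OF norm_le_l1_cart sum_bounded_above]) (rule assms)
  then have "(\<Sum>i\<in>UNIV. norm (M $ i)) \<le> (\<Sum>i\<in>(UNIV :: 'm set). real CARD('n) * e)"
    by (rule sum_mono)
  moreover have "norm M \<le> (\<Sum>i\<in>UNIV. norm (M $ i))"
    unfolding norm_vec_def[of M] by (rule L2_set_le_sum) simp
  ultimately show ?thesis by simp
qed

lemma weighted_moment_bound:
  fixes B :: "real ^ ('d::finite) option ^ 'd option"
  assumes "0 < c" "0 < \<kappa>" "coercive \<kappa> B" "2 \<le> r" "0 \<le> a"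
  shows "norm (weighted_moment c a B \<phi>) \<le> (real CARD('d option) * real CARD('d option) * (a * (3 / \<kappa>))) * poly_norm r \<phi>"
proof -
  have "\<bar>weighted_moment c a B \<phi> $ i $ j\<bar> \<le> a * (3 / \<kappa>) * poly_norm r \<phi>" for i j
    using mult_left_mono[OF J_bound[OF assms(1-3), of "[matrix_unit i j]" r \<phi>], of a] assms(4,5)
    by (simp add: weighted_moment_def abs_mult)
  from norm_matrix_le_entries[OF this] show ?thesis by (simp only: mult.assoc)
qed

lemma weighted_moment_deriv_bound:
  fixes B :: "real ^ ('d::finite) option ^ 'd option"
  assumes "0 < c" "0 < \<kappa>" "coercive \<kappa> B" "4 \<le> r" "0 \<le> a"
  shows "norm (weighted_moment_deriv c a B \<phi> H) \<le> (real CARD('d option) * real CARD('d option) * (a * (3 / \<kappa>\<^sup>2))) * poly_norm r \<phi> * norm H"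
proof -
  have "\<bar>weighted_moment_deriv c a B \<phi> H $ i $ j\<bar> \<le> a * (3 / \<kappa>\<^sup>2) * poly_norm r \<phi> * norm H" for i j
    using mult_left_mono[OF J_bound[OF assms(1-3), of "[H, matrix_unit i j]" r \<phi>], of a] assms(4,5)
    by (simp add: weighted_moment_deriv_def abs_mult power2_eq_square mult_ac)
  from norm_matrix_le_entries[OF this] show ?thesis by (simp only: mult.assoc)
qed

lemma score_diff_measure:
  assumes "0 < c" "0 < \<kappa>" "coercive \<kappa> B"
  shows "score c a B \<phi> - score c a B \<psi> = B ** weighted_moment c a B (\<phi> - \<psi>)"
    and "score_deriv c a B \<phi> H - score_deriv c a B \<psi> H = H ** weighted_moment c a B (\<phi> - \<psi>) + B ** weighted_moment_deriv c a B (\<phi> - \<psi>) H"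
  by (simp_all add: score_def score_deriv_def weighted_moment_diff[OF assms] weighted_moment_deriv_diff[OF assms]
      bounded_bilinear.diff_right[OF bounded_bilinear_matrix_mult])

text \<open>
  The equation is affine in the measure, so these bounds say that it and its derivative in
  \<^term>\<open>B\<close> move little when the measure moves little in the seminorm. The derivative involves
  kernels with two factors, hence the degree four.
\<close>

lemma score_perturbation_bounds:
  assumes "0 < c" "0 < \<kappa>" "4 \<le> r" "0 \<le> a"
  shows "\<exists>C\<ge>0. \<forall>B :: real ^ ('d::finite) option ^ 'd option. coercive \<kappa> B \<longrightarrow> norm B \<le> R \<longrightarrow>
    (\<forall>\<phi> \<psi>. norm (score c a B \<phi> - score c a B \<psi>) \<le> C * poly_norm r (\<phi> - \<psi>)) \<and>
    (\<forall>\<phi> \<psi> H. norm (score_deriv c a B \<phi> H - score_deriv c a B \<psi> H) \<le> C * poly_norm r (\<phi> - \<psi>) * norm H)"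
proof -
  obtain K where K: "K > 0" "\<And>(A :: real ^ 'd option ^ 'd option) (B :: real ^ 'd option ^ 'd option). norm (A ** B) \<le> norm A * norm B * K"
    using bounded_bilinear.pos_bounded[OF bounded_bilinear_matrix_mult] by metis
  define n where "n = real CARD('d option) * real CARD('d option)"
  define C1 where "C1 = n * (a * (3 / \<kappa>))"
  define C2 where "C2 = n * (a * (3 / \<kappa>\<^sup>2))"
  have C12: "0 \<le> C1" "0 \<le> C2" using assms by (auto simp: C1_def C2_def n_def)
  define C where "C = K * (\<bar>R\<bar> * C1 + C1 + \<bar>R\<bar> * C2)"
  have N: "0 \<le> poly_norm r \<phi>" for \<phi> :: "(real ^ 'd) signed_measure"
    using is_seminorm_poly_norm unfolding is_seminorm_def by blast
  have C: "0 \<le> C" unfolding C_def using K C12 by simp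
  have 1: "norm (score c a B \<phi> - score c a B \<psi>) \<le> C * poly_norm r (\<phi> - \<psi>)"
    if B: "coercive \<kappa> B" "norm B \<le> R" for B :: "real ^ 'd option ^ 'd option" and \<phi> \<psi>
  proof -
    have "norm (B ** weighted_moment c a B (\<phi> - \<psi>)) \<le> norm B * norm (weighted_moment c a B (\<phi> - \<psi>)) * K" by (rule K(2))
    also have "\<dots> \<le> \<bar>R\<bar> * (C1 * poly_norm r (\<phi> - \<psi>)) * K"
      using weighted_moment_bound[OF assms(1,2) B(1), of r a "\<phi> - \<psi>"] assms(3,4) B(2) K(1)
      by (intro mult_right_mono mult_mono) (auto simp: C1_def n_def)
    also have "\<dots> = (K * (\<bar>R\<bar> * C1)) * poly_norm r (\<phi> - \<psi>)" by simp
    also have "\<dots> \<le> C * poly_norm r (\<phi> - \<psi>)"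
      unfolding C_def using K(1) C12 N by (intro mult_right_mono mult_left_mono) auto
    finally show ?thesis by (simp add: score_diff_measure[OF assms(1,2) B(1)])
  qed
  have 2: "norm (score_deriv c a B \<phi> H - score_deriv c a B \<psi> H) \<le> C * poly_norm r (\<phi> - \<psi>) * norm H"
    if B: "coercive \<kappa> B" "norm B \<le> R" for B :: "real ^ 'd option ^ 'd option" and \<phi> \<psi> H
  proof -
    let ?N = "poly_norm r (\<phi> - \<psi>)"
    have "norm (H ** weighted_moment c a B (\<phi> - \<psi>) + B ** weighted_moment_deriv c a B (\<phi> - \<psi>) H)
        \<le> norm H * norm (weighted_moment c a B (\<phi> - \<psi>)) * K + norm B * norm (weighted_moment_deriv c a B (\<phi> - \<psi>) H) * K"
      by (rule order_trans[OF norm_triangle_ineq add_mono[OF K(2) K(2)]])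
    also have "\<dots> \<le> norm H * (C1 * ?N) * K + \<bar>R\<bar> * (C2 * ?N * norm H) * K"
      using weighted_moment_bound[OF assms(1,2) B(1), of r a "\<phi> - \<psi>"] weighted_moment_deriv_bound[OF assms(1,2) B(1), of r a "\<phi> - \<psi>" H]
        assms(3,4) B(2) K(1)
      by (intro add_mono mult_right_mono mult_mono) (auto simp: C1_def C2_def n_def)
    also have "\<dots> = (K * (C1 + \<bar>R\<bar> * C2)) * ?N * norm H" by (simp add: algebra_simps)
    also have "\<dots> \<le> C * ?N * norm H"
      unfolding C_def using K(1) C12 N by (intro mult_right_mono mult_left_mono) auto
    finally show ?thesis by (simp add: score_diff_measure[OF assms(1,2) B(1)])
  qed
  show ?thesis using C 1 2 by blast
qed

section \<open>Smoothness of an implicitly defined branch\<close>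

lemma abs_entry_le_norm: "\<bar>A $ i $ j\<bar> \<le> norm A" for A :: "real ^ 'n ^ 'm"
  by (rule order_trans[OF component_le_norm_cart Finite_Cartesian_Product.norm_nth_le])

text \<open>
  A Lipschitz branch of solutions of the estimating equation on a ball of signed measures, along which
  the derivative of the equation is uniformly bounded below.
\<close>

locale implicit_branch =
  seminormed_ball "poly_norm (2 * k + 4) :: (real ^ 'd) signed_measure \<Rightarrow> real" \<phi>0 \<delta>
  for k :: nat and \<phi>0 :: "(real ^ 'd) signed_measure" and \<delta> :: real +
  fixes c a \<kappa> R M :: real and b :: "(real ^ 'd) signed_measure \<Rightarrow> real ^ 'd option ^ 'd option"
  assumes c: "0 < c" and \<kappa>: "0 < \<kappa>" and a: "0 \<le> a"
    and coerc: "\<phi> \<in> U \<Longrightarrow> coercive \<kappa> (b \<phi>)"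
    and b_bound: "\<phi> \<in> U \<Longrightarrow> norm (b \<phi>) \<le> R"
    and solves: "\<phi> \<in> U \<Longrightarrow> score c a (b \<phi>) \<phi> = 0"
    and lipschitz: "\<exists>C. \<forall>\<phi>\<in>U. \<forall>\<psi>\<in>U. norm (b \<phi> - b \<psi>) \<le> C * poly_norm (2 * k + 4) (\<phi> - \<psi>)"
    and lower: "\<phi> \<in> U \<Longrightarrow> norm H \<le> M * norm (score_deriv c a (b \<phi>) \<phi> H)"
begin

abbreviation N :: "(real ^ 'd) signed_measure \<Rightarrow> real" where "N \<equiv> poly_norm (2 * k + 4)"

definition L :: "(real ^ 'd) signed_measure \<Rightarrow> real ^ 'd option ^ 'd option \<Rightarrow> real ^ 'd option ^ 'd option" where
  "L \<phi> = score_deriv c a (b \<phi>) \<phi>"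

definition W :: "(real ^ 'd) signed_measure \<Rightarrow> real ^ 'd option ^ 'd option \<Rightarrow> real ^ 'd option ^ 'd option" where
  "W \<phi> = inv (L \<phi>)"

lemma linear_L: "\<phi> \<in> U \<Longrightarrow> linear (L \<phi>)"
  unfolding L_def by (rule linear_score_deriv[OF c \<kappa> coerc])

lemma bij_L: assumes "\<phi> \<in> U" shows "bij (L \<phi>)"
proof -
  have "inj (L \<phi>)"
    unfolding linear_injective_0[OF linear_L[OF assms]]
  proof (intro allI impI)
    fix H assume "L \<phi> H = 0"
    then show "H = 0" using lower[OF assms, of H] by (simp add: L_def)
  qed
  then show ?thesis
    using linear_injective_imp_surjective[OF linear_L[OF assms]] by (simp add: bij_def)
qed

lemma W_L: "\<phi> \<in> U \<Longrightarrow> W \<phi> (L \<phi> H) = H" and L_W: "\<phi> \<in> U \<Longrightarrow> L \<phi> (W \<phi> Y) = Y"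
  using bij_L[of \<phi>] by (simp_all add: W_def bij_is_inj bij_is_surj surj_f_inv_f)

lemma linear_W: assumes "\<phi> \<in> U" shows "linear (W \<phi>)"
proof (rule linearI)
  show "W \<phi> (x + y) = W \<phi> x + W \<phi> y" for x y
    using W_L[OF assms, of "W \<phi> x + W \<phi> y"] by (simp add: linear_add[OF linear_L[OF assms]] L_W[OF assms])
  show "W \<phi> (r *\<^sub>R x) = r *\<^sub>R W \<phi> x" for r x
    using W_L[OF assms, of "r *\<^sub>R W \<phi> x"] by (simp add: linear_scale[OF linear_L[OF assms]] L_W[OF assms])
qed

lemma norm_W: "\<phi> \<in> U \<Longrightarrow> norm (W \<phi> Y) \<le> M * norm Y"
  using lower[of \<phi> "W \<phi> Y"] L_W[of \<phi> Y] by (simp add: L_def)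

definition b' :: "(real ^ 'd) signed_measure \<Rightarrow> (real ^ 'd) signed_measure \<Rightarrow> real ^ 'd option ^ 'd option" where
  "b' \<phi> h = - W \<phi> (b \<phi> ** weighted_moment c a (b \<phi>) h)"

lemma tendsto_b:
  assumes \<phi>: "\<phi> \<in> U" shows "((\<lambda>t. b (\<phi> + t *\<^sub>R h)) \<longlongrightarrow> b \<phi>) (at 0)"
    and "\<exists>C\<ge>0. \<forall>\<^sub>F t in at 0. norm (b (\<phi> + t *\<^sub>R h) - b \<phi>) \<le> C * \<bar>t\<bar>"
proof -
  obtain C where C: "\<And>\<phi> \<psi>. \<phi> \<in> U \<Longrightarrow> \<psi> \<in> U \<Longrightarrow> norm (b \<phi> - b \<psi>) \<le> C * N (\<phi> - \<psi>)"
    using lipschitz by blast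
  have ev: "\<forall>\<^sub>F t in at 0. norm (b (\<phi> + t *\<^sub>R h) - b \<phi>) \<le> (\<bar>C\<bar> * N h) * \<bar>t\<bar>"
    using eventually_line_in_U[OF \<phi>, of h]
  proof (rule eventually_mono)
    fix t assume "\<phi> + t *\<^sub>R h \<in> U"
    then have "norm (b (\<phi> + t *\<^sub>R h) - b \<phi>) \<le> C * N (t *\<^sub>R h)" using C[OF _ \<phi>, of "\<phi> + t *\<^sub>R h"] by simp
    also have "\<dots> \<le> \<bar>C\<bar> * N (t *\<^sub>R h)" by (intro mult_right_mono) (auto simp del: N_scale)
    finally show "norm (b (\<phi> + t *\<^sub>R h) - b \<phi>) \<le> (\<bar>C\<bar> * N h) * \<bar>t\<bar>" unfolding N_scale by (simp only: mult_ac)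
  qed
  then show "\<exists>C\<ge>0. \<forall>\<^sub>F t in at 0. norm (b (\<phi> + t *\<^sub>R h) - b \<phi>) \<le> C * \<bar>t\<bar>"
    by (intro exI[of _ "\<bar>C\<bar> * N h"]) simp
  have "((\<lambda>t. (\<bar>C\<bar> * N h) * \<bar>t\<bar>) \<longlongrightarrow> 0) (at 0)" by (auto intro!: tendsto_eq_intros)
  then have "((\<lambda>t. b (\<phi> + t *\<^sub>R h) - b \<phi>) \<longlongrightarrow> 0) (at 0)"
    by (rule Lim_null_comparison[OF ev])
  then show "((\<lambda>t. b (\<phi> + t *\<^sub>R h)) \<longlongrightarrow> b \<phi>) (at 0)" by (simp add: LIM_zero_iff)
qed

text \<open>
  The usual implicit differentiation along a line. The Lipschitz bound makes the error of the
  linearisation in \<^term>\<open>B\<close> negligible compared with the step on the line.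
\<close>

lemma has_derivative_b:
  assumes \<phi>: "\<phi> \<in> U"
  shows "((\<lambda>t. b (\<phi> + t *\<^sub>R h)) has_vector_derivative b' \<phi> h) (at 0)"
proof -
  define e where "e t = b (\<phi> + t *\<^sub>R h) - b \<phi>" for t
  define Q where "Q B = B ** weighted_moment c a B h" for B
  \<comment> \<open>the error of the linearisation in \<open>B\<close> at the fixed measure\<close>
  define \<rho> where "\<rho> t = score c a (b (\<phi> + t *\<^sub>R h)) \<phi> - score c a (b \<phi>) \<phi> - L \<phi> (e t)" for t
  obtain C where C: "C \<ge> 0" "\<forall>\<^sub>F t in at 0. norm (e t) \<le> C * \<bar>t\<bar>"
    using tendsto_b(2)[OF \<phi>, of h] unfolding e_def by blast
  have \<rho>: "((\<lambda>t. (1 / t) *\<^sub>R \<rho> t) \<longlongrightarrow> 0) (at 0)"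
  proof (rule tendstoI)
    fix \<epsilon> :: real assume "0 < \<epsilon>"
    then have e2: "0 < \<epsilon> / (C + 1) / 2" using C(1) by simp
    obtain d where d: "d > 0" "\<And>B. norm (B - b \<phi>) < d \<Longrightarrow>
        norm (score c a B \<phi> - score c a (b \<phi>) \<phi> - L \<phi> (B - b \<phi>)) \<le> \<epsilon> / (C + 1) / 2 * norm (B - b \<phi>)"
      using has_derivative_score[OF c \<kappa> coerc[OF \<phi>], of a \<phi>] e2 unfolding has_derivative_at_alt L_def by blast
    have "\<forall>\<^sub>F t in at 0. norm (e t) < d"
      using tendstoD[OF tendsto_b(1)[OF \<phi>, of h] d(1)] by (simp add: e_def dist_norm)
    then show "\<forall>\<^sub>F t in at 0. dist ((1 / t) *\<^sub>R \<rho> t) 0 < \<epsilon>"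
      using C(2)
    proof eventually_elim
      case (elim t)
      have "norm (\<rho> t) \<le> \<epsilon> / (C + 1) / 2 * norm (e t)"
        unfolding \<rho>_def e_def using elim(1) by (intro d(2)) (simp add: e_def)
      also have "\<dots> \<le> \<epsilon> / (C + 1) / 2 * (C * \<bar>t\<bar>)" using elim(2) e2 by (intro mult_left_mono) auto
      also have "\<dots> \<le> (\<epsilon> / 2) * \<bar>t\<bar>"
      proof -
        have "\<epsilon> / (C + 1) / 2 * C \<le> \<epsilon> / 2" using C(1) \<open>0 < \<epsilon>\<close> by (simp add: field_simps)
        from mult_right_mono[OF this, of "\<bar>t\<bar>"] show ?thesis by (simp add: mult.assoc)
      qed
      finally have "norm (\<rho> t) \<le> (\<epsilon> / 2) * \<bar>t\<bar>" .
      then have "norm ((1 / t) *\<^sub>R \<rho> t) \<le> \<epsilon> / 2"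
        using \<open>0 < \<epsilon>\<close> by (cases "t = 0") (simp_all add: divide_simps)
      then show ?case unfolding dist_norm diff_0_right using \<open>0 < \<epsilon>\<close> by linarith
    qed
  qed
  have Q: "((\<lambda>t. Q (b (\<phi> + t *\<^sub>R h))) \<longlongrightarrow> Q (b \<phi>)) (at 0)"
  proof -
    have "isCont (\<lambda>B. weighted_moment c a B h) (b \<phi>)"
      using has_derivative_continuous[OF has_derivative_weighted_moment[OF c \<kappa> coerc[OF \<phi>]]] .
    then have "((\<lambda>t. weighted_moment c a (b (\<phi> + t *\<^sub>R h)) h) \<longlongrightarrow> weighted_moment c a (b \<phi>) h) (at 0)"
      using tendsto_b(1)[OF \<phi>] isCont_tendsto_compose by blast
    then show ?thesis unfolding Q_def
      by (intro bounded_bilinear.tendsto[OF bounded_bilinear_matrix_mult] tendsto_b(1)[OF \<phi>])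
  qed
  have blW: "bounded_linear (W \<phi>)" using linear_W[OF \<phi>] by (simp add: linear_conv_bounded_linear)
  have "((\<lambda>t. - W \<phi> (Q (b (\<phi> + t *\<^sub>R h))) - W \<phi> ((1 / t) *\<^sub>R \<rho> t)) \<longlongrightarrow> - W \<phi> (Q (b \<phi>)) - W \<phi> 0) (at 0)"
    by (intro tendsto_intros bounded_linear.tendsto[OF blW] Q \<rho>)
  moreover have "\<forall>\<^sub>F t in at 0. - W \<phi> (Q (b (\<phi> + t *\<^sub>R h))) - W \<phi> ((1 / t) *\<^sub>R \<rho> t) = (1 / t) *\<^sub>R e t"
    using eventually_line_in_U[OF \<phi>, of h] eventually_neq_at_within[of "0::real" 0 UNIV]
  proof (eventually_elim)
    case (elim t)
    let ?\<psi> = "\<phi> + t *\<^sub>R h"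
    have "score c a (b ?\<psi>) ?\<psi> - score c a (b ?\<psi>) \<phi> = t *\<^sub>R Q (b ?\<psi>)"
      using score_diff_measure(1)[OF c \<kappa> coerc[OF elim(1)], of a ?\<psi> \<phi>]
      by (simp add: Q_def weighted_moment_scale[OF c \<kappa> coerc[OF elim(1)]] bounded_bilinear.scaleR_right[OF bounded_bilinear_matrix_mult])
    then have "score c a (b ?\<psi>) \<phi> = - (t *\<^sub>R Q (b ?\<psi>))"
      using solves[OF elim(1)] by (metis diff_0 minus_minus)
    then have "L \<phi> (e t) = - t *\<^sub>R Q (b ?\<psi>) - \<rho> t"
      using solves[OF elim(1)] solves[OF \<phi>] by (simp add: \<rho>_def algebra_simps)
    then have "e t = W \<phi> (- t *\<^sub>R Q (b ?\<psi>) - \<rho> t)" using W_L[OF \<phi>] by metis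
    then have "e t = - (t *\<^sub>R W \<phi> (Q (b ?\<psi>))) - W \<phi> (\<rho> t)"
      by (simp add: linear_diff[OF linear_W[OF \<phi>]] linear_scale[OF linear_W[OF \<phi>]] linear_neg[OF linear_W[OF \<phi>]])
    then show ?case
      using elim(2) by (simp add: linear_scale[OF linear_W[OF \<phi>]] scaleR_diff_right)
  qed
  ultimately have "((\<lambda>t. (1 / t) *\<^sub>R e t) \<longlongrightarrow> b' \<phi> h) (at 0)"
    using linear_0[OF linear_W[OF \<phi>]] by (auto simp: b'_def Q_def elim: Lim_transform_eventually)
  then have "((\<lambda>t. norm ((1 / t) *\<^sub>R e t - b' \<phi> h)) \<longlongrightarrow> 0) (at 0)"
    by (intro tendsto_norm_zero LIM_zero)
  moreover have "\<forall>\<^sub>F t in at 0. norm ((1 / t) *\<^sub>R e t - b' \<phi> h) = norm (e t - t *\<^sub>R b' \<phi> h) / norm t"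
    using eventually_neq_at_within[of "0::real" 0 UNIV]
  proof eventually_elim
    case (elim t)
    then have "(1 / t) *\<^sub>R e t - b' \<phi> h = (1 / t) *\<^sub>R (e t - t *\<^sub>R b' \<phi> h)" by (simp add: scaleR_diff_right)
    then show ?case by simp
  qed
  ultimately have "((\<lambda>t. norm (e t - t *\<^sub>R b' \<phi> h) / norm t) \<longlongrightarrow> 0) (at 0)"
    by (rule Lim_transform_eventually)
  then show ?thesis
    unfolding has_vector_derivative_def has_derivative_at by (simp add: bounded_linear_scaleR_left e_def)
qed

lemma mlin_cong:
  assumes "mlin S f" and eq: "\<And>x v. x \<in> U \<Longrightarrow> g x v = f x v" shows "mlin S g"
  using assms(1) unfolding mlin_def by (simp only: eq cong: ball_cong) blast

lemma smooth_cong: "smooth m S f \<Longrightarrow> (\<And>x v. x \<in> U \<Longrightarrow> g x v = f x v) \<Longrightarrow> smooth m S g"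
proof (induction m arbitrary: S f g)
  case 0
  then show ?case using mlin_cong[of S f g] by simp
next
  case (Suc m)
  have 1: "mlin S g" by (rule mlin_cong[OF smooth_imp_mlin[OF Suc.prems(1)] Suc.prems(2)])
  have "line_deriv i g f'" if d: "line_deriv i f f'" for i f'
    unfolding line_deriv_def
  proof (intro ballI allI)
    fix x v assume x: "x \<in> U"
    have "\<forall>\<^sub>F t in nhds 0. g (x + t *\<^sub>R v i) v = f (x + t *\<^sub>R v i) v"
      unfolding eventually_nhds_conv_at
      using eventually_mono[OF eventually_line_in_U[OF x, of "v i"]] Suc.prems(2) x by simp
    from DERIV_cong_ev[OF refl this refl] d x show "((\<lambda>t. g (x + t *\<^sub>R v i) v) has_real_derivative f' x v) (at 0)"
      by (simp add: line_deriv_def)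
  qed
  then show ?case using 1 Suc.prems(1) unfolding smooth.simps by blast
qed

lemma deriv_J_line:
  assumes \<phi>: "\<phi> \<in> U"
  shows "((\<lambda>t. J c (b (\<phi> + t *\<^sub>R h)) Ms \<psi>) has_real_derivative
    - real (length Ms) * J c (b \<phi>) (b' \<phi> h # Ms) \<psi>) (at 0)"
proof -
  have "((\<lambda>t. b (\<phi> + t *\<^sub>R h)) has_derivative (\<lambda>t. t *\<^sub>R b' \<phi> h)) (at 0)"
    using has_derivative_b[OF \<phi>] by (simp add: has_vector_derivative_def)
  moreover have "((\<lambda>B. J c B Ms \<psi>) has_derivative (\<lambda>H. - real (length Ms) * J c (b \<phi>) (H # Ms) \<psi>)) (at (b (\<phi> + 0 *\<^sub>R h)))"
    using has_derivative_J[OF c \<kappa> coerc[OF \<phi>]] by simp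
  ultimately have "((\<lambda>t. J c (b (\<phi> + t *\<^sub>R h)) Ms \<psi>) has_derivative
      (\<lambda>t. - real (length Ms) * J c (b \<phi>) ((t *\<^sub>R b' \<phi> h) # Ms) \<psi>)) (at 0)"
    by (rule has_derivative_compose)
  then show ?thesis
    unfolding has_field_derivative_def
    by (rule has_derivative_eq_rhs) (auto simp: linear_scale[OF linear_J_head[OF c \<kappa> coerc[OF \<phi>]]] fun_eq_iff)
qed

lemma J_expand_head: "\<phi> \<in> U \<Longrightarrow> J c (b \<phi>) (H # Ms) \<psi> = (\<Sum>p\<in>UNIV. \<Sum>q\<in>UNIV. H $ p $ q * J c (b \<phi>) (matrix_unit p q # Ms) \<psi>)"
  using linear_matrix_expansion[OF linear_J_head[OF c \<kappa> coerc, of \<phi> Ms \<psi>], of H] by simp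

lemma b'_entries: assumes \<phi>: "\<phi> \<in> U"
  shows "b' \<phi> h $ i $ j = - (\<Sum>p\<in>UNIV. \<Sum>q\<in>UNIV. W \<phi> (matrix_unit p q) $ i $ j *
     (\<Sum>r\<in>UNIV. b \<phi> $ p $ r * (a * J c (b \<phi>) [matrix_unit r q] h)))"
proof -
  let ?Y = "b \<phi> ** weighted_moment c a (b \<phi>) h"
  have "W \<phi> ?Y $ i $ j = (\<Sum>p\<in>UNIV. \<Sum>q\<in>UNIV. ?Y $ p $ q * W \<phi> (matrix_unit p q) $ i $ j)"
    using arg_cong[OF linear_matrix_expansion[OF linear_W[OF \<phi>], of ?Y], of "\<lambda>M. M $ i $ j"] by simp
  moreover have "?Y $ p $ q = (\<Sum>r\<in>UNIV. b \<phi> $ p $ r * (a * J c (b \<phi>) [matrix_unit r q] h))" for p q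
    by (simp add: matrix_matrix_mult_def weighted_moment_def)
  ultimately show ?thesis by (simp add: b'_def mult.commute)
qed

lemma mlin_J_arg:
  assumes "length Ms \<le> k + 2" shows "mlin {i} (\<lambda>\<phi> v. J c (b \<phi>) Ms (v i))"
proof -
  have "\<bar>J c (b \<phi>) Ms \<psi>\<bar> \<le> 3 * (\<Prod>M\<leftarrow>Ms. norm M / \<kappa>) * N \<psi>" if "\<phi> \<in> U" for \<phi> \<psi>
    using assms by (intro J_bound[OF c \<kappa> coerc[OF that]]) simp
  moreover have "0 \<le> (\<Prod>M\<leftarrow>Ms. norm M / \<kappa>)"
    using \<kappa> by (intro prod_list_nonneg) auto
  ultimately have "\<exists>C\<ge>0. \<forall>\<phi>\<in>U. \<forall>v. \<bar>J c (b \<phi>) Ms (v i)\<bar> \<le> C * (\<Prod>l\<in>{i}. N (v l))"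
    by (intro exI[of _ "3 * (\<Prod>M\<leftarrow>Ms. norm M / \<kappa>)"]) auto
  then show ?thesis
    unfolding mlin_def using linear_J[OF c \<kappa> coerc] by simp
qed

lemma mlin_J_self:
  assumes "length Ms \<le> k + 2" shows "mlin {} (\<lambda>\<phi> v. J c (b \<phi>) Ms \<phi>)"
proof -
  have P: "0 \<le> (\<Prod>M\<leftarrow>Ms. norm M / \<kappa>)"
    using \<kappa> by (intro prod_list_nonneg) auto
  have "\<bar>J c (b \<phi>) Ms \<phi>\<bar> \<le> 3 * (\<Prod>M\<leftarrow>Ms. norm M / \<kappa>) * (N \<phi>0 + \<delta>)" if "\<phi> \<in> U" for \<phi>
  proof -
    have "\<bar>J c (b \<phi>) Ms \<phi>\<bar> \<le> 3 * (\<Prod>M\<leftarrow>Ms. norm M / \<kappa>) * N \<phi>"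
      using assms by (intro J_bound[OF c \<kappa> coerc[OF that]]) simp
    also have "\<dots> \<le> 3 * (\<Prod>M\<leftarrow>Ms. norm M / \<kappa>) * (N \<phi>0 + \<delta>)"
    proof (intro mult_left_mono)
      have "N (\<phi>0 + (\<phi> - \<phi>0)) \<le> N \<phi>0 + N (\<phi> - \<phi>0)" by (rule N_add)
      then show "N \<phi> \<le> N \<phi>0 + \<delta>" using that unfolding U_def by simp
    qed (use P in simp)
    finally show ?thesis .
  qed
  moreover have "0 \<le> 3 * (\<Prod>M\<leftarrow>Ms. norm M / \<kappa>) * (N \<phi>0 + \<delta>)"
    using P \<delta> by (intro mult_nonneg_nonneg add_nonneg_nonneg) auto
  ultimately have "\<exists>C\<ge>0. \<forall>\<phi>\<in>U. \<bar>J c (b \<phi>) Ms \<phi>\<bar> \<le> C" by blast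
  then show ?thesis unfolding mlin_def by simp
qed

lemma mlin_b: "mlin {} (\<lambda>\<phi> _. b \<phi> $ i $ j)"
proof -
  have "\<bar>b \<phi> $ i $ j\<bar> \<le> \<bar>R\<bar>" if "\<phi> \<in> U" for \<phi>
    using abs_entry_le_norm[of "b \<phi>" i j] b_bound[OF that] by linarith
  then show ?thesis unfolding mlin_def by (auto intro!: exI[of _ "\<bar>R\<bar>"])
qed

lemma mlin_W: "mlin {} (\<lambda>\<phi> _. W \<phi> (matrix_unit p q) $ i $ j)"
proof -
  have "\<bar>W \<phi> (matrix_unit p q) $ i $ j\<bar> \<le> \<bar>M\<bar>" if "\<phi> \<in> U" for \<phi>
  proof -
    have "norm (W \<phi> (matrix_unit p q)) \<le> M" using norm_W[OF that, of "matrix_unit p q"] by simp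
    then show ?thesis using abs_entry_le_norm[of "W \<phi> (matrix_unit p q)" i j] by linarith
  qed
  then show ?thesis unfolding mlin_def by (auto intro!: exI[of _ "\<bar>M\<bar>"])
qed

text \<open>
  Implicit differentiation expresses the derivative of the branch by the branch itself, the inverse and
  kernels with one factor, so their smoothness of one order less suffices.
\<close>

lemma smooth_b_Suc:
  assumes b: "\<And>i j. smooth m {} (\<lambda>\<phi> _. b \<phi> $ i $ j)"
    and W: "\<And>p q i j. smooth m {} (\<lambda>\<phi> _. W \<phi> (matrix_unit p q) $ i $ j)"
    and J: "\<And>p q i. smooth m {i} (\<lambda>\<phi> v. J c (b \<phi>) [matrix_unit p q] (v i))"
  shows "smooth (Suc m) {} (\<lambda>\<phi> _. b \<phi> $ i $ j)"
    and "smooth m {l} (\<lambda>\<phi> v. - (\<Sum>p\<in>UNIV. \<Sum>q\<in>UNIV. W \<phi> (matrix_unit p q) $ i $ j *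
     (\<Sum>r\<in>UNIV. b \<phi> $ p $ r * (a * J c (b \<phi>) [matrix_unit r q] (v l)))))"
proof -
  let ?d = "\<lambda>l \<phi> v. - (\<Sum>p\<in>UNIV. \<Sum>q\<in>UNIV. W \<phi> (matrix_unit p q) $ i $ j *
     (\<Sum>r\<in>UNIV. b \<phi> $ p $ r * (a * J c (b \<phi>) [matrix_unit r q] (v l))))"
  show sd: "smooth m {l} (?d l)" for l
    by (intro smooth_uminus smooth_sum smooth_mult_scalar smooth_cmult b W J) auto
  have "line_deriv l (\<lambda>\<phi> _. b \<phi> $ i $ j) (?d l)" for l
    unfolding line_deriv_def
  proof (intro ballI allI)
    fix \<phi> v assume \<phi>: "\<phi> \<in> U"
    have "((\<lambda>t. b (\<phi> + t *\<^sub>R v l) $ i $ j) has_vector_derivative b' \<phi> (v l) $ i $ j) (at 0)"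
      by (intro bounded_linear.has_vector_derivative[OF bounded_linear_vec_nth] has_derivative_b \<phi>)
    then show "((\<lambda>t. b (\<phi> + t *\<^sub>R v l) $ i $ j) has_real_derivative ?d l \<phi> v) (at 0)"
      by (simp only: b'_entries[OF \<phi>] has_real_derivative_iff_has_vector_derivative)
  qed
  then show "smooth (Suc m) {} (\<lambda>\<phi> _. b \<phi> $ i $ j)"
    using sd by (intro smooth_SucI[where f' = ?d] mlin_b)
qed

text \<open>
  Every derivative of a kernel integral costs one more factor in the kernel; the bound on the length is
  what keeps the integral within reach of the seminorm.
\<close>

lemma smooth_J_Suc:
  assumes len: "length Ms + Suc m \<le> k + 2"
    and b': "\<And>l p q. smooth m {l} (\<lambda>\<phi> v. b' \<phi> (v l) $ p $ q)"
    and J: "\<And>p q i. smooth m {i} (\<lambda>\<phi> v. J c (b \<phi>) (matrix_unit p q # Ms) (v i))"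
    and J0: "\<And>p q. smooth m {} (\<lambda>\<phi> v. J c (b \<phi>) (matrix_unit p q # Ms) \<phi>)"
    and J1: "\<And>l. smooth m {l} (\<lambda>\<phi> v. J c (b \<phi>) Ms (v l))"
  shows "smooth (Suc m) {i} (\<lambda>\<phi> v. J c (b \<phi>) Ms (v i))"
    and "smooth (Suc m) {} (\<lambda>\<phi> v. J c (b \<phi>) Ms \<phi>)"
proof -
  let ?d = "\<lambda>l \<phi> v. - real (length Ms) * (\<Sum>p\<in>UNIV. \<Sum>q\<in>UNIV. b' \<phi> (v l) $ p $ q * J c (b \<phi>) (matrix_unit p q # Ms) (v i))"
  let ?e = "\<lambda>l \<phi> v. - real (length Ms) * (\<Sum>p\<in>UNIV. \<Sum>q\<in>UNIV. J c (b \<phi>) (matrix_unit p q # Ms) \<phi> * b' \<phi> (v l) $ p $ q)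
      + J c (b \<phi>) Ms (v l)"
  have prod: "smooth m (insert l {i}) (\<lambda>\<phi> v. b' \<phi> (v l) $ p $ q * J c (b \<phi>) (matrix_unit p q # Ms) (v i))"
    if "l \<notin> {i}" for l p q
    using smooth_mult[OF b'[of l p q] J[of i p q]] that by (simp add: insert_commute)
  show "smooth (Suc m) {i} (\<lambda>\<phi> v. J c (b \<phi>) Ms (v i))"
  proof (rule smooth_SucI[where f' = ?d])
    show "mlin {i} (\<lambda>\<phi> v. J c (b \<phi>) Ms (v i))" using len by (intro mlin_J_arg) simp
    fix l assume l: "l \<notin> {i}"
    show "smooth m (insert l {i}) (?d l)"
      by (intro smooth_cmult smooth_sum prod l) auto
    show "line_deriv l (\<lambda>\<phi> v. J c (b \<phi>) Ms (v i)) (?d l)"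
      unfolding line_deriv_def
    proof (intro ballI allI)
      fix \<phi> and v :: "nat \<Rightarrow> (real ^ 'd) signed_measure" assume \<phi>: "\<phi> \<in> U"
      show "((\<lambda>t. J c (b (\<phi> + t *\<^sub>R v l)) Ms (v i)) has_real_derivative ?d l \<phi> v) (at 0)"
        unfolding J_expand_head[OF \<phi>, of "b' \<phi> (v l)", symmetric] by (rule deriv_J_line[OF \<phi>])
    qed
  qed
  show "smooth (Suc m) {} (\<lambda>\<phi> v. J c (b \<phi>) Ms \<phi>)"
  proof (rule smooth_SucI[where f' = ?e])
    show "mlin {} (\<lambda>\<phi> v. J c (b \<phi>) Ms \<phi>)" using len by (intro mlin_J_self) simp
    fix l
    show "smooth m {l} (?e l)"
      by (intro smooth_add smooth_cmult smooth_sum smooth_mult_scalar J0 b' J1) auto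
    show "line_deriv l (\<lambda>\<phi> v. J c (b \<phi>) Ms \<phi>) (?e l)"
      unfolding line_deriv_def
    proof (intro ballI allI)
      fix \<phi> and v :: "nat \<Rightarrow> (real ^ 'd) signed_measure" assume \<phi>: "\<phi> \<in> U"
      let ?h = "v l"
      have "((\<lambda>t. J c (b (\<phi> + t *\<^sub>R ?h)) Ms \<phi> + t * J c (b (\<phi> + t *\<^sub>R ?h)) Ms ?h) has_real_derivative
          - real (length Ms) * J c (b \<phi>) (b' \<phi> ?h # Ms) \<phi> +
          (1 * J c (b (\<phi> + 0 *\<^sub>R ?h)) Ms ?h + - real (length Ms) * J c (b \<phi>) (b' \<phi> ?h # Ms) ?h * 0)) (at 0)"
        by (intro DERIV_add DERIV_mult DERIV_ident deriv_J_line[OF \<phi>])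
      also have "- real (length Ms) * J c (b \<phi>) (b' \<phi> ?h # Ms) \<phi> +
          (1 * J c (b (\<phi> + 0 *\<^sub>R ?h)) Ms ?h + - real (length Ms) * J c (b \<phi>) (b' \<phi> ?h # Ms) ?h * 0) = ?e l \<phi> v"
        unfolding J_expand_head[OF \<phi>, of "b' \<phi> (v l)"] by (simp add: mult.commute)
      finally have d: "((\<lambda>t. J c (b (\<phi> + t *\<^sub>R ?h)) Ms \<phi> + t * J c (b (\<phi> + t *\<^sub>R ?h)) Ms ?h) has_real_derivative ?e l \<phi> v) (at 0)" .
      have "\<forall>\<^sub>F t in at 0. J c (b (\<phi> + t *\<^sub>R ?h)) Ms (\<phi> + t *\<^sub>R ?h) = J c (b (\<phi> + t *\<^sub>R ?h)) Ms \<phi> + t * J c (b (\<phi> + t *\<^sub>R ?h)) Ms ?h"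
        using eventually_line_in_U[OF \<phi>, of ?h]
      proof (rule eventually_mono)
        fix t assume "\<phi> + t *\<^sub>R ?h \<in> U"
        note lin = linear_J[OF c \<kappa> coerc[OF this], of Ms]
        show "J c (b (\<phi> + t *\<^sub>R ?h)) Ms (\<phi> + t *\<^sub>R ?h) = J c (b (\<phi> + t *\<^sub>R ?h)) Ms \<phi> + t * J c (b (\<phi> + t *\<^sub>R ?h)) Ms ?h"
          unfolding linear_add[OF lin] linear_scale[OF lin] by simp
      qed
      then have "\<forall>\<^sub>F t in nhds 0. J c (b (\<phi> + t *\<^sub>R ?h)) Ms (\<phi> + t *\<^sub>R ?h) = J c (b (\<phi> + t *\<^sub>R ?h)) Ms \<phi> + t * J c (b (\<phi> + t *\<^sub>R ?h)) Ms ?h"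
        unfolding eventually_nhds_conv_at by simp
      from DERIV_cong_ev[OF refl this refl] show "((\<lambda>t. J c (b (\<phi> + t *\<^sub>R ?h)) Ms (\<phi> + t *\<^sub>R ?h)) has_real_derivative ?e l \<phi> v) (at 0)"
        using d by simp
    qed
  qed
qed

lemma smooth_J_all_Suc:
  assumes b: "\<And>i j. smooth m {} (\<lambda>\<phi> _. b \<phi> $ i $ j)"
    and W: "\<And>p q i j. smooth m {} (\<lambda>\<phi> _. W \<phi> (matrix_unit p q) $ i $ j)"
    and J: "\<And>Ms i. length Ms + m \<le> k + 2 \<Longrightarrow> smooth m {i} (\<lambda>\<phi> v. J c (b \<phi>) Ms (v i))"
    and J0: "\<And>Ms. length Ms + m \<le> k + 2 \<Longrightarrow> smooth m {} (\<lambda>\<phi> v. J c (b \<phi>) Ms \<phi>)"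
    and len: "length Ms + Suc m \<le> k + 2"
  shows "smooth (Suc m) {i} (\<lambda>\<phi> v. J c (b \<phi>) Ms (v i))"
    and "smooth (Suc m) {} (\<lambda>\<phi> v. J c (b \<phi>) Ms \<phi>)"
proof -
  have "smooth m {i} (\<lambda>\<phi> v. J c (b \<phi>) [matrix_unit p q] (v i))" for p q i
    using len by (intro J) simp
  note sd = smooth_b_Suc(2)[OF b W this]
  have b': "smooth m {l} (\<lambda>\<phi> v. b' \<phi> (v l) $ p $ q)" for l p q
    by (rule smooth_cong[OF sd[of l p q]]) (simp add: b'_entries)
  have "smooth m {i} (\<lambda>\<phi> v. J c (b \<phi>) (matrix_unit p q # Ms) (v i))" for p q i using len by (intro J) simp
  moreover have "smooth m {} (\<lambda>\<phi> v. J c (b \<phi>) (matrix_unit p q # Ms) \<phi>)" for p q using len by (intro J0) simp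
  moreover have "smooth m {l} (\<lambda>\<phi> v. J c (b \<phi>) Ms (v l))" for l using len by (intro J) simp
  ultimately show "smooth (Suc m) {i} (\<lambda>\<phi> v. J c (b \<phi>) Ms (v i))"
    "smooth (Suc m) {} (\<lambda>\<phi> v. J c (b \<phi>) Ms \<phi>)"
    using smooth_J_Suc[OF len b'] by blast+
qed

lemma L_entries:
  "L \<phi> (matrix_unit p q) $ i $ j = (\<Sum>r\<in>UNIV. matrix_unit p q $ i $ r * (a * J c (b \<phi>) [matrix_unit r j] \<phi>)) +
     (\<Sum>r\<in>UNIV. b \<phi> $ i $ r * (- a * J c (b \<phi>) [matrix_unit p q, matrix_unit r j] \<phi>))"
  by (simp add: L_def score_deriv_def weighted_moment_def weighted_moment_deriv_def matrix_matrix_mult_def)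

lemma smooth_L:
  assumes "\<And>i j. smooth m {} (\<lambda>\<phi> _. b \<phi> $ i $ j)"
    and "\<And>Ms. length Ms \<le> 2 \<Longrightarrow> smooth m {} (\<lambda>\<phi> v. J c (b \<phi>) Ms \<phi>)"
  shows "smooth m {} (\<lambda>\<phi> _. L \<phi> (matrix_unit p q) $ i $ j)"
  unfolding L_entries
  by (intro smooth_add smooth_sum smooth_mult_scalar smooth_cmult assms smooth_const) auto

text \<open>
  Differentiating an inverse: the difference of two inverses is \<open>- W (L' - L) W\<close>.
\<close>

lemma smooth_W_Suc:
  assumes W: "\<And>p q i j. smooth m {} (\<lambda>\<phi> _. W \<phi> (matrix_unit p q) $ i $ j)"
    and L: "\<And>p q i j. smooth (Suc m) {} (\<lambda>\<phi> _. L \<phi> (matrix_unit p q) $ i $ j)"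
  shows "smooth (Suc m) {} (\<lambda>\<phi> _. W \<phi> (matrix_unit p q) $ i $ j)"
proof -
  have "\<forall>l p q r s. \<exists>L'. smooth m {l} L' \<and> line_deriv l (\<lambda>\<phi> _. L \<phi> (matrix_unit p q) $ r $ s) L'"
  proof (intro allI)
    fix l :: nat and p q r s
    have "l \<notin> {}" by simp
    from smooth_SucE[OF L[of p q r s] this] show "\<exists>L'. smooth m {l} L' \<and> line_deriv l (\<lambda>\<phi> _. L \<phi> (matrix_unit p q) $ r $ s) L'"
      by metis
  qed
  then obtain L' where L': "\<And>l p q r s. smooth m {l} (L' l p q r s)"
      "\<And>l p q r s. line_deriv l (\<lambda>\<phi> _. L \<phi> (matrix_unit p q) $ r $ s) (L' l p q r s)"
    by metis
  let ?d = "\<lambda>l \<phi> v. - (\<Sum>p'\<in>UNIV. \<Sum>q'\<in>UNIV. \<Sum>r\<in>UNIV. \<Sum>s\<in>UNIV.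
      W \<phi> (matrix_unit p q) $ p' $ q' * (W \<phi> (matrix_unit r s) $ i $ j * L' l p' q' r s \<phi> v))"
  have sd: "smooth m {l} (?d l)" for l
    by (intro smooth_uminus smooth_sum smooth_mult_scalar W L') auto
  have "line_deriv l (\<lambda>\<phi> _. W \<phi> (matrix_unit p q) $ i $ j) (?d l)" for l
    unfolding line_deriv_def
  proof (intro ballI allI)
    fix \<phi> and v :: "nat \<Rightarrow> (real ^ 'd) signed_measure" assume \<phi>: "\<phi> \<in> U"
    define \<psi> where "\<psi> t = \<phi> + t *\<^sub>R v l" for t
    define X where "X = W \<phi> (matrix_unit p q)"
    define D where "D t p' q' r s = (L (\<psi> t) (matrix_unit p' q') $ r $ s - L \<phi> (matrix_unit p' q') $ r $ s) / t" for t p' q' r s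
    have evU: "\<forall>\<^sub>F t in at 0. \<psi> t \<in> U" unfolding \<psi>_def by (rule eventually_line_in_U[OF \<phi>])
    have D: "((\<lambda>t. D t p' q' r s) \<longlongrightarrow> L' l p' q' r s \<phi> v) (at 0)" for p' q' r s
      using L'(2)[of l p' q' r s] \<phi> unfolding line_deriv_def D_def \<psi>_def DERIV_def by simp
    have tD: "((\<lambda>t. t * D t p' q' r s) \<longlongrightarrow> 0) (at 0)" for p' q' r s
      using tendsto_mult[OF tendsto_ident_at D] by simp
    have diff: "W (\<psi> t) Y - W \<phi> Y = - W (\<psi> t) (L (\<psi> t) (W \<phi> Y) - L \<phi> (W \<phi> Y))" if "\<psi> t \<in> U" for t Y
      by (simp add: linear_diff[OF linear_W[OF that]] W_L[OF that] L_W[OF \<phi>])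
    have expand: "L (\<psi> t) Z - L \<phi> Z = (\<Sum>p'\<in>UNIV. \<Sum>q'\<in>UNIV. \<Sum>r\<in>UNIV. \<Sum>s\<in>UNIV. (Z $ p' $ q' * (t * D t p' q' r s)) *\<^sub>R matrix_unit r s)"
      if "\<psi> t \<in> U" "t \<noteq> 0" for t Z
    proof -
      have "linear (\<lambda>Z. L (\<psi> t) Z - L \<phi> Z)"
        by (intro linear_compose_sub linear_L that \<phi>)
      from linear_matrix_expansion[OF this, of Z]
      have "L (\<psi> t) Z - L \<phi> Z = (\<Sum>p'\<in>UNIV. \<Sum>q'\<in>UNIV. Z $ p' $ q' *\<^sub>R (L (\<psi> t) (matrix_unit p' q') - L \<phi> (matrix_unit p' q')))" .
      also have "\<dots> = (\<Sum>p'\<in>UNIV. \<Sum>q'\<in>UNIV. Z $ p' $ q' *\<^sub>R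
          (\<Sum>r\<in>UNIV. \<Sum>s\<in>UNIV. (t * D t p' q' r s) *\<^sub>R matrix_unit r s))"
        using that(2) by (subst matrix_expansion[of "L (\<psi> t) _ - L \<phi> _"]) (simp add: D_def)
      finally show ?thesis by (simp add: scaleR_sum_right)
    qed
    have Wlim: "((\<lambda>t. W (\<psi> t) Y) \<longlongrightarrow> W \<phi> Y) (at 0)" for Y
    proof -
      have z: "((\<lambda>t. \<Sum>p'\<in>UNIV. \<Sum>q'\<in>UNIV. \<Sum>r\<in>UNIV. \<Sum>s\<in>UNIV. (W \<phi> Y $ p' $ q' * (t * D t p' q' r s)) *\<^sub>R matrix_unit r s) \<longlongrightarrow>
          (\<Sum>p'\<in>UNIV. \<Sum>q'\<in>UNIV. \<Sum>r\<in>UNIV. \<Sum>s\<in>UNIV. (W \<phi> Y $ p' $ q' * 0) *\<^sub>R matrix_unit r s)) (at 0)"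
        by (intro tendsto_intros tD)
      have "\<forall>\<^sub>F t in at 0. norm (W (\<psi> t) Y - W \<phi> Y) \<le> \<bar>M\<bar> * norm (\<Sum>p'\<in>UNIV. \<Sum>q'\<in>UNIV. \<Sum>r\<in>UNIV. \<Sum>s\<in>UNIV. (W \<phi> Y $ p' $ q' * (t * D t p' q' r s)) *\<^sub>R matrix_unit r s)"
        using evU eventually_neq_at_within[of "0::real" 0 UNIV]
      proof eventually_elim
        case (elim t)
        have "norm (W (\<psi> t) Y - W \<phi> Y) \<le> M * norm (L (\<psi> t) (W \<phi> Y) - L \<phi> (W \<phi> Y))"
          unfolding diff[OF elim(1)] norm_minus_cancel by (rule norm_W[OF elim(1)])
        also have "\<dots> \<le> \<bar>M\<bar> * norm (L (\<psi> t) (W \<phi> Y) - L \<phi> (W \<phi> Y))" by (intro mult_right_mono) auto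
        finally show ?case unfolding expand[OF elim] .
      qed
      moreover have "((\<lambda>t. \<bar>M\<bar> * norm (\<Sum>p'\<in>UNIV. \<Sum>q'\<in>UNIV. \<Sum>r\<in>UNIV. \<Sum>s\<in>UNIV. (W \<phi> Y $ p' $ q' * (t * D t p' q' r s)) *\<^sub>R matrix_unit r s)) \<longlongrightarrow> 0) (at 0)"
        using tendsto_mult[OF tendsto_const[of "\<bar>M\<bar>"] tendsto_norm[OF z]] by simp
      ultimately have "((\<lambda>t. W (\<psi> t) Y - W \<phi> Y) \<longlongrightarrow> 0) (at 0)" by (rule Lim_null_comparison)
      then show ?thesis by (simp add: LIM_zero_iff)
    qed
    have "((\<lambda>t. - (\<Sum>p'\<in>UNIV. \<Sum>q'\<in>UNIV. \<Sum>r\<in>UNIV. \<Sum>s\<in>UNIV. X $ p' $ q' * (W (\<psi> t) (matrix_unit r s) $ i $ j * D t p' q' r s))) \<longlongrightarrow>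
        ?d l \<phi> v) (at 0)"
      unfolding X_def by (intro tendsto_intros D Wlim)
    moreover have "\<forall>\<^sub>F t in at 0. - (\<Sum>p'\<in>UNIV. \<Sum>q'\<in>UNIV. \<Sum>r\<in>UNIV. \<Sum>s\<in>UNIV. X $ p' $ q' * (W (\<psi> t) (matrix_unit r s) $ i $ j * D t p' q' r s))
        = (W (\<psi> t) (matrix_unit p q) $ i $ j - W \<phi> (matrix_unit p q) $ i $ j) / t"
      using evU eventually_neq_at_within[of "0::real" 0 UNIV]
    proof eventually_elim
      case (elim t)
      note lin = linear_W[OF elim(1)]
      have "W (\<psi> t) (matrix_unit p q) - W \<phi> (matrix_unit p q) = - (\<Sum>p'\<in>UNIV. \<Sum>q'\<in>UNIV. \<Sum>r\<in>UNIV. \<Sum>s\<in>UNIV. (X $ p' $ q' * (t * D t p' q' r s)) *\<^sub>R W (\<psi> t) (matrix_unit r s))"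
        unfolding diff[OF elim(1)] expand[OF elim] X_def by (simp add: linear_sum[OF lin] linear_scale[OF lin])
      then have "W (\<psi> t) (matrix_unit p q) $ i $ j - W \<phi> (matrix_unit p q) $ i $ j =
          - (\<Sum>p'\<in>UNIV. \<Sum>q'\<in>UNIV. \<Sum>r\<in>UNIV. \<Sum>s\<in>UNIV. (X $ p' $ q' * (t * D t p' q' r s)) * W (\<psi> t) (matrix_unit r s) $ i $ j)"
        by (simp only: vector_minus_component[symmetric]) (simp add: sum_component)
      also have "\<dots> = t * - (\<Sum>p'\<in>UNIV. \<Sum>q'\<in>UNIV. \<Sum>r\<in>UNIV. \<Sum>s\<in>UNIV. X $ p' $ q' * (W (\<psi> t) (matrix_unit r s) $ i $ j * D t p' q' r s))"
        by (simp add: sum_distrib_left mult_ac)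
      finally show ?case using elim(2) by simp
    qed
    ultimately have "((\<lambda>t. (W (\<psi> t) (matrix_unit p q) $ i $ j - W \<phi> (matrix_unit p q) $ i $ j) / t) \<longlongrightarrow> ?d l \<phi> v) (at 0)"
      by (rule Lim_transform_eventually)
    then show "((\<lambda>t. W (\<phi> + t *\<^sub>R v l) (matrix_unit p q) $ i $ j) has_real_derivative ?d l \<phi> v) (at 0)"
      unfolding DERIV_def \<psi>_def by simp
  qed
  then show ?thesis using sd by (intro smooth_SucI[where f' = ?d] mlin_W)
qed

text \<open>
  The three families depend on each other: the branch needs kernels with one factor and the inverse,
  the inverse needs kernels with two factors, and kernels need the branch. The inverse is used one
  order less than the branch, which makes the count of factors end exactly at \<^term>\<open>k + 2\<close>.
\<close>

lemma smooth_branch: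
  "m \<le> k + 1 \<Longrightarrow> (\<forall>i j. smooth m {} (\<lambda>\<phi> _. b \<phi> $ i $ j)) \<and>
     (\<forall>Ms. length Ms + m \<le> k + 2 \<longrightarrow> (\<forall>i. smooth m {i} (\<lambda>\<phi> v. J c (b \<phi>) Ms (v i))) \<and>
        smooth m {} (\<lambda>\<phi> v. J c (b \<phi>) Ms \<phi>)) \<and>
     (m \<le> k \<longrightarrow> (\<forall>p q i j. smooth m {} (\<lambda>\<phi> _. W \<phi> (matrix_unit p q) $ i $ j)))"
proof (induction m)
  case 0
  then show ?case using mlin_b mlin_J_arg mlin_J_self mlin_W by simp
next
  case (Suc m)
  then have b: "\<And>i j. smooth m {} (\<lambda>\<phi> _. b \<phi> $ i $ j)"
    and J: "\<And>Ms i. length Ms + m \<le> k + 2 \<Longrightarrow> smooth m {i} (\<lambda>\<phi> v. J c (b \<phi>) Ms (v i))"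
    and J0: "\<And>Ms. length Ms + m \<le> k + 2 \<Longrightarrow> smooth m {} (\<lambda>\<phi> v. J c (b \<phi>) Ms \<phi>)"
    and W: "\<And>p q i j. smooth m {} (\<lambda>\<phi> _. W \<phi> (matrix_unit p q) $ i $ j)"
    by auto
  have "smooth m {i} (\<lambda>\<phi> v. J c (b \<phi>) [matrix_unit p q] (v i))" for p q i
    using Suc.prems by (intro J) simp
  note b1 = smooth_b_Suc(1)[OF b W this]
  note J1 = smooth_J_all_Suc[OF b W J J0]
  have W1: "smooth (Suc m) {} (\<lambda>\<phi> _. W \<phi> (matrix_unit p q) $ i $ j)" if "Suc m \<le> k" for p q i j
    using that by (intro smooth_W_Suc W smooth_L b1 J1) auto
  show ?case using b1 J1 W1 by blast
qed

lemma smooth_weighted_moment: "smooth (Suc k) {} (\<lambda>\<phi> _. weighted_moment c a (b \<phi>) \<phi> $ i $ j)"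
proof -
  have "smooth (Suc k) {} (\<lambda>\<phi> v. J c (b \<phi>) [matrix_unit i j] \<phi>)"
    using smooth_branch[of "Suc k"] by simp
  then show ?thesis by (simp add: weighted_moment_def smooth_cmult del: smooth.simps)
qed

end

section \<open>Existence of the branch\<close>

text \<open>
  Pointwise convergence of linear maps in finite dimension is uniform on the unit ball.
\<close>

lemma linear_family_uniform:
  fixes f :: "'a::topological_space \<Rightarrow> real ^ 'n ^ 'n \<Rightarrow> 'b::real_normed_vector"
  assumes lin: "\<forall>\<^sub>F x in F. linear (f x)" "linear g"
    and lim: "\<And>i j. ((\<lambda>x. f x (matrix_unit i j)) \<longlongrightarrow> g (matrix_unit i j)) F" and e: "0 < e"
  shows "\<forall>\<^sub>F x in F. \<forall>H. norm (f x H - g H) \<le> e * norm H"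
proof -
  define n where "n = real CARD('n) * real CARD('n)"
  have n: "0 < n" by (simp add: n_def)
  have "\<forall>\<^sub>F x in F. \<forall>i j. norm (f x (matrix_unit i j) - g (matrix_unit i j)) < e / n"
    using tendstoD[OF lim, of "e / n"] e n by (simp add: eventually_all_finite dist_norm)
  with lin(1) show ?thesis
  proof eventually_elim
    case (elim x)
    show ?case
    proof
      fix H
      have "norm (f x H - g H) = norm (\<Sum>i\<in>UNIV. \<Sum>j\<in>UNIV. H $ i $ j *\<^sub>R (f x (matrix_unit i j) - g (matrix_unit i j)))"
        unfolding linear_matrix_expansion[OF elim(1), of H] linear_matrix_expansion[OF lin(2), of H]
        by (simp add: scaleR_diff_right sum_subtractf)
      also have "\<dots> \<le> (\<Sum>i\<in>(UNIV :: 'n set). \<Sum>j\<in>(UNIV :: 'n set). norm H * (e / n))"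
      proof (intro order_trans[OF norm_sum] sum_mono)
        fix i j
        show "norm (H $ i $ j *\<^sub>R (f x (matrix_unit i j) - g (matrix_unit i j))) \<le> norm H * (e / n)"
          unfolding norm_scaleR using elim(2) e n abs_entry_le_norm[of H i j]
          by (intro mult_mono) (auto intro: less_imp_le)
      qed
      also have "\<dots> = e * norm H" using n by (simp add: n_def)
      finally show "norm (f x H - g H) \<le> e * norm H" .
    qed
  qed
qed

lemma continuous_score_deriv:
  assumes "0 < c" "0 < \<kappa>" "coercive \<kappa> B0"
  shows "((\<lambda>B. score_deriv c a B \<phi> H) \<longlongrightarrow> score_deriv c a B0 \<phi> H) (at B0)"
proof -
  have S: "((\<lambda>B. weighted_moment c a B \<phi>) \<longlongrightarrow> weighted_moment c a B0 \<phi>) (at B0)"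
    using has_derivative_continuous[OF has_derivative_weighted_moment[OF assms]] by (simp add: isCont_def)
  have "((\<lambda>B. - (a * J c B [H, matrix_unit i j] \<phi>)) \<longlongrightarrow> - (a * J c B0 [H, matrix_unit i j] \<phi>)) (at B0)" for i j
    using has_derivative_continuous[OF has_derivative_J[OF assms]] by (intro tendsto_intros) (simp add: isCont_def)
  then have D: "((\<lambda>B. weighted_moment_deriv c a B \<phi> H) \<longlongrightarrow> weighted_moment_deriv c a B0 \<phi> H) (at B0)"
    unfolding weighted_moment_deriv_def by (intro tendsto_vec_lambda)
  show ?thesis unfolding score_deriv_def
    by (intro tendsto_add bounded_bilinear.tendsto[OF bounded_bilinear_matrix_mult] S D tendsto_const tendsto_ident_at)
qed

text \<open>
  A simplified Newton iteration with the inverse of the derivative frozen at the reference point is a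
  contraction of a small ball, for every measure close to the reference measure.
\<close>

theorem implicit_branch_exists:
  fixes B0 :: "real ^ ('d::finite) option ^ 'd option" and \<phi>0 :: "(real ^ 'd) signed_measure"
  assumes c: "0 < c" and \<kappa>: "0 < \<kappa>" and a: "0 \<le> a"
    and B0: "coercive (2 * \<kappa>) B0" and sol: "score c a B0 \<phi>0 = 0"
    and nondeg: "\<And>H. score_deriv c a B0 \<phi>0 H = 0 \<Longrightarrow> H = 0"
  shows "\<exists>\<delta> R M b. implicit_branch k \<phi>0 \<delta> c a \<kappa> R M b"
proof -
  let ?N = "poly_norm (2 * k + 4) :: (real ^ 'd) signed_measure \<Rightarrow> real"
  have N: "0 \<le> ?N \<phi>" "?N (\<phi> + \<psi>) \<le> ?N \<phi> + ?N \<psi>" "?N (t *\<^sub>R \<phi>) = \<bar>t\<bar> * ?N \<phi>" for \<phi> \<psi> t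
    using is_seminorm_poly_norm[of "2 * k + 4"] unfolding is_seminorm_def by blast+
  have cB0: "coercive \<kappa> B0" using coercive_near[OF B0, of B0 \<kappa>] \<kappa> by simp
  define L0 where "L0 = score_deriv c a B0 \<phi>0"
  have lin0: "linear L0" unfolding L0_def by (rule linear_score_deriv[OF c \<kappa> cB0])
  have inj0: "inj L0" unfolding linear_injective_0[OF lin0] using nondeg by (simp add: L0_def)
  then obtain I0 where I0: "linear I0" "\<And>H. I0 (L0 H) = H" "\<And>H. L0 (I0 H) = H"
    using linear_injective_isomorphism[OF lin0] by blast
  obtain K where K: "K > 0" "\<And>Y. norm (I0 Y) \<le> K * norm Y"
    using linear_bounded_pos[OF I0(1)] by blast
  define R where "R = norm B0 + \<kappa>"
  obtain C where C: "0 \<le> C" "\<And>B \<phi> \<psi>. coercive \<kappa> B \<Longrightarrow> norm B \<le> R \<Longrightarrow>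
      norm (score c a B \<phi> - score c a B \<psi>) \<le> C * ?N (\<phi> - \<psi>)"
    "\<And>B \<phi> \<psi> H. coercive \<kappa> B \<Longrightarrow> norm B \<le> R \<Longrightarrow>
      norm (score_deriv c a B \<phi> H - score_deriv c a B \<psi> H) \<le> C * ?N (\<phi> - \<psi>) * norm H"
    using score_perturbation_bounds[OF c \<kappa> _ a, where r = "2 * k + 4" and R = R and 'd = 'd] by (smt (verit) le_add2)
  have near: "coercive \<kappa> B \<and> norm B \<le> R" if "norm (B - B0) \<le> \<kappa>" for B
    using coercive_near[OF B0 that] that norm_triangle_sub[of B B0] by (simp add: R_def)
  have "\<forall>\<^sub>F B in at B0. linear (score_deriv c a B \<phi>0)"
  proof -
    have "\<forall>\<^sub>F B in at B0. dist B B0 < \<kappa>" by (rule tendstoD[OF tendsto_ident_at \<kappa>])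
    then show ?thesis
    proof (rule eventually_mono)
      fix B assume "dist B B0 < \<kappa>"
      then have "coercive \<kappa> B" using near[of B] by (simp add: dist_norm)
      then show "linear (score_deriv c a B \<phi>0)" by (rule linear_score_deriv[OF c \<kappa>])
    qed
  qed
  from linear_family_uniform[OF this lin0 _, of "1 / (4 * K)"]
  have "\<forall>\<^sub>F B in at B0. \<forall>H. norm (score_deriv c a B \<phi>0 H - L0 H) \<le> 1 / (4 * K) * norm H"
    using continuous_score_deriv[OF c \<kappa> cB0] K(1) unfolding L0_def by simp
  then obtain r' where r': "r' > 0" "\<And>B H. B \<noteq> B0 \<Longrightarrow> dist B B0 < r' \<Longrightarrow> norm (score_deriv c a B \<phi>0 H - L0 H) \<le> 1 / (4 * K) * norm H"
    unfolding eventually_at by blast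
  define r where "r = min \<kappa> (r' / 2)"
  have r: "r > 0" "r \<le> \<kappa>" using r'(1) \<kappa> by (auto simp: r_def)
  have cont: "norm (score_deriv c a B \<phi>0 H - L0 H) \<le> 1 / (4 * K) * norm H" if "norm (B - B0) \<le> r" for B H
  proof (cases "B = B0")
    case True then show ?thesis using K(1) by (simp add: L0_def)
  next
    case False then show ?thesis using that r'(1) by (intro r'(2)) (auto simp: dist_norm r_def)
  qed
  \<comment> \<open>the first bound makes the iteration a contraction, the second keeps it in the ball of radius \<open>r\<close>\<close>
  define \<delta> where "\<delta> = min (1 / (4 * K * (C + 1))) (r / (2 * K * (C + 1)))"
  have \<delta>: "\<delta> > 0" using K(1) C(1) r(1) by (simp add: \<delta>_def)
  have Cd: "K * (C * s) \<le> 1 / 4" "K * (C * s) \<le> r / 2" if "0 \<le> s" "s < \<delta>" for s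
  proof -
    have "K * (C * s) \<le> K * (C + 1) * s" using K(1) C(1) that by (simp add: algebra_simps)
    moreover have "K * (C + 1) * s \<le> K * (C + 1) * \<delta>" using that K(1) C(1) by (intro mult_left_mono) auto
    moreover have "K * (C + 1) * \<delta> \<le> K * (C + 1) * (1 / (4 * K * (C + 1)))" "K * (C + 1) * \<delta> \<le> K * (C + 1) * (r / (2 * K * (C + 1)))"
      using K(1) C(1) by (intro mult_left_mono; simp add: \<delta>_def)+
    moreover have "K * (C + 1) * (1 / (4 * K * (C + 1))) = 1 / 4" "K * (C + 1) * (r / (2 * K * (C + 1))) = r / 2"
    proof -
      have "K \<noteq> 0" "C + 1 \<noteq> 0" using K(1) C(1) by auto
      then show "K * (C + 1) * (1 / (4 * K * (C + 1))) = 1 / 4" "K * (C + 1) * (r / (2 * K * (C + 1))) = r / 2"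
        by (simp_all add: divide_simps)
    qed
    ultimately show "K * (C * s) \<le> 1 / 4" "K * (C * s) \<le> r / 2" by linarith+
  qed
  define U where "U = {\<phi>. ?N (\<phi> - \<phi>0) < \<delta>}"
  define \<Psi> where "\<Psi> \<phi> B = B - I0 (score c a B \<phi>)" for \<phi> B
  have approx: "norm (H - I0 (score_deriv c a B \<phi> H)) \<le> 1 / 2 * norm H"
    if B: "norm (B - B0) \<le> r" and \<phi>: "\<phi> \<in> U" for B \<phi> H
  proof -
    have B': "coercive \<kappa> B" "norm B \<le> R" using near[of B] B r(2) by auto
    have "H - I0 (score_deriv c a B \<phi> H) = - I0 (score_deriv c a B \<phi> H - L0 H)"
      by (simp add: linear_diff[OF I0(1)] I0(2))
    then have "norm (H - I0 (score_deriv c a B \<phi> H)) \<le> K * norm (score_deriv c a B \<phi> H - L0 H)"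
      using K(2) by simp
    also have "score_deriv c a B \<phi> H - L0 H = (score_deriv c a B \<phi> H - score_deriv c a B \<phi>0 H) + (score_deriv c a B \<phi>0 H - L0 H)" by simp
    also have "K * norm \<dots> \<le> K * (C * ?N (\<phi> - \<phi>0) * norm H + 1 / (4 * K) * norm H)"
      using K(1) by (intro mult_left_mono order_trans[OF norm_triangle_ineq] add_mono C(3)[OF B'] cont[OF B]) auto
    also have "\<dots> = K * (C * ?N (\<phi> - \<phi>0)) * norm H + 1 / 4 * norm H" using K(1) by (simp add: field_simps)
    also have "\<dots> \<le> 1 / 4 * norm H + 1 / 4 * norm H"
      using Cd(1)[of "?N (\<phi> - \<phi>0)"] N(1)[of "\<phi> - \<phi>0"] \<phi> by (intro add_mono mult_right_mono) (auto simp: U_def)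
    finally show ?thesis by simp
  qed
  have contr: "norm (\<Psi> \<phi> A - \<Psi> \<phi> B) \<le> 1 / 2 * norm (A - B)"
    if "A \<in> cball B0 r" "B \<in> cball B0 r" and \<phi>: "\<phi> \<in> U" for A B \<phi>
  proof (rule differentiable_bound[OF convex_cball _ _ that(1,2)])
    fix A assume "A \<in> cball B0 r"
    then have A: "norm (A - B0) \<le> r" by (simp add: dist_norm norm_minus_commute)
    then have "coercive \<kappa> A" using near[of A] r(2) by auto
    have "(\<Psi> \<phi> has_derivative (\<lambda>H. H - I0 (score_deriv c a A \<phi> H))) (at A)"
      unfolding \<Psi>_def using I0(1)
      by (intro has_derivative_diff has_derivative_ident bounded_linear.has_derivative[of I0]
          has_derivative_score[OF c \<kappa> \<open>coercive \<kappa> A\<close>]) (simp add: linear_conv_bounded_linear)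
    then show "(\<Psi> \<phi> has_derivative (\<lambda>H. H - I0 (score_deriv c a A \<phi> H))) (at A within cball B0 r)"
      by (rule has_derivative_at_withinI)
    show "onorm (\<lambda>H. H - I0 (score_deriv c a A \<phi> H)) \<le> 1 / 2"
      by (rule onorm_le[OF approx[OF A \<phi>]])
  qed
  have shift: "norm (\<Psi> \<phi> B - \<Psi> \<psi> B) \<le> K * (C * ?N (\<phi> - \<psi>))" if "norm (B - B0) \<le> r" for B \<phi> \<psi>
  proof -
    have B': "coercive \<kappa> B" "norm B \<le> R" using near[of B] that r(2) by auto
    have "\<Psi> \<phi> B - \<Psi> \<psi> B = - I0 (score c a B \<phi> - score c a B \<psi>)"
      by (simp add: \<Psi>_def linear_diff[OF I0(1)])
    then have "norm (\<Psi> \<phi> B - \<Psi> \<psi> B) \<le> K * norm (score c a B \<phi> - score c a B \<psi>)" using K(2) by simp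
    also have "\<dots> \<le> K * (C * ?N (\<phi> - \<psi>))" using K(1) by (intro mult_left_mono C(2)[OF B']) auto
    finally show ?thesis .
  qed
  have fix0: "\<Psi> \<phi>0 B0 = B0" by (simp add: \<Psi>_def sol linear_0[OF I0(1)])
  have "\<exists>!B\<in>cball B0 r. \<Psi> \<phi> B = B" if \<phi>: "\<phi> \<in> U" for \<phi>
  proof (rule Banach_fix[OF compact_imp_complete[OF compact_cball], where c = "1 / 2"])
    show "cball B0 r \<noteq> {}" using r(1) by simp
    show "\<Psi> \<phi> ` cball B0 r \<subseteq> cball B0 r"
    proof clarify
      fix B assume B: "B \<in> cball B0 r"
      have "norm (\<Psi> \<phi> B - B0) \<le> norm (\<Psi> \<phi> B - \<Psi> \<phi> B0) + norm (\<Psi> \<phi> B0 - \<Psi> \<phi>0 B0)"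
        using norm_triangle_ineq[of "\<Psi> \<phi> B - \<Psi> \<phi> B0" "\<Psi> \<phi> B0 - \<Psi> \<phi>0 B0"] by (simp add: fix0)
      also have "\<dots> \<le> 1 / 2 * norm (B - B0) + K * (C * ?N (\<phi> - \<phi>0))"
        using B \<phi> r(1) by (intro add_mono contr shift) auto
      also have "\<dots> \<le> 1 / 2 * r + r / 2"
        using B \<phi> N(1)[of "\<phi> - \<phi>0"] by (intro add_mono mult_left_mono Cd(2)) (auto simp: U_def dist_norm norm_minus_commute)
      finally show "\<Psi> \<phi> B \<in> cball B0 r" by (simp add: dist_norm norm_minus_commute)
    qed
    show "dist (\<Psi> \<phi> A) (\<Psi> \<phi> B) \<le> 1 / 2 * dist A B" if "A \<in> cball B0 r" "B \<in> cball B0 r" for A B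
      using contr[OF that \<phi>] by (simp add: dist_norm)
  qed auto
  then obtain b where b: "\<And>\<phi>. \<phi> \<in> U \<Longrightarrow> b \<phi> \<in> cball B0 r" "\<And>\<phi>. \<phi> \<in> U \<Longrightarrow> \<Psi> \<phi> (b \<phi>) = b \<phi>" by metis
  have bn: "norm (b \<phi> - B0) \<le> r" if "\<phi> \<in> U" for \<phi> using b(1)[OF that] by (simp add: dist_norm norm_minus_commute)
  have lip: "norm (b \<phi> - b \<psi>) \<le> (2 * (K * C)) * ?N (\<phi> - \<psi>)" if "\<phi> \<in> U" "\<psi> \<in> U" for \<phi> \<psi>
  proof -
    have "b \<phi> - b \<psi> = (\<Psi> \<phi> (b \<phi>) - \<Psi> \<phi> (b \<psi>)) + (\<Psi> \<phi> (b \<psi>) - \<Psi> \<psi> (b \<psi>))"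
      using b(2) that by simp
    then have "norm (b \<phi> - b \<psi>) \<le> norm (\<Psi> \<phi> (b \<phi>) - \<Psi> \<phi> (b \<psi>)) + norm (\<Psi> \<phi> (b \<psi>) - \<Psi> \<psi> (b \<psi>))"
      by (metis norm_triangle_ineq)
    also have "\<dots> \<le> 1 / 2 * norm (b \<phi> - b \<psi>) + K * (C * ?N (\<phi> - \<psi>))"
      using that by (intro add_mono contr shift b bn)
    finally show ?thesis by simp
  qed
  interpret S: seminormed_ball ?N \<phi>0 \<delta>
    by unfold_locales (simp_all add: is_seminorm_poly_norm \<delta>)
  have US: "S.U = U" by (simp add: S.U_def U_def)
  have "implicit_branch k \<phi>0 \<delta> c a \<kappa> R (2 * K) b"
  proof (unfold_locales, unfold US)
    fix \<phi> assume \<phi>: "\<phi> \<in> U"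
    show "coercive \<kappa> (b \<phi>)" "norm (b \<phi>) \<le> R" using near[of "b \<phi>"] bn[OF \<phi>] r(2) by auto
    have "I0 (score c a (b \<phi>) \<phi>) = 0" using b(2)[OF \<phi>] by (simp add: \<Psi>_def)
    then show "score c a (b \<phi>) \<phi> = 0" using I0(3) linear_0[OF lin0] by metis
    fix H
    have "norm H \<le> norm (H - I0 (score_deriv c a (b \<phi>) \<phi> H)) + norm (I0 (score_deriv c a (b \<phi>) \<phi> H))"
      using norm_triangle_ineq[of "H - I0 (score_deriv c a (b \<phi>) \<phi> H)" "I0 (score_deriv c a (b \<phi>) \<phi> H)"] by simp
    also have "\<dots> \<le> 1 / 2 * norm H + K * norm (score_deriv c a (b \<phi>) \<phi> H)"
      by (intro add_mono approx[OF bn[OF \<phi>] \<phi>] K(2))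
    finally show "norm H \<le> 2 * K * norm (score_deriv c a (b \<phi>) \<phi> H)" by simp
  next
    show "\<exists>C. \<forall>\<phi>\<in>U. \<forall>\<psi>\<in>U. norm (b \<phi> - b \<psi>) \<le> C * ?N (\<phi> - \<psi>)" using lip by blast
  qed (use c \<kappa> a in auto)
  then show ?thesis by blast
qed

section \<open>Critical points of the scatter objective\<close>

lemma law_integrable:
  assumes "law P" "g \<in> borel_measurable borel" "\<And>x. \<bar>g x\<bar> \<le> (K :: real)" shows "integrable P g"
proof (rule bounded_integrable)
  show "finite_measure P" using assms(1) by (simp add: law_def prob_space.finite_measure)
  show "g \<in> borel_measurable P" using assms(1,2) measurable_cong_sets unfolding law_def by blast
qed (rule assms)

lemma law_J:
  assumes "law P" "0 < c" "0 < \<kappa>" "coercive \<kappa> B"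
  shows "J c B Ms (signed_of P) = (LINT y|P. kernel c B Ms y)" and "integrable P (kernel c B Ms)"
  unfolding J_def
  by (rule sint_signed_of[OF assms(1) measurable_kernel abs_kernel_le[OF assms(2-4)]],
      rule law_integrable[OF assms(1) measurable_kernel abs_kernel_le[OF assms(2-4)]])

lemma pos_def_lower:
  fixes B :: "real ^ 'n ^ 'n"
  assumes "B \<in> pos_def_mats" shows "\<exists>\<kappa>>0. \<forall>x. \<kappa> * (norm x)\<^sup>2 \<le> x \<bullet> (B *v x)"
proof -
  obtain P :: "real ^ 'n ^ 'n" and l where P: "transpose P ** P = mat 1" "B = transpose P ** diag l ** P" "\<And>i. l i > 0"
    using pos_def_spectral[OF assms] by blast
  have "Min (range l) * (norm x)\<^sup>2 \<le> x \<bullet> (B *v x)" for x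
  proof -
    have "(norm x)\<^sup>2 = x \<bullet> ((transpose P ** mat 1 ** P) *v x)" by (simp add: P(1) power2_norm_eq_inner)
    also have "\<dots> = (\<Sum>i\<in>UNIV. ((P *v x) $ i)\<^sup>2)"
      unfolding quadratic_form_congruence by (simp add: inner_vec_def power2_eq_square)
    finally have "Min (range l) * (norm x)\<^sup>2 = (\<Sum>i\<in>UNIV. Min (range l) * ((P *v x) $ i)\<^sup>2)" by (simp add: sum_distrib_left)
    also have "\<dots> \<le> (\<Sum>i\<in>UNIV. l i * ((P *v x) $ i)\<^sup>2)" by (intro sum_mono mult_right_mono) auto
    also have "\<dots> = x \<bullet> (B *v x)" unfolding P(2) quadratic_form_congruence quadratic_form_diag ..
    finally show ?thesis .
  qed
  moreover have "Min (range l) > 0" using P(3) by simp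
  ultimately show ?thesis by blast
qed

lemma pos_def_coercive: "B \<in> pos_def_mats \<Longrightarrow> \<exists>\<kappa>>0. coercive \<kappa> B"
  using pos_def_lower[of B] by (auto simp: coercive_def)

lemma inner_matrix_mult_right: "(M ** A) \<bullet> N = M \<bullet> (N ** transpose A)"
  for M :: "real ^ 'n ^ 'm" and A :: "real ^ 'p ^ 'n" and N :: "real ^ 'p ^ 'm"
proof -
  have "(\<Sum>j\<in>UNIV. \<Sum>k\<in>UNIV. M $ i $ k * A $ k $ j * N $ i $ j) = (\<Sum>k\<in>UNIV. \<Sum>j\<in>UNIV. M $ i $ k * (N $ i $ j * A $ k $ j))" for i
    by (subst sum.swap) (simp add: mult_ac)
  then show ?thesis
    by (simp add: inner_vec_def matrix_matrix_mult_def transpose_def sum_distrib_left sum_distrib_right)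
qed

lemma inner_matrix_transpose: "transpose M \<bullet> transpose N = M \<bullet> N" for M N :: "real ^ 'n ^ 'm"
  by (simp add: inner_vec_def transpose_def) (rule sum.swap)

lemma inner_matrix_mult_left: "(A ** M) \<bullet> N = M \<bullet> (transpose A ** N)"
  for M :: "real ^ 'n ^ 'm" and A :: "real ^ 'm ^ 'p" and N :: "real ^ 'n ^ 'p"
  using inner_matrix_mult_right[of "transpose M" "transpose A" "transpose N"]
  by (metis inner_matrix_transpose matrix_transpose_mul transpose_transpose)

lemma inner_matrix_unit: "matrix_unit i j \<bullet> M = M $ i $ j"
  by (simp add: matrix_unit_def inner_axis')

lemma inner_diag_mat_1: "diag l \<bullet> mat 1 = sum l UNIV"
  by (simp add: inner_vec_def diag_def mat_def if_distrib[of "\<lambda>x. x * _"] cong: if_cong)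

text \<open>
  Traces against the weighted second moment are integrals of kernels. All integral identities for
  critical points are obtained in this way from matrix identities.
\<close>

lemma weighted_moment_inner:
  assumes "0 < c" "0 < \<kappa>" "coercive \<kappa> B"
  shows "a * J c B [M] \<phi> = M \<bullet> weighted_moment c a B \<phi>"
  using linear_matrix_expansion[OF linear_J_head[OF assms, of "[]" \<phi>], of M]
  by (simp add: inner_vec_def weighted_moment_def sum_distrib_left mult_ac)

lemma kernel_swap: "kernel c B [M, M'] = kernel c B [M', M]"
  by (rule ext) (simp add: kernel_def mult.commute)

lemma weighted_moment_deriv_inner:
  assumes "0 < c" "0 < \<kappa>" "coercive \<kappa> B"
  shows "a * J c B [M, H] \<phi> = - (M \<bullet> weighted_moment_deriv c a B \<phi> H)"
  using linear_matrix_expansion[OF linear_J_head[OF assms, of "[H]" \<phi>], of M]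
  by (simp add: inner_vec_def weighted_moment_deriv_def sum_distrib_left mult_ac sum_negf J_def kernel_swap[of c B H])

lemma kernel_matrix_unit_commute: "kernel c B (Ms @ [matrix_unit i j]) = kernel c B (Ms @ [matrix_unit j i])"
  by (rule ext) (simp add: kernel_def qf_matrix_unit mult.commute)

lemma weighted_moment_symmetric: "transpose (weighted_moment c a B \<phi>) = weighted_moment c a B \<phi>"
  using kernel_matrix_unit_commute[of c B "[]"] by (simp add: vec_eq_iff transpose_def weighted_moment_def J_def)

lemma weighted_moment_deriv_symmetric: "transpose (weighted_moment_deriv c a B \<phi> H) = weighted_moment_deriv c a B \<phi> H"
  using kernel_matrix_unit_commute[of c B "[H]"] by (simp add: vec_eq_iff transpose_def weighted_moment_deriv_def J_def)

text \<open>
  If the augmented observations lay almost surely in a hyperplane, rescaling its normal direction would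
  change the determinant but not the integral, and no minimum could exist.
\<close>

definition nondegenerate :: "(real ^ 'd) measure \<Rightarrow> bool" where
  "nondegenerate P \<longleftrightarrow> (\<forall>u. u \<noteq> 0 \<longrightarrow> \<not> (AE y in P. u \<bullet> augment y = 0))"

text \<open>
  Subtracting the value at the identity matrix makes the integrand bounded, hence integrable for every
  law.
\<close>

definition log_ratio :: "real \<Rightarrow> real ^ ('d::finite) option ^ 'd option \<Rightarrow> real ^ 'd \<Rightarrow> real" where
  "log_ratio c B y = ln ((c + qf B y) / (c + (norm (augment y))\<^sup>2))"

lemma measurable_norm_augment [measurable]: "(\<lambda>y. norm (augment y)) \<in> borel_measurable borel"
  by (intro borel_measurable_continuous_onI continuous_on_norm continuous_augment)

lemma measurable_log_ratio [measurable]: "log_ratio c B \<in> borel_measurable borel"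
  unfolding log_ratio_def by measurable

lemma log_ratio_bounds:
  assumes "0 < c" "0 < \<kappa>" "coercive \<kappa> B"
  shows "\<bar>log_ratio c B y\<bar> \<le> \<bar>ln (min 1 \<kappa>)\<bar> + \<bar>ln (max 1 (norm B))\<bar>"
proof -
  let ?s = "(norm (augment y))\<^sup>2"
  have s: "0 < c + ?s" using assms(1) by (simp add: add_pos_nonneg)
  have "min 1 \<kappa> * (c + ?s) \<le> c + \<kappa> * ?s"
  proof -
    have "min 1 \<kappa> * c \<le> 1 * c" "min 1 \<kappa> * ?s \<le> \<kappa> * ?s" using assms(1) by (intro mult_right_mono; simp)+
    then show ?thesis by (simp add: distrib_left)
  qed
  then have 1: "min 1 \<kappa> \<le> (c + qf B y) / (c + ?s)"
    using coercive_qf[OF assms(3), of y] s by (simp add: pos_le_divide_eq)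
  have "c + qf B y \<le> max 1 (norm B) * (c + ?s)"
  proof -
    have "1 * c \<le> max 1 (norm B) * c" "norm B * ?s \<le> max 1 (norm B) * ?s" using assms(1) by (intro mult_right_mono; simp)+
    then show ?thesis using abs_qf_le[of B y] by (simp add: distrib_left)
  qed
  then have 2: "(c + qf B y) / (c + ?s) \<le> max 1 (norm B)" using s by (simp add: pos_divide_le_eq)
  have "ln (min 1 \<kappa>) \<le> log_ratio c B y" "log_ratio c B y \<le> ln (max 1 (norm B))"
    unfolding log_ratio_def using 1 2 assms(2) by (intro ln_mono; simp add: less_le_trans[of 0 "min 1 \<kappa>"])+
  then show ?thesis by linarith
qed

lemma integrable_log_ratio:
  assumes "law P" "0 < c" "B \<in> pos_def_mats" shows "integrable P (log_ratio c B)"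
proof -
  obtain \<kappa> where "0 < \<kappa>" "coercive \<kappa> B" using pos_def_coercive[OF assms(3)] by blast
  then show ?thesis using law_integrable[OF assms(1) measurable_log_ratio log_ratio_bounds[OF assms(2)]] by blast
qed

definition objective :: "real \<Rightarrow> real \<Rightarrow> (real ^ 'd) measure \<Rightarrow> real ^ ('d::finite) option ^ 'd option \<Rightarrow> real" where
  "objective c a P B = - (1 / 2 * ln (det B)) + a / 2 * (LINT y|P. log_ratio c B y)"

text \<open>
  Jensen's inequality for the logarithm and weights of which one, \<^term>\<open>p0\<close>, sits at the point 1. In
  case of equality all points of positive weight coincide, hence equal 1.
\<close>

lemma ln_gap:
  fixes p x :: "'i \<Rightarrow> real"
  assumes "finite I" and p: "\<And>i. i \<in> I \<Longrightarrow> 0 \<le> p i" and x: "\<And>i. i \<in> I \<Longrightarrow> 0 < x i" and p0: "0 < p0" "p0 + sum p I = 1"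
  shows "(\<Sum>i\<in>I. p i * ln (x i)) \<le> ln (p0 + (\<Sum>i\<in>I. p i * x i))"
    and "(\<Sum>i\<in>I. p i * ln (x i)) = ln (p0 + (\<Sum>i\<in>I. p i * x i)) \<Longrightarrow> i \<in> I \<Longrightarrow> p i \<noteq> 0 \<Longrightarrow> x i = 1"
proof -
  define m where "m = p0 + (\<Sum>i\<in>I. p i * x i)"
  have m: "0 < m" unfolding m_def using p x p0(1) by (intro add_pos_nonneg sum_nonneg mult_nonneg_nonneg) (auto intro: less_imp_le)
  \<comment> \<open>the defect of the tangent inequality of the logarithm at \<open>m\<close>, zero at \<open>m\<close> only\<close>
  define g where "g t = t / m - 1 - ln (t / m)" for t
  have g: "0 \<le> g t" if "0 < t" for t using ln_le_minus_one[of "t / m"] that m by (simp add: g_def)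
  have g0: "t = m" if "0 < t" "g t = 0" for t
    using ln_eq_minus_one[of "t / m"] that m by (simp add: g_def)
  have "ln m - (\<Sum>i\<in>I. p i * ln (x i)) = p0 * g 1 + (\<Sum>i\<in>I. p i * g (x i))"
  proof -
    have "(\<Sum>i\<in>I. p i * g (x i)) = (\<Sum>i\<in>I. (p i * x i) / m - p i - p i * ln (x i) + p i * ln m)"
    proof (intro sum.cong refl)
      fix i assume "i \<in> I"
      then have "0 < x i" by (rule x)
      then show "p i * g (x i) = (p i * x i) / m - p i - p i * ln (x i) + p i * ln m"
        using m by (simp add: g_def ln_div algebra_simps)
    qed
    also have "\<dots> = (\<Sum>i\<in>I. p i * x i) / m - sum p I - (\<Sum>i\<in>I. p i * ln (x i)) + sum p I * ln m"
      by (simp add: sum.distrib sum_subtractf sum_divide_distrib sum_distrib_right)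
    also have "sum p I = 1 - p0" using p0(2) by simp
    also have "(\<Sum>i\<in>I. p i * x i) = m - p0" by (simp add: m_def)
    finally have s: "(\<Sum>i\<in>I. p i * g (x i)) = (m - p0) / m - (1 - p0) - (\<Sum>i\<in>I. p i * ln (x i)) + (1 - p0) * ln m" .
    have "p0 * g 1 = p0 / m - p0 + p0 * ln m" using m by (simp add: g_def ln_div algebra_simps)
    with s show ?thesis using m by (simp add: diff_divide_distrib algebra_simps)
  qed
  note eq = this
  have nn: "0 \<le> p0 * g 1" "\<And>i. i \<in> I \<Longrightarrow> 0 \<le> p i * g (x i)" using p x p0 g by (auto simp: less_imp_le)
  have sn: "0 \<le> (\<Sum>i\<in>I. p i * g (x i))" using nn(2) by (rule sum_nonneg)
  show "(\<Sum>i\<in>I. p i * ln (x i)) \<le> ln (p0 + (\<Sum>i\<in>I. p i * x i))"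
    using eq nn(1) sn by (simp add: m_def)
  assume e: "(\<Sum>i\<in>I. p i * ln (x i)) = ln (p0 + (\<Sum>i\<in>I. p i * x i))" and i: "i \<in> I" "p i \<noteq> 0"
  have z: "p0 * g 1 = 0" "(\<Sum>i\<in>I. p i * g (x i)) = 0" using eq e nn(1) sn unfolding m_def by linarith+
  have "m = 1" using g0[of 1] z(1) p0(1) by simp
  moreover have "p i * g (x i) = 0" using z(2) sum_nonneg_eq_0_iff[OF assms(1) nn(2)] i(1) by simp
  ultimately show "x i = 1" using g0[of "x i"] x[OF i(1)] i(2) by simp
qed

text \<open>
  In coordinates diagonalising both matrices the second is a rescaling of the axes. Concavity of the
  logarithm bounds the increment of the integrand from below by a linear expression in the logarithms
  of the scale factors, and by criticality the integral of that expression is exactly the increment of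
  the log determinant. Equality forces every coordinate that is really rescaled to vanish almost
  surely.
\<close>

theorem critical_point_strict_minimum:
  fixes B0 B1 :: "real ^ ('d::finite) option ^ 'd option"
  assumes P: "law P" "nondegenerate P" and c: "0 < c" and a: "0 < a"
    and B0: "B0 \<in> pos_def_mats" and crit: "score c a B0 (signed_of P) = 0"
    and B1: "B1 \<in> pos_def_mats" "B1 \<noteq> B0"
  shows "objective c a P B0 < objective c a P B1"
proof -
  obtain G :: "real ^ 'd option ^ 'd option" and l where G: "invertible G" "\<And>i. l i > 0"
    "B0 = transpose G ** G" "B1 = transpose G ** diag l ** G"
    using simultaneous_diagonalisation[OF B0 B1(1)] by blast
  obtain \<kappa> where \<kappa>: "0 < \<kappa>" "coercive \<kappa> B0" using pos_def_coercive[OF B0] by blast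
  obtain H where H: "G ** H = mat 1" "H ** G = mat 1" using G(1) by (auto simp: invertible_def)
  define w where "w y = G *v augment y" for y
  define S where "S = weighted_moment c a B0 (signed_of P)"
  define Q where "Q = transpose G ** diag (\<lambda>i. ln (l i)) ** G"
  have B0q: "qf B0 y = (\<Sum>i\<in>UNIV. (w y $ i)\<^sup>2)" for y
    using quadratic_form_congruence[of "augment y" G "mat 1"] by (simp add: qf_def G(3) w_def inner_vec_def power2_eq_square)
  have B1q: "qf B1 y = (\<Sum>i\<in>UNIV. l i * (w y $ i)\<^sup>2)" for y
    unfolding qf_def G(4) w_def quadratic_form_congruence quadratic_form_diag ..
  have Qq: "qf Q y = (\<Sum>i\<in>UNIV. ln (l i) * (w y $ i)\<^sup>2)" for y
    unfolding qf_def Q_def w_def quadratic_form_congruence quadratic_form_diag ..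
  have u: "0 < c + qf B0 y" for y by (rule denominator_pos(2)[OF c \<kappa>])
  \<comment> \<open>the increment of the integrand minus its linear lower bound\<close>
  define D where "D y = log_ratio c B1 y - log_ratio c B0 y - kernel c B0 [Q] y" for y
  have Dform: "D y = ln (c / (c + qf B0 y) + (\<Sum>i\<in>UNIV. (w y $ i)\<^sup>2 / (c + qf B0 y) * l i))
      - (\<Sum>i\<in>UNIV. (w y $ i)\<^sup>2 / (c + qf B0 y) * ln (l i))" for y
  proof -
    have s: "0 < c + (norm (augment y))\<^sup>2" using c by (simp add: add_pos_nonneg)
    have u1: "0 < c + qf B1 y"
      unfolding B1q using c G(2) by (intro add_pos_nonneg sum_nonneg) (auto simp: less_imp_le)
    have "log_ratio c B1 y - log_ratio c B0 y = ln ((c + qf B1 y) / (c + qf B0 y))"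
      unfolding log_ratio_def using s u1 u[of y] by (simp add: ln_div)
    also have "(c + qf B1 y) / (c + qf B0 y) = c / (c + qf B0 y) + (\<Sum>i\<in>UNIV. (w y $ i)\<^sup>2 / (c + qf B0 y) * l i)"
      unfolding B1q add_divide_distrib sum_divide_distrib by (simp add: mult.commute)
    finally show ?thesis
      by (simp add: D_def kernel_def Qq sum_divide_distrib mult.commute)
  qed
  have weights: "c / (c + qf B0 y) + (\<Sum>i\<in>UNIV. (w y $ i)\<^sup>2 / (c + qf B0 y)) = 1" "0 < c / (c + qf B0 y)" for y
    unfolding sum_divide_distrib[symmetric] B0q[symmetric] add_divide_distrib[symmetric]
    using u[of y] c by auto
  have Dnn: "0 \<le> D y" for y
    unfolding Dform using ln_gap(1)[where I = UNIV, OF _ _ G(2) weights(2) weights(1)] u[of y] less_imp_le by simp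
  have D0: "l i = 1" if "D y = 0" "w y $ i \<noteq> 0" for y i
    using ln_gap(2)[where I = UNIV and i = i and x = l, OF _ _ G(2) weights(2)[of y] weights(1)[of y]] u[of y] that
    unfolding Dform by (simp add: less_imp_le)
  have int: "integrable P (log_ratio c B1)" "integrable P (log_ratio c B0)" "integrable P (kernel c B0 [Q])"
    using integrable_log_ratio[OF P(1) c] B0 B1(1) law_J(2)[OF P(1) c \<kappa>] by auto
  then have intD: "integrable P D" unfolding D_def by simp
  have "(LINT y|P. D y) \<noteq> 0"
  proof
    assume "(LINT y|P. D y) = 0"
    then have ae: "AE y in P. D y = 0" using integral_nonneg_eq_0_iff_AE[OF intD] Dnn by simp
    have "\<exists>i. l i \<noteq> 1"
    proof (rule ccontr)
      assume "\<not> ?thesis"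
      then have "diag l = mat 1" by (simp add: diag_def mat_def vec_eq_iff)
      then show False using B1(2) G(3,4) by simp
    qed
    then obtain i where i: "l i \<noteq> 1" by blast
    have "AE y in P. (G $ i) \<bullet> augment y = 0"
      using ae by eventually_elim (use D0 i in \<open>force simp: w_def matrix_vector_mul_component\<close>)
    moreover have "G $ i \<noteq> 0"
    proof
      assume "G $ i = 0"
      then have "(G ** H) $ i $ i = 0" by (simp add: matrix_matrix_mult_def)
      then show False by (simp add: H(1) mat_def)
    qed
    ultimately show False using P(2) by (auto simp: nondegenerate_def)
  qed
  then have Dpos: "0 < (LINT y|P. D y)" using integral_nonneg_AE[of D P] Dnn by (simp add: less_le)
  have BS: "B0 ** S = mat 1" using crit by (simp add: score_def S_def)
  have GSG: "G ** S ** transpose G = mat 1"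
  proof -
    have "transpose G ** (G ** S ** transpose G) = transpose G"
      using BS by (metis G(3) matrix_mul_assoc matrix_mul_lid)
    then have "transpose H ** transpose G ** (G ** S ** transpose G) = transpose H ** transpose G"
      by (metis matrix_mul_assoc)
    then show ?thesis using H(1) by (metis matrix_transpose_mul transpose_mat matrix_mul_lid)
  qed
  have "a * (LINT y|P. kernel c B0 [Q] y) = Q \<bullet> S"
    using weighted_moment_inner[OF c \<kappa>, of a Q "signed_of P"] law_J(1)[OF P(1) c \<kappa>] by (simp add: S_def)
  also have "\<dots> = diag (\<lambda>i. ln (l i)) \<bullet> (G ** S ** transpose G)"
    unfolding Q_def inner_matrix_mult_right[of _ G] inner_matrix_mult_left[of "transpose G"]
    by (simp add: matrix_mul_assoc)
  also have "\<dots> = (\<Sum>i\<in>UNIV. ln (l i))" unfolding GSG by (rule inner_diag_mat_1)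
  finally have K: "a * (LINT y|P. kernel c B0 [Q] y) = (\<Sum>i\<in>UNIV. ln (l i))" .
  have "det B1 = det B0 * prod l UNIV" by (simp add: G(3,4) det_mul det_diag)
  moreover have "ln (prod l UNIV) = (\<Sum>i\<in>UNIV. ln (l i))"
    by (rule ln_prod) (use G(2) in \<open>auto simp: less_imp_neq[symmetric]\<close>)
  ultimately have "ln (det B1) = ln (det B0) + (\<Sum>i\<in>UNIV. ln (l i))"
    using pos_def_det_pos[OF B0] G(2) by (simp add: ln_mult_pos prod_pos)
  moreover have "(LINT y|P. D y) = (LINT y|P. log_ratio c B1 y) - (LINT y|P. log_ratio c B0 y) - (LINT y|P. kernel c B0 [Q] y)"
    unfolding D_def using int by simp
  then have "a * (LINT y|P. D y) = a * (LINT y|P. log_ratio c B1 y) - a * (LINT y|P. log_ratio c B0 y) - (\<Sum>i\<in>UNIV. ln (l i))"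
    unfolding K[symmetric] by (simp only: right_diff_distrib)
  ultimately have "objective c a P B1 - objective c a P B0 = a / 2 * (LINT y|P. D y)"
    by (simp add: objective_def field_simps)
  moreover have "0 < a / 2 * (LINT y|P. D y)" using Dpos a by simp
  ultimately show ?thesis by linarith
qed

text \<open>
  Pairing the linearised equation with \<^term>\<open>H\<close> gives an integral of a Cauchy--Schwarz defect.
  Because of the positive constant \<^term>\<open>c\<close> in the denominators the defect is strict
  unless \<^term>\<open>H\<close> kills the observation.
\<close>

theorem critical_point_nondegenerate:
  fixes B0 :: "real ^ ('d::finite) option ^ 'd option"
  assumes P: "law P" "nondegenerate P" and c: "0 < c" and a: "0 < a"
    and B0: "B0 \<in> pos_def_mats" and crit: "score c a B0 (signed_of P) = 0"
    and H: "score_deriv c a B0 (signed_of P) H = 0"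
  shows "H = 0"
proof -
  obtain \<kappa> where \<kappa>: "0 < \<kappa>" "coercive \<kappa> B0" using pos_def_coercive[OF B0] by blast
  obtain G :: "real ^ 'd option ^ 'd option" where G: "invertible G" "B0 = transpose G ** G"
    using pos_def_factor[OF B0] by blast
  obtain F where F: "G ** F = mat 1" "F ** G = mat 1" using G(1) by (auto simp: invertible_def)
  define S where "S = weighted_moment c a B0 (signed_of P)"
  define S' where "S' = weighted_moment_deriv c a B0 (signed_of P) H"
  have BS: "B0 ** S = mat 1" using crit by (simp add: score_def S_def)
  then have SB: "S ** B0 = mat 1" by (simp add: matrix_left_right_inverse)
  have tS: "transpose S = S" unfolding S_def by (rule weighted_moment_symmetric)
  have tS': "transpose S' = S'" unfolding S'_def by (rule weighted_moment_deriv_symmetric)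
  have "H ** S + B0 ** S' = 0" using H by (simp add: score_deriv_def S_def S'_def)
  then have "S ** (H ** S) + S ** (B0 ** S') = S ** 0"
    by (metis matrix_add_ldistrib)
  then have S'_eq: "S' = - (S ** H ** S)"
    by (simp add: matrix_mul_assoc SB bounded_bilinear.zero_right[OF bounded_bilinear_matrix_mult] eq_neg_iff_add_eq_0 add.commute)
  \<comment> \<open>this makes \<open>H\<close> symmetric, as a congruence of the symmetric derivative of \<open>S\<close>\<close>
  have H_eq: "H = B0 ** (S ** H ** S) ** B0"
    by (metis BS SB matrix_mul_assoc matrix_mul_lid matrix_mul_rid)
  have tH: "transpose H = H"
  proof -
    have "transpose (S ** H ** S) = S ** H ** S"
      using tS' unfolding S'_eq by (simp add: vec_eq_iff transpose_def)
    then show ?thesis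
      by (metis H_eq matrix_mul_assoc matrix_transpose_mul pos_def_sym[OF B0])
  qed
  have tF: "transpose G ** transpose F = mat 1" using F(2) by (metis matrix_transpose_mul transpose_mat)
  have S_F: "S = F ** transpose F"
  proof -
    have "S ** transpose G ** (G ** F) = F" using SB G(2) by (simp add: matrix_mul_assoc)
    then have "S ** transpose G = F" by (simp add: F(1))
    then have "S ** (transpose G ** transpose F) = F ** transpose F" by (simp add: matrix_mul_assoc)
    then show ?thesis by (simp add: tF)
  qed
  have q1: "qf (H ** S ** H) y = (norm (transpose F *v (H *v augment y)))\<^sup>2" for y
  proof -
    have "H ** S ** H = transpose (transpose F ** H) ** mat 1 ** (transpose F ** H)"
      by (simp add: S_F matrix_transpose_mul tH matrix_mul_assoc)
    then show ?thesis
      unfolding qf_def by (simp only: quadratic_form_congruence) (simp add: matrix_vector_mul_assoc[symmetric] power2_norm_eq_inner del: transpose_matrix_vector)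
  qed
  have q0: "qf B0 y = (norm (G *v augment y))\<^sup>2" for y
    using quadratic_form_congruence[of "augment y" G "mat 1"] by (simp add: qf_def G(2) power2_norm_eq_inner)
  have cs: "(qf H y)\<^sup>2 \<le> qf B0 y * qf (H ** S ** H) y" for y
  proof -
    have "H = transpose G ** (transpose F ** H)" by (simp add: matrix_mul_assoc tF)
    then have "qf H y = (G *v augment y) \<bullet> (transpose F *v (H *v augment y))"
      unfolding qf_def by (metis inner_transpose matrix_vector_mul_assoc)
    then show ?thesis unfolding q0 q1 using Cauchy_Schwarz_ineq by (simp add: power2_norm_eq_inner)
  qed
  \<comment> \<open>the Cauchy--Schwarz defect\<close>
  define D where "D y = kernel c B0 [H ** S ** H] y - kernel c B0 [H, H] y" for y
  have u: "0 < c + qf B0 y" for y by (rule denominator_pos(2)[OF c \<kappa>])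
  have Dge: "c * qf (H ** S ** H) y / (c + qf B0 y)\<^sup>2 \<le> D y" for y
  proof -
    have "D y = (qf (H ** S ** H) y * (c + qf B0 y) - (qf H y)\<^sup>2) / (c + qf B0 y)\<^sup>2"
      unfolding D_def kernel_def using u[of y] by (simp add: power2_eq_square diff_divide_distrib)
    moreover have "c * qf (H ** S ** H) y \<le> qf (H ** S ** H) y * (c + qf B0 y) - (qf H y)\<^sup>2"
      using cs[of y] by (simp add: algebra_simps)
    ultimately show ?thesis by (simp add: divide_right_mono)
  qed
  have qnn: "0 \<le> qf (H ** S ** H) y" for y unfolding q1 by simp
  have Dnn: "0 \<le> D y" for y
    using Dge[of y] qnn[of y] c by (smt (verit) divide_nonneg_nonneg mult_nonneg_nonneg zero_le_power2)
  have intD: "integrable P D" unfolding D_def using law_J(2)[OF P(1) c \<kappa>] by simp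
  have "a * (LINT y|P. D y) = a * J c B0 [H ** S ** H] (signed_of P) - a * J c B0 [H, H] (signed_of P)"
    unfolding D_def law_J(1)[OF P(1) c \<kappa>] using law_J(2)[OF P(1) c \<kappa>] by (simp add: right_diff_distrib)
  also have "\<dots> = (H ** S ** H) \<bullet> S - H \<bullet> (S ** H ** S)"
    unfolding weighted_moment_inner[OF c \<kappa>] weighted_moment_deriv_inner[OF c \<kappa>] S_def[symmetric] S'_def[symmetric]
    by (simp add: S'_eq)
  also have "(H ** S ** H) \<bullet> S = (H ** S) \<bullet> (S ** H)" by (simp add: inner_matrix_mult_right tH)
  also have "H \<bullet> (S ** H ** S) = (H ** S) \<bullet> (S ** H)" by (simp add: inner_matrix_mult_right tS)
  finally have "(LINT y|P. D y) = 0" using a by simp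
  then have "AE y in P. D y = 0" using integral_nonneg_eq_0_iff_AE[OF intD] Dnn by simp
  then have ae: "AE y in P. H *v augment y = 0"
  proof eventually_elim
    case (elim y)
    have "c * qf (H ** S ** H) y / (c + qf B0 y)\<^sup>2 \<le> 0" using Dge[of y] elim by simp
    then have "qf (H ** S ** H) y = 0"
      using qnn[of y] c u[of y] by (simp add: divide_le_0_iff mult_le_0_iff)
    then have "transpose F *v (H *v augment y) = 0" by (simp add: q1 del: transpose_matrix_vector)
    then have "transpose G *v (transpose F *v (H *v augment y)) = 0" by (simp del: transpose_matrix_vector)
    then show "H *v augment y = 0"
      by (simp only: matrix_vector_mul_assoc matrix_mul_assoc tF matrix_mul_lid)
  qed
  show "H = 0"
  proof (rule ccontr)
    assume "H \<noteq> 0"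
    then obtain i where "H $ i \<noteq> 0" by (auto simp: vec_eq_iff)
    moreover have "AE y in P. H $ i \<bullet> augment y = 0"
      using ae by eventually_elim (metis matrix_vector_mul_component zero_index)
    ultimately show False using P(2) by (auto simp: nondegenerate_def)
  qed
qed

text \<open>
  A quadratic that dominates the increments at a minimum has no linear term, since a small step against
  the sign of that term would make it negative.
\<close>

lemma linear_coefficient_zero:
  fixes A K :: real
  assumes "\<And>t. \<bar>t\<bar> < 1 / 2 \<Longrightarrow> 0 \<le> t * A + t\<^sup>2 * K" shows "A = 0"
proof (rule ccontr)
  assume A: "A \<noteq> 0"
  define s where "s = min (1 / 4) (\<bar>A\<bar> / (2 * (\<bar>K\<bar> + 1)))"
  have s: "0 < s" "s < 1 / 2" using A by (auto simp: s_def)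
  have "s * (\<bar>K\<bar> + 1) \<le> \<bar>A\<bar> / (2 * (\<bar>K\<bar> + 1)) * (\<bar>K\<bar> + 1)" unfolding s_def by (intro mult_right_mono) auto
  also have "\<dots> = \<bar>A\<bar> / 2" by (simp add: field_simps)
  finally have sK: "s * (\<bar>K\<bar> + 1) \<le> \<bar>A\<bar> / 2" .
  have "s * K \<le> s * (\<bar>K\<bar> + 1)" using s by (intro mult_left_mono) auto
  \<comment> \<open>a small step against the sign of the linear coefficient\<close>
  define t where "t = - sgn A * s"
  have t: "\<bar>t\<bar> < 1 / 2" "t * A = - s * \<bar>A\<bar>" "t\<^sup>2 = s * s"
    using A s by (auto simp: t_def abs_mult abs_sgn_eq sgn_if power2_eq_square)
  have "0 \<le> s * (s * K - \<bar>A\<bar>)" using assms[OF t(1)] t(2,3) by (simp add: algebra_simps)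
  then have "\<bar>A\<bar> \<le> s * K" using s(1) by (simp add: zero_le_mult_iff)
  also have "\<dots> \<le> \<bar>A\<bar> / 2" using sK \<open>s * K \<le> s * (\<bar>K\<bar> + 1)\<close> by linarith
  finally show False using A by simp
qed

lemma det_elementary: "det (mat 1 + t *\<^sub>R matrix_unit p q :: real ^ 'n ^ 'n) = 1 + (if p = q then t else 0)"
proof (cases "p = q")
  case True
  have "mat 1 + t *\<^sub>R matrix_unit p q = diag (\<lambda>i. if i = p then 1 + t else 1)"
    using True by (auto simp: vec_eq_iff mat_def diag_def matrix_unit_nth)
  then show ?thesis using True by (simp add: det_diag)
next
  case False
  have "mat 1 + t *\<^sub>R matrix_unit p q = (\<chi> k. if k = p then row p (mat 1) + t *s row q (mat 1) else row k (mat 1 :: real ^ 'n ^ 'n))"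
    by (auto simp: vec_eq_iff mat_def row_def matrix_unit_nth)
  then show ?thesis using det_row_operation[OF False, of "mat 1" t] False by simp
qed

text \<open>
  Elementary congruences \<open>(1 + t e\<^sub>p e\<^sub>q')\<close> keep the matrix positive definite and change its
  determinant in a trivial way. The logarithm lies below its tangents, so the increment of the
  objective is at most an explicit quadratic in \<^term>\<open>t\<close>, whose linear coefficient is an entry of
  the critical equation.
\<close>

theorem minimum_is_critical:
  fixes B :: "real ^ ('d::finite) option ^ 'd option"
  assumes P: "law P" and c: "0 < c" and a: "0 < a" and B: "B \<in> pos_def_mats"
    and min: "\<And>A. A \<in> pos_def_mats \<Longrightarrow> objective c a P B \<le> objective c a P A"
  shows "score c a B (signed_of P) = 0"
proof -
  obtain \<kappa> where \<kappa>: "0 < \<kappa>" "coercive \<kappa> B" using pos_def_coercive[OF B] by blast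
  define S where "S = weighted_moment c a B (signed_of P)"
  have u: "0 < c + qf B y" for y by (rule denominator_pos(2)[OF c \<kappa>])
  have entry: "(S ** B) $ q $ p = (if p = q then 1 else 0)" for p q
  proof -
    let ?X = "matrix_unit q p ** B"
    let ?Y = "B $ p $ p *\<^sub>R matrix_unit q q"
    define g k where "g = (LINT y|P. kernel c B [?X] y)" and "k = (LINT y|P. kernel c B [?Y] y)"
    define d :: real where "d = (if p = q then 1 else 0)"
    have "0 \<le> t * (a * g - d) + t\<^sup>2 * (2 + a / 2 * k)" if t: "\<bar>t\<bar> < 1 / 2" for t
    proof -
      define E where "E = mat 1 + t *\<^sub>R (matrix_unit p q :: real ^ 'd option ^ 'd option)"
      have detE: "det E = 1 + d * t" unfolding E_def det_elementary d_def by simp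
      have detE_pos: "0 < det E" unfolding detE d_def using t by auto
      then have "invertible E" by (simp add: invertible_det_nz)
      define A where "A = transpose E ** B ** E"
      have A: "A \<in> pos_def_mats" unfolding A_def by (rule congruence_pos_def[OF B \<open>invertible E\<close>])
      have Ev: "E *v x = x + (t * x $ q) *\<^sub>R axis p 1" for x
      proof -
        have "matrix_unit p q *v x = x $ q *\<^sub>R axis p 1"
          by (auto simp: vec_eq_iff matrix_vector_mult_def matrix_unit_nth axis_def if_distrib[of "\<lambda>x. x * _"] cong: if_cong)
        then show ?thesis
          by (simp add: E_def matrix_vector_mult_add_rdistrib scaleR_matrix_vector_assoc[symmetric])
      qed
      have Xq: "qf ?X y = augment y $ q * (B *v augment y) $ p" for y
      proof -
        have "matrix_unit q p *v x = x $ p *\<^sub>R axis q 1" for x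
          by (auto simp: vec_eq_iff matrix_vector_mult_def matrix_unit_nth axis_def if_distrib[of "\<lambda>x. x * _"] cong: if_cong)
        then show ?thesis by (simp add: qf_def matrix_vector_mul_assoc[symmetric] inner_axis mult.commute)
      qed
      have Yq: "qf ?Y y = B $ p $ p * (augment y $ q)\<^sup>2" for y
        by (simp add: qf_scale qf_matrix_unit power2_eq_square)
      have Aq: "qf A y = qf B y + 2 * t * qf ?X y + t\<^sup>2 * qf ?Y y" for y
      proof -
        have Bp: "axis p 1 \<bullet> (B *v z) = (B *v z) $ p" for z by (simp add: inner_axis')
        have sB: "z \<bullet> (B *v axis p 1) = (B *v z) $ p" for z
          using inner_transpose[of z B "axis p 1"] pos_def_sym[OF B] by (simp add: inner_axis)
        have "(B *v axis p 1) $ p = B $ p $ p"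
          by (simp add: matrix_vector_mul_component inner_axis)
        moreover have "qf A y = (E *v augment y) \<bullet> (B *v (E *v augment y))"
          by (simp only: qf_def A_def quadratic_form_congruence)
        ultimately show ?thesis
          unfolding Ev Xq Yq
          by (simp add: matrix_vector_right_distrib matrix_vector_mult_scaleR inner_simps Bp sB qf_def power2_eq_square algebra_simps)
      qed
      have lr: "log_ratio c A y - log_ratio c B y \<le> 2 * t * kernel c B [?X] y + t\<^sup>2 * kernel c B [?Y] y" for y
      proof -
        obtain \<kappa>' where \<kappa>': "0 < \<kappa>'" "coercive \<kappa>' A" using pos_def_coercive[OF A] by blast
        have uA: "0 < c + qf A y" by (rule denominator_pos(2)[OF c \<kappa>'])
        have s: "0 < c + (norm (augment y))\<^sup>2" using c by (simp add: add_pos_nonneg)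
        have "log_ratio c A y - log_ratio c B y = ln (c + qf A y) - ln (c + qf B y)"
          unfolding log_ratio_def using s uA u[of y] by (simp add: ln_div)
        also have "\<dots> \<le> ((c + qf A y) - (c + qf B y)) / (c + qf B y)"
          by (rule ln_diff_le[OF uA u])
        also have "\<dots> = 2 * t * kernel c B [?X] y + t\<^sup>2 * kernel c B [?Y] y"
          unfolding Aq kernel_def by (simp add: add_divide_distrib)
        finally show ?thesis .
      qed
      note i = integrable_log_ratio[OF P c A] integrable_log_ratio[OF P c B] law_J(2)[OF P c \<kappa>, of "[?X]"] law_J(2)[OF P c \<kappa>, of "[?Y]"]
      have "(LINT y|P. log_ratio c A y) - (LINT y|P. log_ratio c B y) = (LINT y|P. log_ratio c A y - log_ratio c B y)"
        using i by simp
      also have "\<dots> \<le> (LINT y|P. 2 * t * kernel c B [?X] y + t\<^sup>2 * kernel c B [?Y] y)"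
        using i lr by (intro integral_mono) auto
      also have "\<dots> = 2 * t * g + t\<^sup>2 * k" unfolding g_def k_def using i by simp
      finally have I: "(LINT y|P. log_ratio c A y) - (LINT y|P. log_ratio c B y) \<le> 2 * t * g + t\<^sup>2 * k" .
      have "det A = (det E)\<^sup>2 * det B" by (simp add: A_def det_mul power2_eq_square)
      then have "ln (det A) = 2 * ln (1 + d * t) + ln (det B)"
        using detE_pos pos_def_det_pos[OF B] by (simp add: ln_mult ln_realpow detE)
      then have "0 \<le> - ln (1 + d * t) + a / 2 * (2 * t * g + t\<^sup>2 * k)"
      proof -
        have "a / 2 * (LINT y|P. log_ratio c A y) - a / 2 * (LINT y|P. log_ratio c B y) \<le> a / 2 * (2 * t * g + t\<^sup>2 * k)"
          unfolding right_diff_distrib[symmetric] using a by (intro mult_left_mono I) simp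
        moreover assume "ln (det A) = 2 * ln (1 + d * t) + ln (det B)"
        ultimately show ?thesis using min[OF A] unfolding objective_def by linarith
      qed
      moreover have "d * t - 2 * t\<^sup>2 \<le> ln (1 + d * t)"
      proof (cases "0 \<le> t")
        case True
        then have "t - t\<^sup>2 \<le> ln (1 + t)" using ln_one_plus_pos_lower_bound[of t] t by simp
        then have "t - 2 * t\<^sup>2 \<le> ln (1 + t)" using zero_le_power2[of t] by linarith
        then show ?thesis by (simp add: d_def)
      next
        case False
        then show ?thesis using ln_one_minus_pos_lower_bound[of "- t"] t by (simp add: d_def)
      qed
      ultimately show ?thesis by (simp add: algebra_simps)
    qed
    then have "a * g - d = 0" by (rule linear_coefficient_zero)
    moreover have "a * g = ?X \<bullet> S"
      using weighted_moment_inner[OF c \<kappa>, of a ?X "signed_of P"] law_J(1)[OF P c \<kappa>] by (simp add: S_def g_def)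
    moreover have "?X \<bullet> S = (S ** B) $ q $ p"
      by (simp add: inner_matrix_mult_right pos_def_sym[OF B] inner_matrix_unit)
    ultimately show ?thesis by (simp add: d_def)
  qed
  then have "S ** B = mat 1" by (auto simp: vec_eq_iff mat_def)
  then have "B ** S = mat 1" by (simp add: matrix_left_right_inverse)
  then show ?thesis by (simp add: score_def S_def)
qed

section \<open>Coercivity of the scatter objective\<close>

lemma affine_augment_hyperplanes: "affine {y. \<forall>i\<in>I. u i \<bullet> augment y = 0}"
proof -
  have "augment (s *\<^sub>R x + t *\<^sub>R y) = s *\<^sub>R augment x + t *\<^sub>R augment y" if "s + t = 1" for s t and x y :: "real ^ 'a"
    using that by (auto simp: vec_eq_iff augment_def split: option.split)
  then show ?thesis unfolding affine_def by (auto simp: inner_simps)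
qed

lemma linear_image_card:
  assumes "pairwise (\<lambda>i j. orthogonal (u i) (u j)) I" "\<And>i. i \<in> I \<Longrightarrow> norm (u i) = 1" "finite I"
  shows "dim (u ` I :: 'a::euclidean_space set) = card I"
proof -
  have "inj_on u I"
  proof (rule inj_onI, rule ccontr)
    fix i j assume "i \<in> I" "j \<in> I" "u i = u j" "i \<noteq> j"
    then have "u i \<bullet> u j = 0" using assms(1) unfolding pairwise_def orthogonal_def by blast
    then have "u i = 0" using \<open>u i = u j\<close> by simp
    then show False using assms(2)[OF \<open>i \<in> I\<close>] by simp
  qed
  moreover have "pairwise orthogonal (u ` I)"
    using assms(1) by (auto simp: pairwise_def)
  then have "independent (u ` I)" using assms(2) by (intro pairwise_orthogonal_independent) force+
  ultimately show ?thesis by (simp add: dim_eq_card_independent card_image)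
qed

definition lin_augment :: "real ^ 'd \<Rightarrow> real ^ ('d::finite) option" where
  "lin_augment y = (\<chi> i. case i of None \<Rightarrow> 0 | Some j \<Rightarrow> y $ j)"

lemma augment_lin_augment: "augment y = axis None 1 + lin_augment y"
  by (auto simp: vec_eq_iff augment_def lin_augment_def axis_def split: option.split)

text \<open>
  Augmentation is an injective linear map followed by a translation.
\<close>

lemma aff_dim_augment_image: "aff_dim (augment ` Y) = aff_dim Y"
proof -
  have "linear lin_augment"
    by (rule linearI) (auto simp: vec_eq_iff lin_augment_def split: option.split)
  moreover have "inj lin_augment"
    by (rule injI) (metis (no_types, lifting) lin_augment_def option.simps(5) vec_eq_iff vec_lambda_beta)
  ultimately have "aff_dim (lin_augment ` Y) = aff_dim Y" by (rule aff_dim_injective_linear_image)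
  moreover have "augment ` Y = (+) (axis None 1) ` lin_augment ` Y" by (auto simp: augment_lin_augment)
  ultimately show ?thesis by (simp only: aff_dim_translation_eq)
qed

text \<open>
  The points whose augmentation is orthogonal to \<^term>\<open>card I\<close> orthonormal vectors form an affine
  subspace. Its augmentation avoids the origin, so adding the origin raises the dimension by one; this
  turns the codimension in the larger space into the bound of the class of laws.
\<close>

lemma V_laws_subspace_mass:
  fixes P :: "(real ^ 'd) measure"
  assumes P: "P \<in> V_laws a" and a: "real CARD('d option) < a"
    and on: "pairwise (\<lambda>i j. orthogonal (u i) (u j)) I" "\<And>i. i \<in> I \<Longrightarrow> norm (u i) = 1"
    and I: "finite I" "I \<noteq> {}" "card I \<le> CARD('d option)"
  shows "measure P {y. \<forall>i\<in>I. u i \<bullet> augment y = 0} < 1 - real (card I) / a"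
proof -
  define Y where "Y = {y :: real ^ 'd. \<forall>i\<in>I. u i \<bullet> augment y = 0}"
  have a0: "0 < a" using a by (simp add: order_le_less_trans[of 0])
  show ?thesis
  proof (cases "Y = {}")
    case True
    have "real (card I) < a" using I(3) a by (meson of_nat_le_iff order_le_less_trans)
    moreover have "{y. \<forall>i\<in>I. u i \<bullet> augment y = 0} = {}" using True unfolding Y_def .
    ultimately show ?thesis using a0 by (simp only: measure_empty) (simp add: divide_simps)
  next
    case False
    define V where "V = {x :: real ^ 'd option. \<forall>i\<in>I. u i \<bullet> x = 0}"
    have sV: "subspace V" unfolding V_def subspace_def by (auto simp: inner_simps)
    have "dim {y \<in> UNIV. \<forall>x\<in>span (u ` I). orthogonal x y} + dim (span (u ` I)) = dim (UNIV :: (real ^ 'd option) set)"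
      by (rule dim_subspace_orthogonal_to_vectors) auto
    moreover have "{y \<in> UNIV. \<forall>x\<in>span (u ` I). orthogonal x y} = V"
    proof (intro equalityI subsetI)
      fix y assume y: "y \<in> V"
      have "orthogonal y x" if "x \<in> span (u ` I)" for x
        by (rule orthogonal_to_span[OF that]) (use y in \<open>auto simp: V_def orthogonal_def inner_commute\<close>)
      then show "y \<in> {y \<in> UNIV. \<forall>x\<in>span (u ` I). orthogonal x y}" by (simp add: orthogonal_commute)
    qed (auto simp: V_def orthogonal_def span_base)
    ultimately have dV: "dim V + card I = CARD('d) + 1"
      using linear_image_card[OF on I(1)] by simp
    have "0 \<notin> affine hull (augment ` Y)"
    proof
      assume 0: "0 \<in> affine hull (augment ` Y)"
      have "affine {x :: real ^ 'd option. x $ None = 1}" by (auto simp: affine_def)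
      then have "affine hull (augment ` Y) \<subseteq> {x. x $ None = 1}" by (intro hull_minimal) auto
      then show False using 0 by auto
    qed
    then have "aff_dim (insert 0 (augment ` Y)) = aff_dim Y + 1"
      by (simp add: aff_dim_insert aff_dim_augment_image)
    moreover have "aff_dim (insert 0 (augment ` Y)) \<le> aff_dim V"
      by (rule aff_dim_subset) (auto simp: V_def Y_def)
    ultimately have le: "aff_dim Y + 1 \<le> int (dim V)" by (simp add: aff_dim_subspace[OF sV])
    have "0 \<le> aff_dim Y" using False aff_dim_negative_iff[of Y] by linarith
    then obtain q where q: "aff_dim Y = int q" using nonneg_int_cases by blast
    have qd: "q + card I \<le> CARD('d)" using le q dV by linarith
    have "card I > 0" using I(1,2) by (simp add: card_gt_0_iff)
    then have "measure P Y < 1 - (real CARD('d) - real q) / a"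
      using P qd q affine_augment_hyperplanes[of I u] unfolding V_laws_def Y_def by auto
    also have "\<dots> \<le> 1 - real (card I) / a"
      using qd a0 by (simp add: divide_right_mono)
    finally show ?thesis unfolding Y_def .
  qed
qed

lemma V_laws_nondegenerate:
  fixes P :: "(real ^ 'd) measure"
  assumes P: "P \<in> V_laws a" and a: "real CARD('d option) < a"
  shows "nondegenerate P"
  unfolding nondegenerate_def
proof (intro allI impI notI)
  fix u :: "real ^ 'd option" assume u: "u \<noteq> 0" and ae: "AE y in P. u \<bullet> augment y = 0"
  interpret prob_space P using P by (simp add: V_laws_def law_def)
  have sP: "sets P = sets borel" using P by (simp add: V_laws_def law_def)
  have sp: "space P = UNIV" using sets_eq_imp_space_eq[OF sP] by simp
  have "measure P {y. \<forall>i\<in>{()}. (1 / norm u) *\<^sub>R u \<bullet> augment y = 0} < 1 - real (card {()}) / a"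
    using u by (intro V_laws_subspace_mass[OF P a]) (auto simp: pairwise_def)
  moreover have "{y. \<forall>i\<in>{()}. (1 / norm u) *\<^sub>R u \<bullet> augment y = 0} = {y \<in> space P. u \<bullet> augment y = 0}"
    using u by (auto simp: sp)
  moreover have "closed {y. u \<bullet> augment y = 0}"
    by (intro closed_Collect_eq continuous_on_inner continuous_on_const continuous_augment)
  then have "{y \<in> space P. u \<bullet> augment y = 0} \<in> sets P" by (simp add: sp sP)
  then have "prob {y \<in> space P. u \<bullet> augment y = 0} = 1" using ae by (simp add: prob_Collect_eq_1)
  moreover have "0 < a" using a by (simp add: order_le_less_trans[of 0])
  ultimately show False by simp
qed

lemma compact_orthogonal_matrices: "compact {Q :: real ^ 'n ^ 'n. Q ** transpose Q = mat 1}"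
  unfolding compact_eq_bounded_closed
proof
  have "norm Q \<le> real CARD('n) * real CARD('n) * 1" if Q: "Q ** transpose Q = mat 1" for Q :: "real ^ 'n ^ 'n"
  proof (rule norm_matrix_le_entries)
    fix i j
    have "Q $ i \<bullet> Q $ i = (Q ** transpose Q) $ i $ i" by (simp add: matrix_matrix_mult_def transpose_def inner_vec_def)
    then have "norm (Q $ i) = 1" by (simp add: Q mat_def norm_eq_1)
    then show "\<bar>Q $ i $ j\<bar> \<le> 1" using component_le_norm_cart[of "Q $ i" j] by simp
  qed
  then show "bounded {Q :: real ^ 'n ^ 'n. Q ** transpose Q = mat 1}" unfolding bounded_iff by blast
  have "continuous_on UNIV (transpose :: real ^ 'n ^ 'n \<Rightarrow> _)"
    unfolding transpose_def by (intro continuous_intros)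
  then show "closed {Q :: real ^ 'n ^ 'n. Q ** transpose Q = mat 1}"
    by (intro closed_Collect_eq bounded_bilinear.continuous_on[OF bounded_bilinear_matrix_mult]) auto
qed

lemma orthogonal_matrix_rows:
  fixes Q :: "real ^ 'n ^ 'n"
  assumes "Q ** transpose Q = mat 1"
  shows "pairwise (\<lambda>i j. orthogonal (Q $ i) (Q $ j)) I" "norm (Q $ i) = 1"
proof -
  have "Q $ i \<bullet> Q $ j = (Q ** transpose Q) $ i $ j" for i j by (simp add: matrix_matrix_mult_def transpose_def inner_vec_def)
  then show "pairwise (\<lambda>i j. orthogonal (Q $ i) (Q $ j)) I" "norm (Q $ i) = 1"
    by (auto simp: assms mat_def orthogonal_def pairwise_def norm_eq_1)
qed

text \<open>
  The observations making a small angle with the orthogonal complement of some rows of an orthogonal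
  matrix.
\<close>

definition thin :: "real \<Rightarrow> real ^ ('d::finite) option ^ 'd option \<Rightarrow> 'd option set \<Rightarrow> (real ^ 'd) set" where
  "thin \<delta> Q I = {y. \<forall>i\<in>I. \<bar>(Q *v augment y) $ i\<bar> < \<delta> * norm (augment y)}"

lemma thin_sets: "thin \<delta> Q I \<in> sets borel"
proof -
  have "(\<lambda>y. (Q *v augment y) $ i) \<in> borel_measurable borel" for i
    by (intro borel_measurable_continuous_onI continuous_on_component linear_continuous_on_compose[OF continuous_augment] matrix_vector_mul_linear)
  then have [measurable]: "{y. \<bar>(Q *v augment y) $ i\<bar> < \<delta> * norm (augment y)} \<in> sets borel" for i by measurable
  have "thin \<delta> Q I = (\<Inter>i\<in>I. {y. \<bar>(Q *v augment y) $ i\<bar> < \<delta> * norm (augment y)})" by (auto simp: thin_def)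
  then show ?thesis by (cases "I = {}") (auto intro!: sets.finite_INT)
qed

lemma thin_mono: "\<delta> \<le> \<delta>' \<Longrightarrow> thin \<delta> Q I \<subseteq> thin \<delta>' Q I"
  unfolding thin_def using mult_right_mono[of \<delta> \<delta>' "norm (augment _)"] by (force intro: less_le_trans)

text \<open>
  Otherwise there are orthogonal matrices and widths tending to 0 that violate the bound. Along a
  convergent subsequence the limes superior of the thin sets lies in a subspace that has too much
  mass.
\<close>

lemma thin_mass_fixed:
  fixes P :: "(real ^ 'd) measure"
  assumes P: "P \<in> V_laws a" and a: "real CARD('d option) < a" and I: "I \<noteq> {}"
  shows "\<exists>e>0. \<forall>Q. Q ** transpose Q = mat 1 \<longrightarrow> measure P (thin e Q I) \<le> 1 - real (card I) / a - e"
proof (rule ccontr)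
  assume neg: "\<not> ?thesis"
  interpret prob_space P using P by (simp add: V_laws_def law_def)
  have sP: "sets P = sets borel" using P by (simp add: V_laws_def law_def)
  define e where "e n = 1 / real (Suc n)" for n
  have "\<exists>Q. Q ** transpose Q = mat 1 \<and> 1 - real (card I) / a - e n < measure P (thin (e n) Q I)" for n
    using neg[unfolded not_ex, rule_format, of "e n"] by (auto simp: e_def not_le)
  then obtain Q where Q: "\<And>n. Q n ** transpose (Q n) = mat 1"
    "\<And>n. 1 - real (card I) / a - e n < measure P (thin (e n) (Q n) I)" by metis
  obtain Q0 r where Q0: "Q0 ** transpose Q0 = mat 1" and r: "strict_mono r" "(Q \<circ> r) \<longlonglongrightarrow> Q0"
    using compact_orthogonal_matrices[unfolded compact_def, rule_format, of Q] Q(1) by auto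
  define A where "A n = thin (e (r n)) (Q (r n)) I" for n
  have A: "A n \<in> sets P" for n by (simp add: A_def sP thin_sets)
  \<comment> \<open>the limes superior of the thin sets, as a decreasing intersection\<close>
  define C where "C m = (\<Union>n\<in>{m..}. A n)" for m
  have C: "C m \<in> sets P" for m unfolding C_def using A by auto
  have e0: "e \<longlonglongrightarrow> 0" unfolding e_def by (rule LIMSEQ_inverse_real_of_nat[unfolded inverse_eq_divide])
  then have er0: "(\<lambda>n. e (r n)) \<longlonglongrightarrow> 0" using LIMSEQ_subseq_LIMSEQ[OF e0 r(1)] by (simp add: comp_def)
  have "(\<Inter>m. C m) \<subseteq> {y. \<forall>i\<in>I. Q0 $ i \<bullet> augment y = 0}"
  proof (clarify, rule ccontr)
    fix y i assume y: "y \<in> (\<Inter>m. C m)" and i: "i \<in> I" and nz: "Q0 $ i \<bullet> augment y \<noteq> 0"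
    have "(\<lambda>n. \<bar>Q (r n) $ i \<bullet> augment y\<bar> - e (r n) * norm (augment y)) \<longlonglongrightarrow> \<bar>Q0 $ i \<bullet> augment y\<bar> - 0 * norm (augment y)"
      using r(2) unfolding comp_def by (intro tendsto_intros er0)
    then have "\<forall>\<^sub>F n in sequentially. 0 < \<bar>Q (r n) $ i \<bullet> augment y\<bar> - e (r n) * norm (augment y)"
      by (rule order_tendstoD(1)) (use nz in simp)
    then obtain m where m: "\<And>n. n \<ge> m \<Longrightarrow> e (r n) * norm (augment y) < \<bar>Q (r n) $ i \<bullet> augment y\<bar>"
      by (auto simp: eventually_sequentially)
    obtain n where "n \<ge> m" "y \<in> A n" using y by (auto simp: C_def)
    then show False using m[OF \<open>n \<ge> m\<close>] i by (auto simp: A_def thin_def matrix_vector_mul_component)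
  qed
  moreover have "closed (\<Inter>i\<in>I. {y. Q0 $ i \<bullet> augment y = 0})"
    by (intro closed_INT ballI closed_Collect_eq continuous_on_inner continuous_on_const continuous_augment)
  then have "closed {y. \<forall>i\<in>I. Q0 $ i \<bullet> augment y = 0}" by (rule back_subst[of closed]) auto
  ultimately have le: "measure P (\<Inter>m. C m) \<le> measure P {y. \<forall>i\<in>I. Q0 $ i \<bullet> augment y = 0}"
    by (intro finite_measure_mono) (auto simp: sP)
  have "(\<lambda>m. measure P (C m)) \<longlonglongrightarrow> measure P (\<Inter>m. C m)"
  proof (rule finite_Lim_measure_decseq)
    show "range C \<subseteq> sets P" using C by auto
    show "decseq C" unfolding decseq_def C_def by (intro allI impI UN_mono) auto
  qed
  moreover have "(\<lambda>m. 1 - real (card I) / a - e (r m)) \<longlonglongrightarrow> 1 - real (card I) / a - 0"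
    by (intro tendsto_intros er0)
  moreover have "1 - real (card I) / a - e (r m) \<le> measure P (C m)" for m
  proof -
    have "measure P (A m) \<le> measure P (C m)" by (intro finite_measure_mono C) (auto simp: C_def)
    then show ?thesis using Q(2)[of "r m"] by (simp add: A_def)
  qed
  ultimately have "1 - real (card I) / a - 0 \<le> measure P (\<Inter>m. C m)" by (intro LIMSEQ_le) auto
  moreover have "measure P {y. \<forall>i\<in>I. Q0 $ i \<bullet> augment y = 0} < 1 - real (card I) / a"
    by (intro V_laws_subspace_mass[OF P a] orthogonal_matrix_rows Q0 I card_mono finite subset_UNIV)
  ultimately show False using le by simp
qed

lemma thin_mass:
  fixes P :: "(real ^ 'd) measure"
  assumes P: "P \<in> V_laws a" and a: "real CARD('d option) < a"
  shows "\<exists>e>0. \<forall>Q I. Q ** transpose Q = mat 1 \<longrightarrow> I \<noteq> {} \<longrightarrow> measure P (thin e Q I) \<le> 1 - real (card I) / a - e"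
proof -
  interpret prob_space P using P by (simp add: V_laws_def law_def)
  have sP: "sets P = sets borel" using P by (simp add: V_laws_def law_def)
  have "\<forall>I. \<exists>e>0. I \<noteq> {} \<longrightarrow> (\<forall>Q. Q ** transpose Q = mat 1 \<longrightarrow> measure P (thin e Q I) \<le> 1 - real (card I) / a - e)"
    using thin_mass_fixed[OF P a] zero_less_one by metis
  then obtain e where e: "\<And>I. 0 < e I"
    "\<And>I Q. I \<noteq> {} \<Longrightarrow> Q ** transpose Q = mat 1 \<Longrightarrow> measure P (thin (e I) Q I) \<le> 1 - real (card I) / a - e I" by metis
  define E where "E = Min (range e)"
  have E: "E \<le> e I" for I unfolding E_def by (rule Min_le) auto
  have "measure P (thin E Q I) \<le> 1 - real (card I) / a - E" if "Q ** transpose Q = mat 1" "I \<noteq> {}" for Q I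
  proof -
    have "measure P (thin E Q I) \<le> measure P (thin (e I) Q I)"
      by (intro finite_measure_mono thin_mono E) (simp add: sP thin_sets)
    then show ?thesis using e(2)[OF that(2,1)] E[of I] by linarith
  qed
  moreover have "0 < E" unfolding E_def using e(1) by simp
  ultimately show ?thesis by blast
qed

lemma norm_augment_tail:
  fixes P :: "(real ^ 'd) measure"
  assumes P: "law P" and e: "0 < e"
  shows "\<exists>R\<ge>0. measure P {y. R < norm (augment y)} < e"
proof -
  interpret prob_space P using P by (simp add: law_def)
  have sP: "sets P = sets borel" using P by (simp add: law_def)
  have "(\<lambda>n. measure P {y. real n < norm (augment y)}) \<longlonglongrightarrow> measure P (\<Inter>n. {y. real n < norm (augment y)})"
  proof (rule finite_Lim_measure_decseq)
    show "range (\<lambda>n. {y. real n < norm (augment y)}) \<subseteq> sets P" by (auto simp: sP)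
    show "decseq (\<lambda>n. {y. real n < norm (augment y)})" unfolding decseq_def by auto
  qed
  moreover have "(\<Inter>n. {y :: real ^ 'd. real n < norm (augment y)}) = {}"
  proof (intro equals0I)
    fix y :: "real ^ 'd" assume y: "y \<in> (\<Inter>n. {y. real n < norm (augment y)})"
    obtain n where "norm (augment y) < real n" using reals_Archimedean2 by blast
    moreover have "real n < norm (augment y)" using y by simp
    ultimately show False by simp
  qed
  ultimately have "(\<lambda>n. measure P {y. real n < norm (augment y)}) \<longlonglongrightarrow> 0" by simp
  then have "\<forall>\<^sub>F n in sequentially. measure P {y. real n < norm (augment y)} < e"
    using e by (rule order_tendstoD(2))
  then obtain n where "measure P {y. real n < norm (augment y)} < e" by (auto simp: eventually_sequentially)
  then show ?thesis by (intro exI[of _ "real n"]) simp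
qed

text \<open>
  An observation outside the thin set of the eigenvectors with large eigenvalues contributes the
  logarithm of such an eigenvalue to the integral. Layer by layer, at height \<^term>\<open>t\<close> these
  observations have mass greater than \<^term>\<open>1 / a\<close> times the number of eigenvalues whose logarithm
  exceeds \<^term>\<open>t\<close>, so the integral outweighs the determinant with a margin proportional to the
  largest logarithm. Small eigenvalues only matter for the few observations of large norm; for the
  others the constant \<^term>\<open>c\<close> bounds the integrand from below.
\<close>

lemma scatter_coercive:
  fixes P :: "(real ^ 'd) measure"
  assumes P: "P \<in> V_laws a" and c: "0 < c" and a: "real CARD('d option) < a"
  shows "\<exists>\<epsilon>>0. \<exists>C. \<forall>(Q :: real ^ 'd option ^ 'd option) l. transpose Q ** Q = mat 1 \<longrightarrow> Q ** transpose Q = mat 1 \<longrightarrow>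
    (\<forall>i. 0 < l i) \<longrightarrow> (\<forall>i. \<epsilon> * \<bar>ln (l i)\<bar> - C \<le> objective c a P (transpose Q ** diag l ** Q))"
proof -
  interpret prob_space P using P by (simp add: V_laws_def law_def)
  have law: "law P" using P by (simp add: V_laws_def)
  have sP: "sets P = sets borel" using law by (simp add: law_def)
  have sp: "space P = UNIV" using sets_eq_imp_space_eq[OF sP] by simp
  have a0: "0 < a" using a by (simp add: order_le_less_trans[of 0])
  obtain e where e: "0 < e" "\<And>(Q :: real ^ 'd option ^ 'd option) I. Q ** transpose Q = mat 1 \<Longrightarrow> I \<noteq> {} \<Longrightarrow>
      measure P (thin e Q I) \<le> 1 - real (card I) / a - e"
    using thin_mass[OF P a] by blast
  obtain R where R: "0 \<le> R" "measure P {y. R < norm (augment y)} < 1 / (2 * a)"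
    using norm_augment_tail[OF law, of "1 / (2 * a)"] a0 by auto
  \<comment> \<open>so little mass that it cannot spoil the gain of the determinant from small eigenvalues\<close>
  define far where "far = {y :: real ^ 'd. R < norm (augment y)}"
  have farm: "far \<in> sets P" unfolding far_def sP by measurable
  define C0 where "C0 = \<bar>ln (e\<^sup>2 / (c + 1))\<bar> + \<bar>ln (c / (c + R\<^sup>2))\<bar> + \<bar>ln (1 / (c + 1))\<bar>"
  define \<epsilon> where "\<epsilon> = min (a * e) (1 / 2) / 2"
  have "\<epsilon> * \<bar>ln (l j)\<bar> - a * C0 / 2 \<le> objective c a P (transpose Q ** diag l ** Q)"
    if QQ: "transpose Q ** Q = mat 1" "Q ** transpose Q = mat 1" and l: "\<And>i. 0 < l i"
    for Q :: "real ^ 'd option ^ 'd option" and l j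
  proof -
    define B where "B = transpose Q ** diag l ** Q"
    have B: "B \<in> pos_def_mats"
    proof -
      have "diag l \<in> pos_def_mats"
        unfolding pos_def_mats_def
      proof (intro CollectI conjI allI impI)
        show "transpose (diag l) = diag l" by (auto simp: diag_def transpose_def vec_eq_iff)
        fix x :: "real ^ 'd option" assume "x \<noteq> 0"
        then obtain i where "x $ i \<noteq> 0" by (auto simp: vec_eq_iff)
        then have "0 < l i * (x $ i)\<^sup>2" using l by simp
        also have "\<dots> \<le> (\<Sum>i\<in>UNIV. l i * (x $ i)\<^sup>2)"
          by (rule member_le_sum) (auto simp: l less_imp_le)
        finally show "0 < x \<bullet> (diag l *v x)" by (simp add: quadratic_form_diag)
      qed
      moreover have "invertible Q" using QQ by (auto simp: invertible_def)
      ultimately show ?thesis unfolding B_def by (rule congruence_pos_def)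
    qed
    define w where "w y = Q *v augment y" for y
    have qB: "qf B y = (\<Sum>i\<in>UNIV. l i * (w y $ i)\<^sup>2)" for y
      unfolding qf_def B_def w_def quadratic_form_congruence quadratic_form_diag ..
    have nw: "(norm (augment y))\<^sup>2 = (\<Sum>i\<in>UNIV. (w y $ i)\<^sup>2)" for y
      using quadratic_form_congruence[of "augment y" Q "mat 1"] QQ(1) unfolding power2_norm_eq_inner
      by (simp add: w_def inner_vec_def[of "Q *v augment y"] power2_eq_square)
    \<comment> \<open>positive parts of the logarithms of the eigenvalues, and the negative part of the smallest one\<close>
    define lp where "lp i = max 0 (ln (l i))" for i
    define Mp where "Mp = Max (range lp)"
    define m where "m = Min (range l)"
    define mm where "mm = max 0 (- ln m)"
    have lpM: "lp i \<le> Mp" for i unfolding Mp_def by simp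
    have m: "0 < m" "m \<le> l i" for i unfolding m_def using l by auto
    have Mp0: "0 \<le> Mp" using lpM[of None] by (simp add: lp_def)
    \<comment> \<open>the largest contribution of a direction that is not nearly orthogonal to the observation\<close>
    define g where "g y i = (if e * norm (augment y) \<le> \<bar>w y $ i\<bar> then lp i else 0)" for y i
    define f where "f y = Max (range (g y))" for y
    have g: "0 \<le> g y i" "g y i \<le> Mp" for y i using lpM[of i] Mp0 by (auto simp: g_def lp_def)
    have f: "0 \<le> f y" "f y \<le> Mp" for y
    proof -
      have "g y None \<le> f y" unfolding f_def by (rule Max_ge) auto
      then show "0 \<le> f y" using g(1)[of y None] by linarith
      show "f y \<le> Mp" unfolding f_def by (rule Max.boundedI) (auto simp: g(2))
    qed
    have f_gt: "t < f y \<longleftrightarrow> y \<notin> thin e Q {i. t < lp i}" if "0 \<le> t" for t y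
    proof -
      have "t < f y \<longleftrightarrow> (\<exists>i. t < g y i)" unfolding f_def by (subst Max_gr_iff) auto
      also have "\<dots> \<longleftrightarrow> y \<notin> thin e Q {i. t < lp i}"
        using that by (auto simp: g_def thin_def w_def not_less split: if_splits)
      finally show ?thesis .
    qed
    have f_level: "{y. t < f y} = (if 0 \<le> t then - thin e Q {i. t < lp i} else UNIV)" for t
      using f_gt f(1) by (auto simp: not_le intro: less_le_trans)
    have fm: "f \<in> borel_measurable borel"
      by (rule borel_measurableI_greater) (simp add: f_level thin_sets borel_comp)
    have fmP: "f \<in> borel_measurable P" using fm sP measurable_cong_sets by blast
    have pw: "f y - mm * indicator far y - C0 \<le> log_ratio c B y" for y
    proof -
      have hom1: "1 \<le> (norm (augment y))\<^sup>2" by (rule norm_augment_ge_1)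
      have den: "0 < c + (norm (augment y))\<^sup>2" using c by (simp add: add_pos_nonneg)
      have den_le: "c + (norm (augment y))\<^sup>2 \<le> (c + 1) * (norm (augment y))\<^sup>2"
        using mult_left_mono[OF hom1, of c] c by (simp add: distrib_right)
      have mm0: "0 \<le> mm" by (simp add: mm_def)
      have qge: "l i * (w y $ i)\<^sup>2 \<le> qf B y" for i
        unfolding qB by (rule member_le_sum) (auto simp: l less_imp_le)
      show ?thesis
      proof (cases "0 < f y")
        case True
        then obtain i where i: "e * norm (augment y) \<le> \<bar>w y $ i\<bar>" "f y = lp i" "0 < lp i"
        proof -
          have "f y \<in> range (g y)" unfolding f_def by (intro Max_in) auto
          then show ?thesis using True that by (auto simp: g_def split: if_splits)
        qed
        have "(e * norm (augment y))\<^sup>2 \<le> (w y $ i)\<^sup>2" using power_mono[OF i(1), of 2] e(1) by simp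
        then have "l i * (e * norm (augment y))\<^sup>2 \<le> l i * (w y $ i)\<^sup>2" using l[of i] by (intro mult_left_mono) auto
        then have "l i * (e\<^sup>2 * (norm (augment y))\<^sup>2) \<le> c + qf B y"
          using qge[of i] c unfolding power_mult_distrib by linarith
        moreover have "l i * (e\<^sup>2 / (c + 1)) * (c + (norm (augment y))\<^sup>2) \<le> l i * (e\<^sup>2 / (c + 1)) * ((c + 1) * (norm (augment y))\<^sup>2)"
          using l[of i] e(1) c den_le by (intro mult_left_mono) auto
        moreover have "l i * (e\<^sup>2 / (c + 1)) * ((c + 1) * (norm (augment y))\<^sup>2) = l i * (e\<^sup>2 * (norm (augment y))\<^sup>2)" using c by simp
        ultimately have "l i * (e\<^sup>2 / (c + 1)) \<le> (c + qf B y) / (c + (norm (augment y))\<^sup>2)"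
          using den by (simp only: pos_le_divide_eq)
        then have "ln (l i * (e\<^sup>2 / (c + 1))) \<le> log_ratio c B y"
          unfolding log_ratio_def using l[of i] e(1) c by (intro ln_mono) (auto intro: less_le_trans[of 0 "l i * (e\<^sup>2 / (c + 1))"])
        moreover have "ln (l i * (e\<^sup>2 / (c + 1))) = ln (l i) + ln (e\<^sup>2 / (c + 1))" using l[of i] e(1) c by (intro ln_mult_pos) auto
        moreover have "ln (l i) = f y" using i(2,3) by (auto simp: lp_def)
        moreover have "0 \<le> mm * indicator far y" using mm0 by simp
        ultimately show ?thesis unfolding C0_def by linarith
      next
        case False
        then have f0: "f y = 0" using f(1)[of y] by simp
        show ?thesis
        proof (cases "y \<in> far")
          case True
          have "m * (norm (augment y))\<^sup>2 \<le> qf B y"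
            unfolding nw sum_distrib_left qB by (intro sum_mono mult_right_mono m) auto
          moreover have "m * (1 / (c + 1)) * (c + (norm (augment y))\<^sup>2) \<le> m * (1 / (c + 1)) * ((c + 1) * (norm (augment y))\<^sup>2)"
            using m(1) c den_le by (intro mult_left_mono) auto
          moreover have "m * (1 / (c + 1)) * ((c + 1) * (norm (augment y))\<^sup>2) = m * (norm (augment y))\<^sup>2" using c by simp
          ultimately have "m * (1 / (c + 1)) * (c + (norm (augment y))\<^sup>2) \<le> c + qf B y" using c by linarith
          then have "m * (1 / (c + 1)) \<le> (c + qf B y) / (c + (norm (augment y))\<^sup>2)"
            using den by (simp only: pos_le_divide_eq)
          then have "ln (m * (1 / (c + 1))) \<le> log_ratio c B y"
            unfolding log_ratio_def using m(1) c by (intro ln_mono) (auto intro: less_le_trans[of 0 "m * (1 / (c + 1))"])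
          moreover have "ln (m * (1 / (c + 1))) = ln m + ln (1 / (c + 1))" using m(1) c by (intro ln_mult_pos) auto
          moreover have "- mm \<le> ln m" by (simp add: mm_def)
          moreover have "mm * indicator far y = mm" using True by simp
          ultimately show ?thesis unfolding C0_def f0 by linarith
        next
          case False
          then have "(norm (augment y))\<^sup>2 \<le> R\<^sup>2" by (intro power_mono) (auto simp: far_def)
          moreover have "0 \<le> qf B y" unfolding qB by (intro sum_nonneg mult_nonneg_nonneg) (auto simp: l less_imp_le)
          ultimately have "c / (c + R\<^sup>2) \<le> (c + qf B y) / (c + (norm (augment y))\<^sup>2)"
            using c den by (intro frac_le) auto
          then have "ln (c / (c + R\<^sup>2)) \<le> log_ratio c B y"
            unfolding log_ratio_def using c
            by (intro ln_mono) (auto intro!: divide_pos_pos add_pos_nonneg intro: less_le_trans[of 0 "c / (c + R\<^sup>2)"])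
          then show ?thesis using False unfolding C0_def f0 by simp
        qed
      qed
    qed
    have fint: "integrable P f"
      by (rule law_integrable[OF law fm, of Mp]) (use f in auto)
    have "(LINT y|P. f y - mm * indicator far y - C0) \<le> (LINT y|P. log_ratio c B y)"
      using fint farm pw integrable_log_ratio[OF law c B] by (intro integral_mono) (auto simp: emeasure_eq_measure)
    moreover have "(LINT y|P. f y - mm * indicator far y - C0) = (LINT y|P. f y) - mm * measure P far - C0"
      using fint farm by (simp add: emeasure_eq_measure prob_space)
    moreover have "mm * measure P far \<le> mm * (1 / (2 * a))"
      using R(2) unfolding far_def by (intro mult_left_mono) (auto simp: mm_def)
    ultimately have I1: "(LINT y|P. f y) - mm * (1 / (2 * a)) - C0 \<le> (LINT y|P. log_ratio c B y)" by linarith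
    have I2: "(\<Sum>i\<in>UNIV. lp i) / a + e * Mp \<le> (LINT y|P. f y)"
    proof -
      \<comment> \<open>at \<open>t = Mp\<close> no logarithm exceeds the level, hence the half-open intervals\<close>
      let ?G = "\<lambda>t. (\<Sum>i\<in>UNIV. indicator {0..<lp i} t) / a + e * indicator {0..<Mp} t"
      have lc: "set_integrable lborel {0..Mp} (\<lambda>t. measure P {y \<in> space P. t < f y})"
        "(LINT y|P. f y) = (LINT t:{0..Mp}|lborel. measure P {y \<in> space P. t < f y})"
        using layer_cake[OF _ fmP, of Mp] f finite_measure_axioms by auto
      have i1: "integrable lborel (\<lambda>t. indicator {0..<x} t :: real)" for x :: real
        by (rule integrable_real_indicator) (simp, cases "0 \<le> x", auto)
      have "(LINT t|lborel. ?G t) = (\<Sum>i\<in>UNIV. lp i) / a + e * Mp"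
        using i1 Mp0 by (simp add: lp_def)
      moreover have "(LINT t|lborel. ?G t) \<le> (LINT t:{0..Mp}|lborel. measure P {y \<in> space P. t < f y})"
        unfolding set_lebesgue_integral_def
      proof (rule integral_mono)
        show "integrable lborel ?G"
          using i1 by (intro Bochner_Integration.integrable_add integrable_divide_zero Bochner_Integration.integrable_sum integrable_mult_right) auto
        show "integrable lborel (\<lambda>t. indicator {0..Mp} t *\<^sub>R measure P {y \<in> space P. t < f y})"
          using lc(1) unfolding set_integrable_def .
        fix t :: real
        show "?G t \<le> indicator {0..Mp} t *\<^sub>R measure P {y \<in> space P. t < f y}"
        proof (cases "0 \<le> t \<and> t < Mp")
          case True
          let ?I = "{i. t < lp i}"
          have "Mp \<in> range lp" unfolding Mp_def by (intro Max_in) auto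
          then have "?I \<noteq> {}" using True by auto
          then have "measure P (thin e Q ?I) \<le> 1 - real (card ?I) / a - e" by (rule e(2)[OF QQ(2)])
          moreover have "measure P {y \<in> space P. t < f y} = 1 - measure P (thin e Q ?I)"
            using True prob_compl[of "thin e Q ?I"] by (simp add: sp f_level sP thin_sets Compl_eq_Diff_UNIV)
          moreover have "(\<Sum>i\<in>UNIV. indicator {0..<lp i} t :: real) = real (card ?I)"
            using True by (simp add: indicator_def sum.If_cases)
          ultimately show ?thesis using True by simp
        next
          case False
          then have "(\<Sum>i\<in>UNIV. indicator {0..<lp i} t :: real) = 0"
            using lpM by (intro sum.neutral) (auto simp: indicator_def intro: less_le_trans)
          then show ?thesis using False by (auto simp: indicator_def)
        qed
      qed
      ultimately show ?thesis using lc(2) by simp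
    qed
    have I3: "(\<Sum>i\<in>UNIV. ln (l i)) \<le> (\<Sum>i\<in>UNIV. lp i) - mm"
    proof -
      have "m \<in> range l" unfolding m_def by (intro Min_in) auto
      then obtain i where i: "l i = m" by auto
      have "mm = lp i - ln (l i)" by (simp add: mm_def lp_def i)
      also have "\<dots> \<le> (\<Sum>i\<in>UNIV. lp i - ln (l i))"
        by (rule member_le_sum) (auto simp: lp_def)
      finally show ?thesis by (simp add: sum_subtractf)
    qed
    have "det B = prod l UNIV"
      using det_orthonormal[OF QQ(1)] by (simp add: B_def det_mul det_diag mult.left_commute)
    moreover have "ln (prod l UNIV) = (\<Sum>i\<in>UNIV. ln (l i))"
      by (rule ln_prod) (use l in \<open>auto simp: less_imp_neq[symmetric]\<close>)
    ultimately have ld: "ln (det B) = (\<Sum>i\<in>UNIV. ln (l i))" by simp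
    have "a * ((\<Sum>i\<in>UNIV. lp i) / a + e * Mp - mm * (1 / (2 * a)) - C0) \<le> a * (LINT y|P. log_ratio c B y)"
      using I1 I2 a0 by (intro mult_left_mono) auto
    moreover have "a * ((\<Sum>i\<in>UNIV. lp i) / a + e * Mp - mm * (1 / (2 * a)) - C0) = (\<Sum>i\<in>UNIV. lp i) + a * e * Mp - mm / 2 - a * C0"
      using a0 by (simp add: algebra_simps)
    ultimately have "a * e * Mp + mm / 2 - a * C0 \<le> 2 * objective c a P B"
      using I3 unfolding objective_def ld by simp
    moreover have "min (a * e) (1 / 2) * \<bar>ln (l j)\<bar> \<le> a * e * Mp + mm / 2"
    proof (cases "0 \<le> ln (l j)")
      case True
      then have "\<bar>ln (l j)\<bar> \<le> Mp" using lpM[of j] by (simp add: lp_def)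
      then have "min (a * e) (1 / 2) * \<bar>ln (l j)\<bar> \<le> (a * e) * Mp" using a0 e(1) by (intro mult_mono) auto
      then show ?thesis by (simp add: mm_def)
    next
      case False
      have "ln m \<le> ln (l j)" using m by (intro ln_mono) auto
      then have "\<bar>ln (l j)\<bar> \<le> mm" using False by (simp add: mm_def)
      then have "min (a * e) (1 / 2) * \<bar>ln (l j)\<bar> \<le> (1 / 2) * mm" using a0 e(1) by (intro mult_mono) auto
      moreover have "0 \<le> a * e * Mp" using a0 e(1) Mp0 by simp
      ultimately show ?thesis by simp
    qed
    ultimately show ?thesis unfolding \<epsilon>_def B_def by simp
  qed
  moreover have "0 < \<epsilon>" unfolding \<epsilon>_def using a0 e(1) by simp
  ultimately show ?thesis by blast
qed

text \<open>
  A compact piece of the cone of positive definite matrices; coercivity confines the minimisation to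
  one of these.
\<close>

definition pinched_mats :: "real \<Rightarrow> real \<Rightarrow> (real ^ 'n ^ 'n) set" where
  "pinched_mats r s = {B. transpose B = B \<and> (\<forall>x. r * (norm x)\<^sup>2 \<le> x \<bullet> (B *v x) \<and> x \<bullet> (B *v x) \<le> s * (norm x)\<^sup>2)}"

lemma pinched_mats_pos_def:
  assumes "0 < r" "B \<in> pinched_mats r s" shows "B \<in> pos_def_mats"
proof -
  have "0 < x \<bullet> (B *v x)" if "x \<noteq> 0" for x
  proof -
    have "0 < r * (norm x)\<^sup>2" using assms(1) that by simp
    also have "\<dots> \<le> x \<bullet> (B *v x)" using assms(2) by (simp add: pinched_mats_def)
    finally show ?thesis .
  qed
  then show ?thesis using assms(2) by (simp add: pinched_mats_def pos_def_mats_def)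
qed

text \<open>
  Entries are bounded by polarisation of the quadratic form.
\<close>

lemma compact_pinched_mats:
  assumes "0 \<le> r" "0 \<le> s" shows "compact (pinched_mats r s :: (real ^ 'n ^ 'n) set)"
  unfolding compact_eq_bounded_closed
proof
  have "norm B \<le> real CARD('n) * real CARD('n) * (2 * s)" if B: "B \<in> pinched_mats r s" for B :: "real ^ 'n ^ 'n"
  proof (rule norm_matrix_le_entries)
    fix i j
    let ?x = "axis i 1 :: real ^ 'n" and ?y = "axis j 1 :: real ^ 'n"
    have q: "0 \<le> z \<bullet> (B *v z)" "z \<bullet> (B *v z) \<le> s * (norm z)\<^sup>2" for z
    proof -
      have "0 \<le> r * (norm z)\<^sup>2" using assms(1) by simp
      moreover have "r * (norm z)\<^sup>2 \<le> z \<bullet> (B *v z)" "z \<bullet> (B *v z) \<le> s * (norm z)\<^sup>2"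
        using B by (simp_all add: pinched_mats_def)
      ultimately show "0 \<le> z \<bullet> (B *v z)" "z \<bullet> (B *v z) \<le> s * (norm z)\<^sup>2" by linarith+
    qed
    have "?y \<bullet> (B *v ?x) = ?x \<bullet> (B *v ?y)"
    proof -
      have tB: "transpose B = B" using B by (simp add: pinched_mats_def)
      show ?thesis using inner_transpose[of ?y B ?x] unfolding tB by (simp add: inner_commute)
    qed
    then have "(?x + ?y) \<bullet> (B *v (?x + ?y)) = ?x \<bullet> (B *v ?x) + ?y \<bullet> (B *v ?y) + 2 * (?x \<bullet> (B *v ?y))"
      by (simp add: matrix_vector_right_distrib inner_simps)
    moreover have "?x \<bullet> (B *v ?y) = B $ i $ j" by (simp add: inner_axis' matrix_vector_mul_component inner_axis)
    moreover have "(norm (?x + ?y))\<^sup>2 \<le> 2\<^sup>2"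
      using norm_triangle_ineq[of ?x ?y] by (intro power_mono) auto
    then have "s * (norm (?x + ?y))\<^sup>2 \<le> s * 4" using assms(2) by (intro mult_left_mono) auto
    ultimately show "\<bar>B $ i $ j\<bar> \<le> 2 * s"
      using q[of ?x] q[of ?y] q[of "?x + ?y"] by simp
  qed
  then show "bounded (pinched_mats r s :: (real ^ 'n ^ 'n) set)" unfolding bounded_iff by blast
  have qc: "continuous_on UNIV (\<lambda>B :: real ^ 'n ^ 'n. x \<bullet> (B *v x))" for x
    unfolding matrix_vector_mult_def by (intro continuous_intros)
  have "continuous_on UNIV (transpose :: real ^ 'n ^ 'n \<Rightarrow> _)"
    unfolding transpose_def by (intro continuous_intros)
  then show "closed (pinched_mats r s :: (real ^ 'n ^ 'n) set)"
    unfolding pinched_mats_def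
    by (intro closed_Collect_conj closed_Collect_all closed_Collect_le closed_Collect_eq qc continuous_on_const continuous_on_id)
qed

lemma continuous_on_det: "continuous_on S (det :: real ^ 'n ^ 'n \<Rightarrow> real)"
  unfolding det_def by (intro continuous_intros)

lemma continuous_on_objective:
  fixes P :: "(real ^ 'd) measure"
  assumes P: "law P" and c: "0 < c" and r: "0 < r"
  shows "continuous_on (pinched_mats r s) (objective c a P)"
proof -
  have coer: "coercive r B" if "B \<in> pinched_mats r s" for B :: "real ^ 'd option ^ 'd option"
    using that by (auto simp: pinched_mats_def coercive_def)
  have le: "(LINT y|P. log_ratio c A y) - (LINT y|P. log_ratio c B y) \<le> norm (A - B) / r"
    if A: "A \<in> pinched_mats r s" and B: "B \<in> pinched_mats r s" for A B :: "real ^ 'd option ^ 'd option"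
  proof -
    note i = integrable_log_ratio[OF P c pinched_mats_pos_def[OF r A]] integrable_log_ratio[OF P c pinched_mats_pos_def[OF r B]]
    have "log_ratio c A y - log_ratio c B y \<le> norm (A - B) / r" for y
    proof -
      have s: "0 < c + (norm (augment y))\<^sup>2" using c by (simp add: add_pos_nonneg)
      note u = denominator_pos(2)[OF c r coer[OF A], of y] denominator_pos(2)[OF c r coer[OF B], of y]
      have "log_ratio c A y - log_ratio c B y = ln (c + qf A y) - ln (c + qf B y)"
        unfolding log_ratio_def using s u by (simp add: ln_div)
      also have "\<dots> \<le> ((c + qf A y) - (c + qf B y)) / (c + qf B y)" by (rule ln_diff_le[OF u])
      also have "\<dots> = qf (A - B) y / (c + qf B y)" by (simp add: qf_diff)
      also have "\<dots> \<le> norm (A - B) / r" using abs_ratio_le[OF c r coer[OF B], of "A - B" y] by linarith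
      finally show ?thesis .
    qed
    then have "(LINT y|P. log_ratio c A y - log_ratio c B y) \<le> (LINT y|P. norm (A - B) / r)"
      using i P by (intro integral_mono) (auto simp: law_def prob_space.finite_measure finite_measure.integrable_const)
    then show ?thesis using i P by (simp add: law_def prob_space.prob_space)
  qed
  have "(1 / r)-lipschitz_on (pinched_mats r s) (\<lambda>B :: real ^ 'd option ^ 'd option. LINT y|P. log_ratio c B y)"
  proof (rule lipschitz_onI)
    fix A B :: "real ^ 'd option ^ 'd option" assume "A \<in> pinched_mats r s" "B \<in> pinched_mats r s"
    then show "dist (LINT y|P. log_ratio c A y) (LINT y|P. log_ratio c B y) \<le> 1 / r * dist A B"
      using le[of A B] le[of B A] by (simp add: dist_norm norm_minus_commute abs_le_iff)
  qed (use r in simp)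
  then have "continuous_on (pinched_mats r s) (\<lambda>B :: real ^ 'd option ^ 'd option. LINT y|P. log_ratio c B y)"
    by (rule lipschitz_on_continuous_on)
  moreover have "det B \<noteq> 0" if "B \<in> pinched_mats r s" for B :: "real ^ 'd option ^ 'd option"
    using pos_def_det_pos[OF pinched_mats_pos_def[OF r that]] by simp
  ultimately show ?thesis
    unfolding objective_def by (intro continuous_intros continuous_on_det) auto
qed

theorem critical_point_exists:
  fixes P :: "(real ^ 'd) measure"
  assumes P: "P \<in> V_laws a" and c: "0 < c" and a: "real CARD('d option) < a"
  shows "\<exists>B \<in> pos_def_mats. score c a B (signed_of P) = 0"
proof -
  have law: "law P" using P by (simp add: V_laws_def)
  have a0: "0 < a" using a by (simp add: order_le_less_trans[of 0])
  obtain \<epsilon> C where \<epsilon>: "0 < \<epsilon>" and C: "\<And>(Q :: real ^ 'd option ^ 'd option) l i. transpose Q ** Q = mat 1 \<Longrightarrow> Q ** transpose Q = mat 1 \<Longrightarrow>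
    (\<forall>i. 0 < l i) \<Longrightarrow> \<epsilon> * \<bar>ln (l i)\<bar> - C \<le> objective c a P (transpose Q ** diag l ** Q)"
    using scatter_coercive[OF P c a] by blast
  define h1 where "h1 = objective c a P (mat 1)"
  define T where "T = max 0 ((h1 + C) / \<epsilon>)"
  let ?K = "pinched_mats (exp (- T)) (exp T) :: (real ^ 'd option ^ 'd option) set"
  have inK: "B \<in> ?K" if B: "B \<in> pos_def_mats" "objective c a P B \<le> h1" for B
  proof -
    obtain Q :: "real ^ 'd option ^ 'd option" and l where Q: "transpose Q ** Q = mat 1" "Q ** transpose Q = mat 1"
      "B = transpose Q ** diag l ** Q" "\<And>i. 0 < l i" using pos_def_spectral[OF B(1)] by blast
    have li: "exp (- T) \<le> l i \<and> l i \<le> exp T" for i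
    proof -
      have "\<epsilon> * \<bar>ln (l i)\<bar> \<le> h1 + C" using C[OF Q(1,2), of l i] Q(3,4) B(2) by auto
      then have "\<bar>ln (l i)\<bar> \<le> (h1 + C) / \<epsilon>" using \<epsilon> by (simp add: pos_le_divide_eq mult.commute)
      also have "\<dots> \<le> T" by (simp add: T_def)
      finally have "exp (- T) \<le> exp (ln (l i))" "exp (ln (l i)) \<le> exp T" by (auto simp: abs_le_iff)
      then show ?thesis using Q(4)[of i] by simp
    qed
    have nx: "(norm x)\<^sup>2 = (\<Sum>i\<in>UNIV. ((Q *v x) $ i)\<^sup>2)" for x
      using quadratic_form_congruence[of x Q "mat 1"] Q(1) unfolding power2_norm_eq_inner
      by (simp add: inner_vec_def[of "Q *v x"] power2_eq_square)
    have qx: "x \<bullet> (B *v x) = (\<Sum>i\<in>UNIV. l i * ((Q *v x) $ i)\<^sup>2)" for x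
      unfolding Q(3) quadratic_form_congruence quadratic_form_diag ..
    show ?thesis
      unfolding pinched_mats_def mem_Collect_eq qx nx sum_distrib_left using pos_def_sym[OF B(1)] li
      by (auto intro!: sum_mono mult_right_mono)
  qed
  have "mat 1 \<in> ?K" by (rule inK[OF mat_1_pos_def]) (simp add: h1_def)
  moreover have "compact ?K" by (rule compact_pinched_mats) auto
  moreover have "continuous_on ?K (objective c a P)" by (rule continuous_on_objective[OF law c]) simp
  ultimately obtain B where B: "B \<in> ?K" "\<And>A. A \<in> ?K \<Longrightarrow> objective c a P B \<le> objective c a P A"
    using continuous_attains_inf[of ?K "objective c a P"] by blast
  have "B \<in> pos_def_mats" using B(1) by (rule pinched_mats_pos_def[rotated]) simp
  moreover have "objective c a P B \<le> objective c a P A" if "A \<in> pos_def_mats" for A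
    using B(2)[of A] B(2)[OF \<open>mat 1 \<in> ?K\<close>] inK[OF that] unfolding h1_def by fastforce
  ultimately have "score c a B (signed_of P) = 0"
    by (intro minimum_is_critical[OF law c a0])
  then show ?thesis using \<open>B \<in> pos_def_mats\<close> by blast
qed

section \<open>Location and scatter as a scatter matrix in one more dimension\<close>

lemma sum_option: "(\<Sum>i\<in>(UNIV :: 'd::finite option set). f i) = f None + (\<Sum>p\<in>UNIV. f (Some p))"
  by (simp add: UNIV_option_conv sum.reindex)

text \<open>
  Together with the shears these give the block factorisation of the moment matrix.
\<close>

definition border :: "real ^ 'd ^ 'd \<Rightarrow> real ^ ('d::finite) option ^ 'd option" where
  "border S = (\<chi> i j. case i of None \<Rightarrow> (case j of None \<Rightarrow> 1 | Some q \<Rightarrow> 0)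
     | Some p \<Rightarrow> (case j of None \<Rightarrow> 0 | Some q \<Rightarrow> S $ p $ q))"

lemma border_nth [simp]:
  "border S $ None $ None = 1" "border S $ None $ Some q = 0"
  "border S $ Some p $ None = 0" "border S $ Some p $ Some q = S $ p $ q"
  by (simp_all add: border_def)

definition shear :: "real ^ 'd \<Rightarrow> real ^ ('d::finite) option ^ 'd option" where
  "shear \<mu> = (\<chi> i j. case i of None \<Rightarrow> (case j of None \<Rightarrow> 1 | Some q \<Rightarrow> 0)
     | Some p \<Rightarrow> (case j of None \<Rightarrow> - \<mu> $ p | Some q \<Rightarrow> if p = q then 1 else 0))"

lemma shear_nth [simp]:
  "shear \<mu> $ None $ None = 1" "shear \<mu> $ None $ Some q = 0"
  "shear \<mu> $ Some p $ None = - \<mu> $ p" "shear \<mu> $ Some p $ Some q = (if p = q then 1 else 0)"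
  by (simp_all add: shear_def)

lemma matrix_option_eqI:
  fixes A B :: "real ^ ('d::finite) option ^ 'd option"
  assumes "A $ None $ None = B $ None $ None" "\<And>q. A $ None $ Some q = B $ None $ Some q"
    "\<And>p. A $ Some p $ None = B $ Some p $ None" "\<And>p q. A $ Some p $ Some q = B $ Some p $ Some q"
  shows "A = B"
proof -
  have "A $ i $ j = B $ i $ j" for i j using assms by (cases i; cases j) auto
  then show ?thesis by (simp add: vec_eq_iff)
qed

lemma mult_option_nth:
  fixes A B :: "real ^ ('d::finite) option ^ 'd option"
  shows "(A ** B) $ i $ j = A $ i $ None * B $ None $ j + (\<Sum>p\<in>UNIV. A $ i $ Some p * B $ Some p $ j)"
  by (simp add: matrix_matrix_mult_def sum_option)

lemma delta_sums [simp]: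
  fixes g :: "'d::finite \<Rightarrow> real"
  shows "(\<Sum>r\<in>UNIV. (if p = r then 1 else 0) * g r) = g p" "(\<Sum>r\<in>UNIV. g r * (if r = p then 1 else 0)) = g p"
    "(\<Sum>r\<in>UNIV. g r * (if p = r then 1 else 0)) = g p"
proof -
  have "(\<Sum>r\<in>UNIV. (if p = r then 1 else 0) * g r) = (\<Sum>r\<in>UNIV. if p = r then g r else 0)" by (intro sum.cong) auto
  then show "(\<Sum>r\<in>UNIV. (if p = r then 1 else 0) * g r) = g p" by simp
  have "(\<Sum>r\<in>UNIV. g r * (if r = p then 1 else 0)) = (\<Sum>r\<in>UNIV. if r = p then g r else 0)" by (intro sum.cong) auto
  then show "(\<Sum>r\<in>UNIV. g r * (if r = p then 1 else 0)) = g p" by simp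
  have "(\<Sum>r\<in>UNIV. g r * (if p = r then 1 else 0)) = (\<Sum>r\<in>UNIV. if r = p then g r else 0)" by (intro sum.cong) auto
  then show "(\<Sum>r\<in>UNIV. g r * (if p = r then 1 else 0)) = g p" by simp
qed

lemma border_mult: "border (A ** B) = border A ** border B"
  by (rule matrix_option_eqI) (simp_all add: mult_option_nth, simp add: matrix_matrix_mult_def)

lemma border_mat_1: "border (mat 1) = mat 1"
  by (rule matrix_option_eqI) (simp_all add: mat_def)

lemma shear_inverse: "shear \<mu> ** shear (- \<mu>) = mat 1"
  by (rule matrix_option_eqI) (simp_all add: mult_option_nth mat_def)

lemma shear_inverse': "shear (- \<mu>) ** shear \<mu> = mat 1"
  using shear_inverse[of "- \<mu>"] by simp

lemma invertible_shear: "invertible (shear \<mu>)"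
  using shear_inverse shear_inverse' unfolding invertible_def by blast

lemma transpose_shear_inverse: "transpose (shear (- \<mu>)) ** transpose (shear \<mu>) = mat 1"
  by (metis shear_inverse matrix_transpose_mul transpose_mat)

lemma det_shear: "det (shear \<mu>) = 1"
proof -
  have span: "(\<Sum>p\<in>UNIV. (- \<mu> $ p) *s row (Some p) (mat 1 :: real ^ 'a option ^ 'a option))
      \<in> vec.span {row j (mat 1 :: real ^ 'a option ^ 'a option) | j. j \<noteq> None}"
    by (intro vec.span_sum vec.span_scale vec.span_base) auto
  have "transpose (shear \<mu>) = (\<chi> k. if k = None
      then row None (mat 1) + (\<Sum>p\<in>UNIV. (- \<mu> $ p) *s row (Some p) (mat 1)) else row k (mat 1))"
    by (rule matrix_option_eqI) (auto simp: transpose_def row_def mat_def sum_negf)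
  then have "det (transpose (shear \<mu>)) = det (mat 1 :: real ^ 'a option ^ 'a option)"
    using det_row_span[OF span] by simp
  then show ?thesis by simp
qed

lemma border_transpose: "border (transpose A) = transpose (border A)"
  by (rule matrix_option_eqI) (simp_all add: transpose_def)

text \<open>
  Diagonalising the block reduces the claim to diagonal matrices, since the bordered orthogonal matrix
  is orthogonal.
\<close>

lemma det_border:
  fixes S :: "real ^ ('d::finite) ^ 'd"
  assumes "S \<in> pos_def_mats" shows "det (border S) = det S"
proof -
  obtain Q :: "real ^ 'd ^ 'd" and l where Q: "transpose Q ** Q = mat 1" "S = transpose Q ** diag l ** Q"
    using pos_def_spectral[OF assms] by blast
  have "transpose (border Q) ** border Q = mat 1"
    by (simp add: border_transpose[symmetric] border_mult[symmetric] Q(1) border_mat_1)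
  moreover have "det (border (diag l)) = prod l UNIV"
  proof -
    have "border (diag l) = diag (\<lambda>i. case i of None \<Rightarrow> 1 | Some p \<Rightarrow> l p)"
      by (rule matrix_option_eqI) (auto simp: diag_def)
    then show ?thesis by (simp add: det_diag UNIV_option_conv prod.reindex)
  qed
  ultimately have "det (border S) = prod l UNIV"
    using det_orthonormal[of "border Q"] by (simp add: Q(2) border_mult border_transpose det_mul mult.left_commute)
  moreover have "det S = prod l UNIV"
    using det_orthonormal[OF Q(1)] by (simp add: Q(2) det_mul det_diag mult.left_commute)
  ultimately show ?thesis by simp
qed

lemma quadratic_form_border: "x \<bullet> (border S *v x) = (x $ None)\<^sup>2 + (\<chi> p. x $ Some p) \<bullet> (S *v (\<chi> p. x $ Some p))"
  by (simp add: inner_vec_def matrix_vector_mult_def sum_option power2_eq_square)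

lemma border_pos_def:
  assumes S: "S \<in> pos_def_mats" shows "border S \<in> pos_def_mats"
proof -
  have "0 < x \<bullet> (border S *v x)" if "x \<noteq> 0" for x
  proof (cases "(\<chi> p. x $ Some p) = 0")
    case True
    then have "x $ Some p = 0" for p by (simp add: vec_eq_iff)
    then have "x $ None \<noteq> 0" using that by (auto simp: vec_eq_iff) (metis not_None_eq)
    then show ?thesis unfolding quadratic_form_border True by simp
  next
    case False
    then show ?thesis unfolding quadratic_form_border
      using pos_def_pos[OF S False] by (intro add_nonneg_pos) auto
  qed
  then show ?thesis using pos_def_sym[OF S] by (simp add: pos_def_mats_def border_transpose[symmetric])
qed

lemma pos_def_of_border:
  assumes "border S \<in> pos_def_mats" shows "S \<in> pos_def_mats"
proof -
  have "transpose S = S"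
  proof -
    have "border (transpose S) = border S" using pos_def_sym[OF assms] by (simp add: border_transpose)
    then have "border (transpose S) $ Some p $ Some q = border S $ Some p $ Some q" for p q by simp
    then show ?thesis by (simp add: vec_eq_iff)
  qed
  moreover have "0 < x \<bullet> (S *v x)" if "x \<noteq> 0" for x
  proof -
    have 1: "(\<chi> p. lin_augment x $ Some p) = x" "lin_augment x $ None = 0" by (simp_all add: lin_augment_def)
    have "lin_augment x \<noteq> 0" using that 1(1) by (metis vec_lambda_eta zero_index vec_eq_iff vec_lambda_beta)
    from pos_def_pos[OF assms this] show ?thesis unfolding quadratic_form_border 1 by simp
  qed
  ultimately show ?thesis by (simp add: pos_def_mats_def)
qed

lemma pos_def_inverse:
  fixes A B :: "real ^ 'n ^ 'n"
  assumes B: "B \<in> pos_def_mats" and BA: "B ** A = mat 1"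
  shows "A \<in> pos_def_mats"
proof -
  have AB: "A ** B = mat 1" using BA by (simp add: matrix_left_right_inverse)
  have "transpose A = transpose A ** (B ** A)" by (simp add: BA)
  also have "\<dots> = transpose (B ** A) ** A"
    using pos_def_sym[OF B] by (simp add: matrix_transpose_mul matrix_mul_assoc)
  finally have tA: "transpose A = A" by (simp add: BA)
  have "transpose A ** B ** A \<in> pos_def_mats"
    using AB BA by (intro congruence_pos_def[OF B]) (auto simp: invertible_def)
  then show ?thesis by (simp add: tA AB)
qed

lemma pos_def_matrix_inv:
  fixes B :: "real ^ 'n ^ 'n"
  assumes "B \<in> pos_def_mats"
  shows "B ** matrix_inv B = mat 1" "matrix_inv B ** B = mat 1" "matrix_inv B \<in> pos_def_mats"
proof -
  have "invertible B" using pos_def_det_pos[OF assms] by (simp add: invertible_det_nz)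
  then have "B ** matrix_inv B = mat 1 \<and> matrix_inv B ** B = mat 1"
    unfolding invertible_def matrix_inv_def by (rule someI_ex)
  then show 1: "B ** matrix_inv B = mat 1" and "matrix_inv B ** B = mat 1" by auto
  show "matrix_inv B \<in> pos_def_mats" by (rule pos_def_inverse[OF assms 1])
qed

text \<open>
  The second moment matrix of an augmented vector with mean \<^term>\<open>\<mu>\<close> and covariance \<^term>\<open>\<Sigma>\<close>.
\<close>

definition moment_mat :: "real ^ 'd \<Rightarrow> real ^ 'd ^ 'd \<Rightarrow> real ^ ('d::finite) option ^ 'd option" where
  "moment_mat \<mu> \<Sigma> = shear (- \<mu>) ** border \<Sigma> ** transpose (shear (- \<mu>))"

text \<open>
  The inverse of the moment matrix, in factored form.
\<close>

definition precision_mat :: "real ^ 'd \<Rightarrow> real ^ 'd ^ 'd \<Rightarrow> real ^ ('d::finite) option ^ 'd option" where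
  "precision_mat \<mu> \<Sigma> = transpose (shear \<mu>) ** border (matrix_inv \<Sigma>) ** shear \<mu>"

lemma moment_mat_nth:
  "moment_mat \<mu> \<Sigma> $ None $ None = 1" "moment_mat \<mu> \<Sigma> $ None $ Some q = \<mu> $ q"
  "moment_mat \<mu> \<Sigma> $ Some p $ None = \<mu> $ p" "moment_mat \<mu> \<Sigma> $ Some p $ Some q = \<Sigma> $ p $ q + \<mu> $ p * \<mu> $ q"
  by (simp_all add: moment_mat_def mult_option_nth transpose_def)

lemma precision_moment_inverse:
  assumes "\<Sigma> \<in> pos_def_mats" shows "precision_mat \<mu> \<Sigma> ** moment_mat \<mu> \<Sigma> = mat 1"
proof -
  have "precision_mat \<mu> \<Sigma> ** moment_mat \<mu> \<Sigma> =
      transpose (shear \<mu>) ** (border (matrix_inv \<Sigma>) ** (shear \<mu> ** shear (- \<mu>)) ** border \<Sigma>) ** transpose (shear (- \<mu>))"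
    by (simp add: precision_mat_def moment_mat_def matrix_mul_assoc)
  also have "border (matrix_inv \<Sigma>) ** (shear \<mu> ** shear (- \<mu>)) ** border \<Sigma> = mat 1"
    by (simp add: shear_inverse border_mult[symmetric] pos_def_matrix_inv[OF assms] border_mat_1)
  finally show ?thesis
    by (simp add: matrix_transpose_mul[symmetric] shear_inverse' transpose_mat)
qed

lemma precision_pos_def: "\<Sigma> \<in> pos_def_mats \<Longrightarrow> precision_mat \<mu> \<Sigma> \<in> pos_def_mats"
  unfolding precision_mat_def by (intro congruence_pos_def border_pos_def pos_def_matrix_inv(3) invertible_shear)

lemma precision_mat_inject:
  assumes "\<Sigma> \<in> pos_def_mats" "\<Sigma>' \<in> pos_def_mats" "precision_mat \<mu> \<Sigma> = precision_mat \<mu>' \<Sigma>'"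
  shows "\<mu> = \<mu>'" "\<Sigma> = \<Sigma>'"
proof -
  have "moment_mat \<mu> \<Sigma> ** precision_mat \<mu> \<Sigma> = mat 1"
    using precision_moment_inverse[OF assms(1)] by (simp add: matrix_left_right_inverse)
  then have "moment_mat \<mu> \<Sigma> = moment_mat \<mu> \<Sigma> ** (precision_mat \<mu>' \<Sigma>' ** moment_mat \<mu>' \<Sigma>')"
    by (simp add: precision_moment_inverse[OF assms(2)])
  also have "\<dots> = moment_mat \<mu> \<Sigma> ** precision_mat \<mu> \<Sigma> ** moment_mat \<mu>' \<Sigma>'" by (simp add: matrix_mul_assoc assms(3))
  finally have eq: "moment_mat \<mu> \<Sigma> = moment_mat \<mu>' \<Sigma>'"
    using \<open>moment_mat \<mu> \<Sigma> ** precision_mat \<mu> \<Sigma> = mat 1\<close> by simp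
  show mu: "\<mu> = \<mu>'"
    unfolding vec_eq_iff using arg_cong[OF eq, of "\<lambda>A. A $ Some _ $ None"] by (simp add: moment_mat_nth)
  show "\<Sigma> = \<Sigma>'"
    unfolding vec_eq_iff using arg_cong[OF eq, of "\<lambda>A. A $ Some _ $ Some _"] by (simp add: moment_mat_nth mu)
qed

text \<open>
  A matrix of the larger space comes from a location and a scatter as soon as the corner of its inverse
  is 1, and these can be read off the inverse.
\<close>

lemma precision_mat_surj:
  fixes A B :: "real ^ ('d::finite) option ^ 'd option"
  assumes B: "B \<in> pos_def_mats" and BA: "B ** A = mat 1" and A1: "A $ None $ None = 1"
  defines "\<mu> \<equiv> \<chi> p. A $ Some p $ None"
  defines "\<Sigma> \<equiv> \<chi> p q. A $ Some p $ Some q - A $ Some p $ None * A $ Some q $ None"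
  shows "\<Sigma> \<in> pos_def_mats" "B = precision_mat \<mu> \<Sigma>"
proof -
  have A: "A \<in> pos_def_mats" by (rule pos_def_inverse[OF B BA])
  have sym: "A $ None $ Some p = A $ Some p $ None" for p
    using arg_cong[OF pos_def_sym[OF A], of "\<lambda>M. M $ None $ Some p"] by (simp add: transpose_def)
  have AM: "A = moment_mat \<mu> \<Sigma>"
    by (rule matrix_option_eqI) (simp_all add: moment_mat_nth A1 sym \<mu>_def \<Sigma>_def)
  have "shear \<mu> ** A ** transpose (shear \<mu>) = (shear \<mu> ** shear (- \<mu>)) ** border \<Sigma> ** (transpose (shear (- \<mu>)) ** transpose (shear \<mu>))"
    by (simp add: AM moment_mat_def matrix_mul_assoc)
  also have "\<dots> = border \<Sigma>" by (simp add: shear_inverse transpose_shear_inverse)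
  finally have "border \<Sigma> = transpose (transpose (shear \<mu>)) ** A ** transpose (shear \<mu>)" by simp
  also have "\<dots> \<in> pos_def_mats"
    by (intro congruence_pos_def A) (simp add: invertible_det_nz det_shear)
  finally show \<Sigma>: "\<Sigma> \<in> pos_def_mats" by (rule pos_def_of_border)
  have "B ** (moment_mat \<mu> \<Sigma> ** precision_mat \<mu> \<Sigma>) = precision_mat \<mu> \<Sigma>"
    using BA by (simp add: AM[symmetric] matrix_mul_assoc)
  moreover have "moment_mat \<mu> \<Sigma> ** precision_mat \<mu> \<Sigma> = mat 1"
    using precision_moment_inverse[OF \<Sigma>] by (simp add: matrix_left_right_inverse)
  ultimately show "B = precision_mat \<mu> \<Sigma>" by simp
qed

lemma qf_precision_mat: "qf (precision_mat \<mu> \<Sigma>) y = 1 + (y - \<mu>) \<bullet> (matrix_inv \<Sigma> *v (y - \<mu>))"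
proof -
  have "shear \<mu> *v augment y = augment (y - \<mu>)"
  proof -
    have "(shear \<mu> *v augment y) $ i = augment (y - \<mu>) $ i" for i
      by (cases i) (simp_all add: matrix_vector_mult_def sum_option)
    then show ?thesis by (simp add: vec_eq_iff)
  qed
  moreover have "(\<chi> p. augment (y - \<mu>) $ Some p) = y - \<mu>" by (simp add: vec_eq_iff)
  ultimately show ?thesis
    unfolding qf_def precision_mat_def quadratic_form_congruence by (simp only: quadratic_form_border augment_None) simp
qed

text \<open>
  Adjoining a coordinate lowers the constant \<^term>\<open>\<nu>\<close> by one, since the augmented quadratic form
  exceeds the original one by 1. The hypothesis on \<^term>\<open>\<nu>\<close> keeps the new constant positive.
\<close>

lemma t_objective_eq:
  fixes P :: "(real ^ 'd) measure"
  assumes \<nu>: "\<nu> > 1" and \<Sigma>: "\<Sigma> \<in> pos_def_mats"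
  shows "t_objective \<nu> P (\<mu>, \<Sigma>) = objective (\<nu> - 1) (\<nu> + real CARD('d)) P (precision_mat \<mu> \<Sigma>)"
proof -
  let ?S = "matrix_inv \<Sigma>"
  note inv = pos_def_matrix_inv[OF \<Sigma>]
  have pt: "rho \<nu> CARD('d) ((y - \<mu>) \<bullet> (?S *v (y - \<mu>))) - rho \<nu> CARD('d) (y \<bullet> y)
      = (\<nu> + real CARD('d)) / 2 * log_ratio (\<nu> - 1) (precision_mat \<mu> \<Sigma>) y" for y
  proof -
    have "0 \<le> (y - \<mu>) \<bullet> (?S *v (y - \<mu>))"
      using pos_def_pos[OF inv(3), of "y - \<mu>"] by (cases "y = \<mu>") (auto simp: less_imp_le)
    then have s: "0 < \<nu> + (y - \<mu>) \<bullet> (?S *v (y - \<mu>))" using \<nu> by linarith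
    have "0 < \<nu> + y \<bullet> y" using \<nu> by (simp add: add_pos_nonneg)
    moreover have "\<nu> - 1 + (norm (augment y))\<^sup>2 = \<nu> + y \<bullet> y"
      unfolding norm_augment_sq unfolding power2_norm_eq_inner by simp
    ultimately show ?thesis
      using s \<nu> unfolding rho_def log_ratio_def qf_precision_mat right_diff_distrib[symmetric]
      by (simp add: ln_div)
  qed
  have ld: "ln (det (precision_mat \<mu> \<Sigma>)) = - ln (det \<Sigma>)"
  proof -
    have "det (precision_mat \<mu> \<Sigma>) = det ?S"
      by (simp add: precision_mat_def det_mul det_shear det_border[OF inv(3)])
    moreover have "det \<Sigma> * det ?S = 1" by (metis inv(1) det_mul det_I)
    then have "ln (det \<Sigma>) + ln (det ?S) = 0"
      using pos_def_det_pos[OF \<Sigma>] pos_def_det_pos[OF inv(3)] by (metis ln_mult_pos ln_one)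
    ultimately show ?thesis by simp
  qed
  show ?thesis unfolding t_objective_def objective_def prod.case pt ld by simp
qed

section \<open>Smoothness of the location and scatter functional\<close>

text \<open>
  The trace of the critical equation determines the total weight of the law, which is the corner
  entry. Total mass 1 is essential here.
\<close>

lemma critical_corner:
  fixes P :: "(real ^ 'd) measure"
  assumes P: "law P" and c: "0 < c" and a: "a = c + real CARD('d option)"
    and \<kappa>: "0 < \<kappa>" "coercive \<kappa> B" and crit: "score c a B (signed_of P) = 0"
  shows "weighted_moment c a B (signed_of P) $ None $ None = 1" "B \<in> pos_def_mats"
proof -
  let ?A = "weighted_moment c a B (signed_of P)"
  have BA: "B ** ?A = mat 1" using crit by (simp add: score_def)
  then have AB: "?A ** B = mat 1" by (simp add: matrix_left_right_inverse)
  have tB: "transpose B = B"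
  proof -
    have "?A ** transpose B = mat 1"
      using arg_cong[OF BA, of transpose] by (simp add: matrix_transpose_mul weighted_moment_symmetric transpose_mat)
    then have "B ** (?A ** transpose B) = B" by simp
    then show ?thesis by (simp add: matrix_mul_assoc BA)
  qed
  have "0 < x \<bullet> (B *v x)" if "x \<noteq> 0" for x
    using \<kappa> that unfolding coercive_def by (meson less_le_trans mult_pos_pos zero_less_norm_iff zero_less_power)
  then show "B \<in> pos_def_mats" using tB by (simp add: pos_def_mats_def)
  have "a * J c B [B] (signed_of P) = B \<bullet> ?A" by (rule weighted_moment_inner[OF c \<kappa>])
  also have "\<dots> = (B ** mat 1) \<bullet> ?A" by simp
  also have "\<dots> = diag (\<lambda>_. 1) \<bullet> (mat 1 :: real ^ 'd option ^ 'd option)"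
    unfolding inner_matrix_mult_left tB BA by (simp add: diag_def mat_def)
  also have "\<dots> = real CARD('d option)" unfolding inner_diag_mat_1 by simp
  finally have tr: "a * J c B [B] (signed_of P) = real CARD('d option)" .
  interpret prob_space P using P by (simp add: law_def)
  let ?E = "matrix_unit None None :: real ^ 'd option ^ 'd option"
  have "kernel c B [B] y = 1 - c * kernel c B [?E] y" for y
    using denominator_pos(2)[OF c \<kappa>, of y] by (simp add: kernel_def qf_matrix_unit field_simps)
  then have "J c B [B] (signed_of P) = (LINT y|P. 1 - c * kernel c B [?E] y)"
    by (simp add: law_J(1)[OF P c \<kappa>])
  also have "\<dots> = 1 - c * J c B [?E] (signed_of P)"
    using law_J[OF P c \<kappa>, of "[?E]"] by (simp add: prob_space)
  finally have JB: "J c B [B] (signed_of P) = 1 - c * J c B [?E] (signed_of P)" .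
  have "a - c * (a * J c B [?E] (signed_of P)) = real CARD('d option)"
    using tr unfolding JB by (simp add: right_diff_distrib mult.left_commute)
  then have "c * (a * J c B [?E] (signed_of P)) = c" using a by linarith
  then show "?A $ None $ None = 1" using c by (simp add: weighted_moment_def)
qed

definition location_scatter :: "real ^ ('d::finite) option ^ 'd option \<Rightarrow> (real ^ 'd) \<times> (real ^ 'd ^ 'd)" where
  "location_scatter A = (\<chi> p. A $ Some p $ None, \<chi> p q. A $ Some p $ Some q - A $ Some p $ None * A $ Some q $ None)"

text \<open>
  The pair belonging to the critical matrix beats every other pair because their objectives are values
  of one and the same function on the larger cone.
\<close>

lemma t_functional_eq:
  fixes P :: "(real ^ 'd) measure"
  assumes P: "P \<in> V_laws (\<nu> + real CARD('d))" and \<nu>: "\<nu> > 1"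
    and \<kappa>: "0 < \<kappa>" "coercive \<kappa> B" and crit: "score (\<nu> - 1) (\<nu> + real CARD('d)) B (signed_of P) = 0"
  shows "t_functional \<nu> P = location_scatter (weighted_moment (\<nu> - 1) (\<nu> + real CARD('d)) B (signed_of P))"
proof -
  let ?c = "\<nu> - 1" and ?a = "\<nu> + real CARD('d)"
  let ?A = "weighted_moment ?c ?a B (signed_of P)"
  have law: "law P" using P by (simp add: V_laws_def)
  have nd: "nondegenerate P" using \<nu> by (intro V_laws_nondegenerate[OF P]) simp
  have c: "0 < ?c" and a: "0 < ?a" using \<nu> by auto
  have corner: "?A $ None $ None = 1" and B: "B \<in> pos_def_mats"
    by (rule critical_corner[OF law c _ \<kappa> crit]; simp)+
  have BA: "B ** ?A = mat 1" using crit by (simp add: score_def)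
  obtain \<mu> \<Sigma> where ms: "location_scatter ?A = (\<mu>, \<Sigma>)" by fastforce
  have \<Sigma>: "\<Sigma> \<in> pos_def_mats" and Bp: "B = precision_mat \<mu> \<Sigma>"
    using precision_mat_surj[OF B BA corner] ms by (auto simp: location_scatter_def)
  have strict: "t_objective \<nu> P (\<mu>, \<Sigma>) < t_objective \<nu> P (\<mu>', \<Sigma>')"
    if "\<Sigma>' \<in> pos_def_mats" "(\<mu>', \<Sigma>') \<noteq> (\<mu>, \<Sigma>)" for \<mu>' \<Sigma>'
  proof -
    have "precision_mat \<mu>' \<Sigma>' \<noteq> B" using precision_mat_inject[OF that(1) \<Sigma>] that(2) Bp by metis
    then have "objective ?c ?a P B < objective ?c ?a P (precision_mat \<mu>' \<Sigma>')"
      by (intro critical_point_strict_minimum[OF law nd c a B crit] precision_pos_def that)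
    then show ?thesis by (simp add: t_objective_eq[OF \<nu>] \<Sigma> that(1) Bp)
  qed
  show ?thesis
    unfolding t_functional_def ms
  proof (rule the_equality)
    show "is_arg_min (t_objective \<nu> P) (\<lambda>\<theta>. \<theta> \<in> UNIV \<times> pos_def_mats) (\<mu>, \<Sigma>)"
      unfolding is_arg_min_def
    proof (intro conjI notI)
      show "(\<mu>, \<Sigma>) \<in> UNIV \<times> pos_def_mats" using \<Sigma> by simp
      assume "\<exists>\<theta>. \<theta> \<in> UNIV \<times> pos_def_mats \<and> t_objective \<nu> P \<theta> < t_objective \<nu> P (\<mu>, \<Sigma>)"
      then obtain \<mu>' \<Sigma>' where "\<Sigma>' \<in> pos_def_mats" and less: "t_objective \<nu> P (\<mu>', \<Sigma>') < t_objective \<nu> P (\<mu>, \<Sigma>)"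
        by auto
      moreover have "(\<mu>', \<Sigma>') \<noteq> (\<mu>, \<Sigma>)" using less by (metis less_irrefl)
      ultimately show False using strict[of \<Sigma>' \<mu>'] by (meson less_asym)
    qed
    fix \<theta> assume "is_arg_min (t_objective \<nu> P) (\<lambda>\<theta>. \<theta> \<in> UNIV \<times> pos_def_mats) \<theta>"
    then have adm: "\<theta> \<in> UNIV \<times> pos_def_mats" and
      min: "\<And>\<theta>'. \<theta>' \<in> UNIV \<times> pos_def_mats \<Longrightarrow> \<not> t_objective \<nu> P \<theta>' < t_objective \<nu> P \<theta>"
      unfolding is_arg_min_def by blast+
    obtain \<mu>' \<Sigma>' where \<theta>: "\<theta> = (\<mu>', \<Sigma>')" by (rule prod.exhaust)
    show "\<theta> = (\<mu>, \<Sigma>)"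
    proof (rule ccontr)
      assume "\<theta> \<noteq> (\<mu>, \<Sigma>)"
      then have "t_objective \<nu> P (\<mu>, \<Sigma>) < t_objective \<nu> P \<theta>"
        unfolding \<theta> using adm \<theta> by (intro strict) auto
      then show False using min[of "(\<mu>, \<Sigma>)"] \<Sigma> by simp
    qed
  qed
qed

theorem corollary24:
  fixes \<nu> :: real and k :: nat and P :: "(real ^ 'd) measure"
  assumes "\<nu> > 1" and "k \<ge> 1"
    and "P \<in> V_laws (\<nu> + real CARD('d))"
  shows "frechet_Ck_at k (poly_norm (2 * k + 4)) (V_laws (\<nu> + real CARD('d))) (t_functional \<nu>) P"
proof -
  let ?c = "\<nu> - 1" and ?a = "\<nu> + real CARD('d)"
  have c: "0 < ?c" and a: "0 < ?a" and da: "real CARD('d option) < ?a" using assms(1) by auto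
  have law: "law P" using assms(3) by (simp add: V_laws_def)
  obtain B0 where B0: "B0 \<in> pos_def_mats" "score ?c ?a B0 (signed_of P) = 0"
    using critical_point_exists[OF assms(3) c da] by blast
  obtain \<kappa>2 where \<kappa>2: "0 < \<kappa>2" "coercive \<kappa>2 B0" using pos_def_coercive[OF B0(1)] by blast
  define \<kappa> where "\<kappa> = \<kappa>2 / 2"
  have \<kappa>: "0 < \<kappa>" "coercive (2 * \<kappa>) B0" using \<kappa>2 by (simp_all add: \<kappa>_def)
  have "score_deriv ?c ?a B0 (signed_of P) H = 0 \<Longrightarrow> H = 0" for H
    by (rule critical_point_nondegenerate[OF law V_laws_nondegenerate[OF assms(3) da] c a B0])
  then obtain \<delta> R M b where "implicit_branch k (signed_of P) \<delta> ?c ?a \<kappa> R M b"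
    using implicit_branch_exists[OF c \<kappa>(1) less_imp_le[OF a] \<kappa>(2) B0(2)] by blast
  then interpret implicit_branch k "signed_of P" \<delta> ?c ?a \<kappa> R M b .
  define F where "F \<phi> = location_scatter (weighted_moment ?c ?a (b \<phi>) \<phi>)" for \<phi>
  have "smooth (Suc k) {} (\<lambda>\<phi> _. F \<phi> \<bullet> u)" if "u \<in> Basis" for u
  proof -
    note sm = smooth_weighted_moment
    have "(\<exists>p. u = (axis p 1, 0)) \<or> (\<exists>p q. u = (0, axis p (axis q 1)))"
      using that by (auto simp: Basis_prod_def Basis_vec_def)
    then consider p where "u = (axis p 1, 0)" | p q where "u = (0, axis p (axis q 1))" by blast
    then show ?thesis
    proof cases
      case 1
      then show ?thesis using sm by (simp add: F_def location_scatter_def inner_axis del: smooth.simps)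
    next
      case 2
      have "smooth (Suc k) {} (\<lambda>\<phi> _. weighted_moment ?c ?a (b \<phi>) \<phi> $ Some p $ Some q +
          - (weighted_moment ?c ?a (b \<phi>) \<phi> $ Some p $ None * weighted_moment ?c ?a (b \<phi>) \<phi> $ Some q $ None))"
        by (intro smooth_add smooth_uminus smooth_mult_scalar sm)
      then show ?thesis using 2 by (simp add: F_def location_scatter_def inner_axis del: smooth.simps)
    qed
  qed
  then have "Ck_on_wrt k (poly_norm (2 * k + 4)) U F" by (rule smooth_imp_Ck_on_wrt)
  moreover have "F (signed_of Q) = t_functional \<nu> Q" if "Q \<in> V_laws ?a" "signed_of Q \<in> U" for Q
    unfolding F_def by (rule t_functional_eq[OF that(1) assms(1) \<kappa>(1) coerc[OF that(2)] solves[OF that(2)], symmetric])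
  ultimately show ?thesis
    unfolding frechet_Ck_at_def using U_open center_in_U by blast
qed

end
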